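(* Let $\kappa,\lambda\in\mathbb{R}$, let ${\rm Y}$ be a locally ${\sf CAT}(\kappa)$ space and let ${\sf E}\colon{\rm Y}\to\mathbb{R}\cup\{+\infty\}$ be $\lambda$-convex and lower semicontinuous. Let $y\in\overline{D({\sf E})}$ and let $(y_t)$ be the gradient flow trajectory of ${\sf E}$ starting from $y$ (with $y_0:=y$). Then for every $t>0$ the vectors $\frac1h({\sf G}_{y_t}^{y_{t+h}})'_0\in{\rm T}_{y_t}{\rm Y}$ (defined for $h>0$ small enough) converge strongly in ${\rm T}_{y_t}{\rm Y}$, as $h\downarrow0$, to the element of minimal norm of $-\partial^-{\sf E}(y_t)$. The same holds at $t=0$ if and only if $y\in D(|\partial^-{\sf E}|)$. Moreover $D(-\partial^-{\sf E})=D(|\partial^-{\sf E}|)$, and \[ |\partial^-{\sf E}|(z)=\min_{v\in-\partial^-{\sf E}(z)}|v|_z\qquad\text{for every }z\in D({\sf E}), \] where the minimum of the empty set is $+\infty$. In particular $D(-\partial^-{\sf E})$ is dense in $D({\sf E})$.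
   Context: Locally ${\sf CAT}(\kappa)$ space: complete geodesic metric space $({\rm Y},{\sf d}_{\rm Y})$ in which every point has a neighbourhood that is ${\sf CAT}(\kappa)$ (geodesic triangles of perimeter $<2D_\kappa$ are thinner than comparison triangles in the model plane $\mathbb{M}_\kappa$ of constant curvature $\kappa$; $D_\kappa=\pi/\sqrt\kappa$ if $\kappa>0$, $\infty$ otherwise). For $y\in{\rm Y}$, ${\sf r}_y:=\sup\{r\le D_\kappa/2:\bar B_r(y)\text{ is }{\sf CAT}(\kappa)\}$ and for $z\in B_{{\sf r}_y}(y)$, ${\sf G}_y^z\colon[0,1]\to{\rm Y}$ is the unique constant speed geodesic from $y$ to $z$ (the vectors in the claim are defined for $h$ with $y_{t+h}\in B_{{\sf r}_{y_t}}(y_t)$). Tangent cone ${\rm T}_y{\rm Y}$: completion of the set of constant speed geodesics $\gamma$ emanating from $y$ modulo ${\sf d}_y(\gamma,\eta):=\lim_{t\downarrow0}{\sf d}_{\rm Y}(\gamma_t,\eta_t)/t=0$, with distance ${\sf d}_y$; $\gamma'_0$ the class of $\gamma$, $0_y$ that of the constant curve; $\alpha\gamma'_0$ ($\alpha\ge0$) the class of $t\mapsto\gamma_{\alpha t}$, extended by continuity; $|v|_y:={\sf d}_y(v,0_y)$, $\langle v,w\rangle_y:=\frac12(|v|_y^2+|w|_y^2-{\sf d}_y^2(v,w))$; strong convergence means convergence in ${\sf d}_y$. $\lambda$-convexity: ${\sf E}(\gamma_t)\le(1-t){\sf E}(\gamma_0)+t{\sf E}(\gamma_1)-\frac\lambda2t(1-t){\sf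 d}^2_{\rm Y}(\gamma_0,\gamma_1)$ along every constant speed geodesic $\gamma\colon[0,1]\to{\rm Y}$; $D({\sf E})=\{{\sf E}<\infty\}$. Slope: $|\partial^-{\sf E}|(y):=\limsup_{z\to y}\frac{({\sf E}(y)-{\sf E}(z))^+}{{\sf d}_{\rm Y}(y,z)}$ for $y\in D({\sf E})$; $D(|\partial^-{\sf E}|)$ is where it is finite. Minus-subdifferential: for $y\in D({\sf E})$, $-\partial^-{\sf E}(y)$ is the set of $v\in{\rm T}_y{\rm Y}$ such that for every $z\in{\rm Y}$ there is a geodesic $\gamma\colon[0,1]\to{\rm Y}$ from $y$ to $z$ with ${\sf E}(y)-\langle v,\gamma'_0\rangle_y+\frac\lambda2{\sf d}^2_{\rm Y}(y,z)\le{\sf E}(z)$; $D(-\partial^-{\sf E})$ is the set where it is nonempty; when nonempty it has a unique element of minimal norm. Gradient flow trajectory starting from $y\in\overline{D({\sf E})}$: a locally absolutely continuous curve $(0,\infty)\ni t\mapsto y_t$ with $y_t\to y$ as $t\downarrow0$ such that for every $w\in{\rm Y}$, $\frac{{\rm d}}{{\rm d}t}\frac{{\sf d}^2_{\rm Y}(y_t,w)}{2}+{\sf E}(y_t)+\frac\lambda2{\sf d}^2_{\rm Y}(y_t,w)\le{\sf E}(w)$ for a.e. $t>0$ (equivalently, energy dissipation formulations); it exists and is unique. *)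

theory Defs
  imports "HOL-Analysis.Analysis"
begin

definition cs_geodesic_on :: "real \<Rightarrow> (real \<Rightarrow> 'a::metric_space) \<Rightarrow> bool" where
  "cs_geodesic_on T g \<longleftrightarrow>
     (\<exists>L\<ge>0. \<forall>s\<in>{0..T}. \<forall>t\<in>{0..T}. dist (g s) (g t) = L * \<bar>s - t\<bar>)"

definition geodesic_from_to :: "(real \<Rightarrow> 'a::metric_space) \<Rightarrow> 'a \<Rightarrow> 'a \<Rightarrow> bool" where
  "geodesic_from_to g x z \<longleftrightarrow> cs_geodesic_on 1 g \<and> g 0 = x \<and> g 1 = z"

definition geodesic_space :: "'a::metric_space itself \<Rightarrow> bool" where
  "geodesic_space _ \<longleftrightarrow> (\<forall>x z::'a. \<exists>g. geodesic_from_to g x z)"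

section \<open>Model space comparison (law of cosines in M_kappa)\<close>

definition below_D :: "real \<Rightarrow> real \<Rightarrow> bool" where
  "below_D \<kappa> r \<longleftrightarrow> \<kappa> \<le> 0 \<or> r < pi / sqrt \<kappa>"

text \<open>Distance in M_kappa between two points at distances a, b from a common
  point, the two segments forming the angle th.\<close>
definition model_dist :: "real \<Rightarrow> real \<Rightarrow> real \<Rightarrow> real \<Rightarrow> real" where
  "model_dist \<kappa> a b th =
    (if \<kappa> = 0 then sqrt (a\<^sup>2 + b\<^sup>2 - 2 * a * b * cos th)
     else if \<kappa> > 0 then
       (let k = sqrt \<kappa> in
        arccos (cos (k*a) * cos (k*b) + sin (k*a) * sin (k*b) * cos th) / k)
     else
       (let k = sqrt (- \<kappa>) in
        arcosh (cosh (k*a) * cosh (k*b) - sinh (k*a) * sinh (k*b) * cos th) / k))"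

text \<open>Angle at the vertex of the comparison triangle in M_kappa with side lengths
  a, b adjacent to the vertex and c opposite to it.\<close>
definition model_angle :: "real \<Rightarrow> real \<Rightarrow> real \<Rightarrow> real \<Rightarrow> real" where
  "model_angle \<kappa> a b c =
    (if \<kappa> = 0 then arccos ((a\<^sup>2 + b\<^sup>2 - c\<^sup>2) / (2 * a * b))
     else if \<kappa> > 0 then
       (let k = sqrt \<kappa> in
        arccos ((cos (k*c) - cos (k*a) * cos (k*b)) / (sin (k*a) * sin (k*b))))
     else
       (let k = sqrt (- \<kappa>) in
        arccos ((cosh (k*a) * cosh (k*b) - cosh (k*c)) / (sinh (k*a) * sinh (k*b)))))"

text \<open>Comparison inequality for two sides g, h (parametrised on [0,1]) of a
  geodesic triangle issuing from the common vertex g 0 = h 0: points on them are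
  not farther apart than the corresponding points of the comparison triangle.\<close>
definition thin_pair :: "real \<Rightarrow> (real \<Rightarrow> 'a::metric_space) \<Rightarrow> (real \<Rightarrow> 'a) \<Rightarrow> bool" where
  "thin_pair \<kappa> g h \<longleftrightarrow>
    (let a = dist (g 0) (g 1); b = dist (h 0) (h 1); c = dist (g 1) (h 1) in
     \<forall>s\<in>{0..1}. \<forall>u\<in>{0..1}.
       dist (g s) (h u) \<le> model_dist \<kappa> (s * a) (u * b) (model_angle \<kappa> a b c))"

definition rev_curve :: "(real \<Rightarrow> 'a) \<Rightarrow> real \<Rightarrow> 'a" where
  "rev_curve g = (\<lambda>t. g (1 - t))"

definition cat_space :: "real \<Rightarrow> 'a::metric_space set \<Rightarrow> bool" where
  "cat_space \<kappa> S \<longleftrightarrow>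
    (\<forall>x\<in>S. \<forall>z\<in>S. below_D \<kappa> (dist x z) \<longrightarrow>
        (\<exists>g. geodesic_from_to g x z \<and> g ` {0..1} \<subseteq> S)) \<and>
    (\<forall>g1 g2 g3.
       cs_geodesic_on 1 g1 \<and> cs_geodesic_on 1 g2 \<and> cs_geodesic_on 1 g3 \<and>
       g1 ` {0..1} \<subseteq> S \<and> g2 ` {0..1} \<subseteq> S \<and> g3 ` {0..1} \<subseteq> S \<and>
       g1 1 = g2 0 \<and> g2 1 = g3 0 \<and> g3 1 = g1 0 \<and>
       below_D \<kappa> ((dist (g1 0) (g1 1) + dist (g2 0) (g2 1) + dist (g3 0) (g3 1)) / 2)
       \<longrightarrow> thin_pair \<kappa> g1 (rev_curve g3) \<and> thin_pair \<kappa> g2 (rev_curve g1) \<and>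
           thin_pair \<kappa> g3 (rev_curve g2))"

definition locally_CAT :: "real \<Rightarrow> 'a::complete_space itself \<Rightarrow> bool" where
  "locally_CAT \<kappa> T \<longleftrightarrow> geodesic_space T \<and>
     (\<forall>y::'a. \<exists>U. y \<in> interior U \<and> cat_space \<kappa> U)"

text \<open>r_y (as an extended real, since D_kappa = infinity for kappa <= 0).\<close>
definition cat_radius :: "real \<Rightarrow> 'a::metric_space \<Rightarrow> ereal" where
  "cat_radius \<kappa> y = Sup {ereal r | r. 0 < r \<and> (\<kappa> \<le> 0 \<or> r \<le> pi / sqrt \<kappa> / 2)
                                   \<and> cat_space \<kappa> (cball y r)}"

definition Geo :: "'a::metric_space \<Rightarrow> 'a \<Rightarrow> real \<Rightarrow> 'a" where
  "Geo y z = (THE g. geodesic_from_to g y z \<and> (\<forall>t. t \<notin> {0..1} \<longrightarrow> g t = y))"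

definition geods_from :: "'a::metric_space \<Rightarrow> (real \<Rightarrow> 'a) set" where
  "geods_from y = {g. g 0 = y \<and> (\<exists>T>0. cs_geodesic_on T g)}"

definition geod_dist :: "(real \<Rightarrow> 'a::metric_space) \<Rightarrow> (real \<Rightarrow> 'a) \<Rightarrow> real" where
  "geod_dist g h = Lim (at_right 0) (\<lambda>t. dist (g t) (h t) / t)"

text \<open>T_y Y is the completion of (geods_from y, geod_dist) modulo zero distance;
  its elements are represented by Cauchy sequences of geodesics from y.\<close>
definition tcone :: "'a::metric_space \<Rightarrow> (nat \<Rightarrow> real \<Rightarrow> 'a) set" where
  "tcone y = {\<sigma>. (\<forall>n. \<sigma> n \<in> geods_from y) \<and>
      (\<forall>e>0. \<exists>N. \<forall>m\<ge>N. \<forall>n\<ge>N. geod_dist (\<sigma> m) (\<sigma> n) < e)}"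

definition tdist :: "(nat \<Rightarrow> real \<Rightarrow> 'a::metric_space) \<Rightarrow> (nat \<Rightarrow> real \<Rightarrow> 'a) \<Rightarrow> real" where
  "tdist v w = lim (\<lambda>n. geod_dist (v n) (w n))"

definition tvec :: "(real \<Rightarrow> 'a) \<Rightarrow> nat \<Rightarrow> real \<Rightarrow> 'a" where
  "tvec g = (\<lambda>n. g)"

definition tzero :: "'a \<Rightarrow> nat \<Rightarrow> real \<Rightarrow> 'a" where
  "tzero y = (\<lambda>n t. y)"

definition tscale :: "real \<Rightarrow> (nat \<Rightarrow> real \<Rightarrow> 'a) \<Rightarrow> nat \<Rightarrow> real \<Rightarrow> 'a" where
  "tscale \<alpha> v = (\<lambda>n t. v n (\<alpha> * t))"

definition tnorm :: "'a::metric_space \<Rightarrow> (nat \<Rightarrow> real \<Rightarrow> 'a) \<Rightarrow> real" where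
  "tnorm y v = tdist v (tzero y)"

definition tinner :: "'a::metric_space \<Rightarrow> (nat \<Rightarrow> real \<Rightarrow> 'a) \<Rightarrow> (nat \<Rightarrow> real \<Rightarrow> 'a) \<Rightarrow> real" where
  "tinner y v w = ((tnorm y v)\<^sup>2 + (tnorm y w)\<^sup>2 - (tdist v w)\<^sup>2) / 2"

definition effdom :: "('a \<Rightarrow> ereal) \<Rightarrow> 'a set" where
  "effdom E = {y. E y < \<infinity>}"

definition lambda_convex :: "real \<Rightarrow> ('a::metric_space \<Rightarrow> ereal) \<Rightarrow> bool" where
  "lambda_convex lam E \<longleftrightarrow>
    (\<forall>g. cs_geodesic_on 1 g \<longrightarrow> (\<forall>t\<in>{0..1}.
       E (g t) \<le> ereal (1 - t) * E (g 0) + ereal t * E (g 1)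
                 - ereal (lam / 2 * t * (1 - t) * (dist (g 0) (g 1))\<^sup>2)))"

definition lsc :: "('a::topological_space \<Rightarrow> ereal) \<Rightarrow> bool" where
  "lsc E \<longleftrightarrow> (\<forall>c::real. closed {x. E x \<le> ereal c})"

text \<open>Descending slope (0 at isolated points, by the convention that the
  positive part is taken).\<close>
definition slope :: "('a::metric_space \<Rightarrow> ereal) \<Rightarrow> 'a \<Rightarrow> ereal" where
  "slope E y = max 0 (Limsup (at y) (\<lambda>z. max 0 (E y - E z) / ereal (dist y z)))"

definition slope_dom :: "('a::metric_space \<Rightarrow> ereal) \<Rightarrow> 'a set" where
  "slope_dom E = {y. E y < \<infinity> \<and> slope E y < \<infinity>}"

definition msubdiff :: "real \<Rightarrow> ('a::metric_space \<Rightarrow> ereal) \<Rightarrow> 'a \<Rightarrow> (nat \<Rightarrow> real \<Rightarrow> 'a) set" where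
  "msubdiff lam E y = {v \<in> tcone y. E y < \<infinity> \<and>
     (\<forall>z. \<exists>g. geodesic_from_to g y z \<and>
        E y - ereal (tinner y v (tvec g)) + ereal (lam / 2 * (dist y z)\<^sup>2) \<le> E z)}"

definition msubdiff_dom :: "real \<Rightarrow> ('a::metric_space \<Rightarrow> ereal) \<Rightarrow> 'a set" where
  "msubdiff_dom lam E = {y. msubdiff lam E y \<noteq> {}}"

definition min_norm_elem :: "real \<Rightarrow> ('a::metric_space \<Rightarrow> ereal) \<Rightarrow> 'a \<Rightarrow> (nat \<Rightarrow> real \<Rightarrow> 'a) \<Rightarrow> bool" where
  "min_norm_elem lam E y v \<longleftrightarrow> v \<in> msubdiff lam E y \<and>
     (\<forall>w\<in>msubdiff lam E y. tnorm y v \<le> tnorm y w)"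

definition loc_abs_cont :: "(real \<Rightarrow> 'a::metric_space) \<Rightarrow> bool" where
  "loc_abs_cont c \<longleftrightarrow> (\<forall>a b. 0 < a \<and> a < b \<longrightarrow>
     (\<exists>m. set_integrable lborel {a..b} m \<and>
        (\<forall>s r. a \<le> s \<and> s \<le> r \<and> r \<le> b \<longrightarrow>
           dist (c s) (c r) \<le> (\<integral>\<tau>\<in>{s..r}. m \<tau> \<partial>lborel))))"

text \<open>Gradient flow trajectory (EVI formulation) starting from y0.\<close>
definition gf_trajectory :: "real \<Rightarrow> ('a::metric_space \<Rightarrow> ereal) \<Rightarrow> 'a \<Rightarrow> (real \<Rightarrow> 'a) \<Rightarrow> bool" where
  "gf_trajectory lam E y0 c \<longleftrightarrow> loc_abs_cont c \<and> (c \<longlongrightarrow> y0) (at_right 0) \<and>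
     (\<forall>w. AE t in lborel. t > 0 \<longrightarrow>
        (\<exists>D. ((\<lambda>s. (dist (c s) w)\<^sup>2 / 2) has_real_derivative D) (at t) \<and>
             ereal D + E (c t) + ereal (lam / 2 * (dist (c t) w)\<^sup>2) \<le> E w))"

definition dq_converges_to_min :: "real \<Rightarrow> ('a::metric_space \<Rightarrow> ereal) \<Rightarrow> (real \<Rightarrow> 'a) \<Rightarrow> real \<Rightarrow> bool" where
  "dq_converges_to_min lam E c t \<longleftrightarrow>
     (\<exists>v. min_norm_elem lam E (c t) v) \<and>
     (\<forall>v. min_norm_elem lam E (c t) v \<longrightarrow>
        ((\<lambda>h. tdist (tscale (1 / h) (tvec (Geo (c t) (c (t + h))))) v) \<longlongrightarrow> 0) (at_right 0))"

end

theory Submission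
  imports Defs
begin

text \<open>
  Taylor expansion of the model cosine laws shows that, near every point, squared distance is
  2-convex along geodesics up to an additive error of fourth order in the size of the triangle. Errors of
  that order disappear in the blow-up, so this weak comparison already gives the
  existence of the limits defining the tangent cone and the homogeneity of its scalar product.

  At a point of finite slope \<open>S\<close>, geodesics along which \<open>E\<close> decreases almost at rate \<open>S\<close> have Cauchy
  directions: interpolating between two such directions that are far apart would yield a direction of
  slope larger than \<open>S\<close>. Interpolating between the limit direction, scaled to length \<open>S\<close>, and an arbitrary
  geodesic shows that it belongs to the minus-subdifferential. Conversely every element of the
  minus-subdifferential has norm at least the slope, by Cauchy-Schwarz. Density of the domain of the slope
  is Ekeland's variational principle.

  Along a gradient flow started at a point \<open>x\<close> of finite slope \<open>S\<close>, the evolution variational inequality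
  tested with \<open>x\<close> bounds the speed at time \<open>0\<close> by \<open>S\<close>, and tested with points in a steep direction it
  bounds the energy dissipation rate below by \<open>S\<^sup>2\<close>. Expanding the squared distance in the tangent cone between
  the difference quotient and an element of norm \<open>S\<close> of the minus-subdifferential, both bounds together force
  convergence. The slope is finite at positive times because time shifts of the flow are quasi-contractive
  and the squared increments are controlled by the energy drop.
\<close>

section \<open>Comparison up to fourth order\<close>

text \<open>Curvature enters only pointwise, through \<open>near_cat0\<close> with \<open>r\<close>
  and \<open>K\<close> depending on the point. The part on the flow, including finiteness of the
  slope at positive times, is purely metric; it receives steep directions as a hypothesis. Every use
  of the evolution inequality goes through \<open>evi_step\<close>: an affine function of time is
  inserted as a bound for the energy, and the almost-everywhere inequality becomes one about a
  function with nonpositive derivative, so that the energy itself is never integrated. The linear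
  term of this bound makes the speed estimate sharp. If the flow has moved at most
  \<open>k*r\<close> by time \<open>r\<close>, the slope allows an energy loss of about
  \<open>S*k*r\<close>; integrating this gives \<open>k^2 \<le> S*k\<close>, whereas its largest
  value \<open>S*k*h\<close> would give \<open>k^2 \<le> 2*S*k\<close> and a speed bound twice too
  large. Uniqueness of the element of minimal norm is not an ingredient: the convergence argument
  uses only that the norm of the candidate equals the slope, so it applies to each minimal
  element.\<close>

lemma sin_ge_cubic: "0 \<le> x \<Longrightarrow> x - x^3/6 \<le> sin (x::real)"
proof -
  assume x: "0 \<le> x"
  have "(\<Sum>m<3. sin_coeff m * x ^ m) = x"
    by (simp add: numeral_3_eq_3 sin_coeff_def)
  then have "\<bar>sin x - x\<bar> \<le> x^3/6"
    using Maclaurin_sin_bound[of x 3] x by (simp add: fact_numeral field_simps)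
  then show ?thesis by linarith
qed

lemma abs_cos_quadratic_le: "\<bar>cos (x::real) - (1 - x^2/2)\<bar> \<le> x^4/24"
proof -
  obtain t where t: "cos x = (\<Sum>m<4. cos_coeff m * x ^ m) + cos (t + 1/2 * real 4 * pi) / fact 4 * x ^ 4"
    using Maclaurin_cos_expansion[of x 4] by blast
  have "(\<Sum>m<4. cos_coeff m * x ^ m) = 1 - x^2/2"
    by (simp add: lessThan_nat_numeral fact_numeral cos_coeff_def)
  then have "\<bar>cos x - (1 - x^2/2)\<bar> = \<bar>cos (t + 1/2 * real 4 * pi)\<bar> * (x^4 / 24)"
    using t by (simp add: abs_mult fact_numeral)
  also have "\<dots> \<le> 1 * (x^4/24)" by (intro mult_right_mono) auto
  finally show ?thesis by simp
qed

lemma sinh_ge_self: "0 \<le> x \<Longrightarrow> x \<le> sinh (x::real)"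
proof -
  assume x: "0 \<le> x"
  have "(\<lambda>x. sinh x - x) 0 \<le> (\<lambda>x. sinh x - x) x"
    by (rule DERIV_nonneg_imp_nondecreasing[OF x])
      (auto intro!: exI derivative_eq_intros simp: cosh_real_ge_1)
  then show ?thesis by simp
qed

lemma cosh_eq_1_plus_sinh_half: "cosh (x::real) = 1 + 2 * (sinh (x/2))^2"
  using cosh_double[of "x/2"] cosh_square_eq[of "x/2"] by simp

lemma cosh_ge_quadratic: "1 + x^2/2 \<le> cosh (x::real)"
proof -
  have "(\<bar>x\<bar>/2)^2 \<le> (sinh (\<bar>x\<bar>/2))^2"
    by (intro power_mono sinh_ge_self) auto
  then have "1 + \<bar>x\<bar>^2/2 \<le> cosh \<bar>x\<bar>"
    by (subst cosh_eq_1_plus_sinh_half) (simp add: power2_eq_square)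
  then show ?thesis by simp
qed

lemma sinh_le_mult_cosh: "0 \<le> x \<Longrightarrow> sinh (x::real) \<le> x * cosh x"
proof -
  assume x: "0 \<le> x"
  have "(\<lambda>x. x * cosh x - sinh x) 0 \<le> (\<lambda>x. x * cosh x - sinh x) x"
    by (rule DERIV_nonneg_imp_nondecreasing[OF x])
      (auto intro!: exI derivative_eq_intros)
  then show ?thesis by simp
qed

lemma cosh_le_2: "0 \<le> x \<Longrightarrow> x \<le> 1 \<Longrightarrow> cosh (x::real) \<le> 2"
proof -
  assume x: "0 \<le> x" "x \<le> 1"
  have "cosh x \<le> cosh 1" using x by (subst cosh_real_nonneg_le_iff) auto
  moreover have "cosh (1::real) \<le> 2"
  proof -
    have "exp (1::real) \<le> 3" using exp_le by simp
    moreover have "exp (-1::real) \<le> 1" by simp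
    ultimately have "exp 1 + exp (-1) \<le> (4::real)" by linarith
    then show ?thesis by (simp add: cosh_def)
  qed
  ultimately show ?thesis by simp
qed

lemma cosh_le_quadratic:
  assumes "0 \<le> x" "x \<le> 1" shows "cosh (x::real) \<le> 1 + 2*x^2"
proof -
  have "sinh (x/2) \<le> x/2 * cosh (x/2)" using assms by (intro sinh_le_mult_cosh) auto
  also have "\<dots> \<le> x/2 * 2" using assms by (intro mult_left_mono cosh_le_2) auto
  finally have "(sinh (x/2))^2 \<le> x^2" using assms by (intro power_mono) auto
  then show ?thesis by (subst cosh_eq_1_plus_sinh_half) simp
qed

lemma sinh_le_cubic:
  assumes "0 \<le> x" "x \<le> 1" shows "sinh (x::real) \<le> x * (1 + 2*x^2)"
  using sinh_le_mult_cosh[of x] mult_left_mono[OF cosh_le_quadratic[OF assms], of x] assms by linarith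

lemma cosh_le_quartic:
  assumes "0 \<le> x" "x \<le> 1" shows "cosh (x::real) \<le> 1 + x^2/2 + x^4"
proof -
  have "sinh (x/2) \<le> x/2 * (1 + 2*(x/2)^2)" using assms by (intro sinh_le_cubic) auto
  then have "(sinh (x/2))^2 \<le> (x/2 * (1 + 2*(x/2)^2))^2" using assms by (intro power_mono) auto
  also have "\<dots> = x^2/4 + x^4/4 + x^4*x^2/16" by (simp add: power2_eq_square power4_eq_xxxx field_simps)
  also have "\<dots> \<le> x^2/4 + x^4/4 + x^4*1/16"
    using assms power_le_one[of x 2] by (intro add_mono divide_right_mono mult_left_mono) auto
  finally have "(sinh (x/2))^2 \<le> x^2/4 + x^4/4 + x^4*1/16" .
  moreover have "0 \<le> x^4" by simp
  ultimately have "2 * (sinh (x/2))^2 \<le> x^2/2 + x^4" by linarith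
  then show ?thesis by (subst cosh_eq_1_plus_sinh_half) simp
qed

section \<open>Laws of cosines as quadratic inequalities with a fourth-order error\<close>

text \<open>Here \<open>A\<close> is the side carrying the point with parameter \<open>s\<close>,
  and \<open>B\<close>, \<open>C\<close>, \<open>D\<close> are the distances from the opposite
  vertex to its two ends and to that point. Eliminating the angle leaves
  \<open>\<alpha> * cos B + \<beta> * cos C \<le> cos D\<close>, the spherical Stewart identity;
  Taylor expansion does the rest. The estimates below add up to about \<open>16*R^4\<close>; the
  constant 24 is shared with the hyperbolic case, where they add up to
  \<open>22*R^4\<close>.\<close>

lemma spherical_comparison:
  fixes A B C D R s :: real
  assumes A: "0 < A" "A \<le> R" and B: "0 < B" "B \<le> R" and C: "0 \<le> C" "C \<le> R" and R: "R \<le> 1"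
    and tri: "\<bar>A - B\<bar> \<le> C" "C \<le> A + B" and s: "0 \<le> s" "s \<le> 1" and D: "0 \<le> D" "D \<le> 2 * R"
    and le: "D \<le> arccos (cos (s*A) * cos B + sin (s*A) * sin B * cos (arccos ((cos C - cos A * cos B) / (sin A * sin B))))"
  shows "D^2 \<le> (1-s)*B^2 + s*C^2 - s*(1-s)*A^2 + 24*R^4"
proof -
  have pi: "2 < pi" using pi_gt3 by linarith
  have sA: "0 < sin A" and sB: "0 < sin B" using A B R pi by (auto intro!: sin_gt_zero)
  define Y where "Y = (cos C - cos A * cos B) / (sin A * sin B)"
  \<comment> \<open>The triangle inequalities put \<open>Y\<close> into \<open>[-1,1]\<close>, which
    is what makes \<open>cos (arccos Y) = Y\<close>.\<close>
  have "cos C \<le> cos \<bar>A-B\<bar>" using tri C R pi by (intro cos_monotone_0_pi_le) auto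
  then have Y1: "Y \<le> 1" using sA sB by (simp add: Y_def cos_diff)
  have "cos (A+B) \<le> cos C" using tri A B C R pi by (intro cos_monotone_0_pi_le) auto
  then have Y2: "-1 \<le> Y" using sA sB by (simp add: Y_def cos_add pos_le_divide_eq)
  define X where "X = cos (s*A) * cos B + sin (s*A) * sin B * Y"
  have X: "D \<le> arccos X" using le Y1 Y2 by (simp add: X_def Y_def)
  \<comment> \<open>These weights are \<open>1-s\<close> and \<open>s\<close> to leading order.
    Their sum exceeds 1 by a second-order amount, and this excess is the source of the convexity
    term.\<close>
  define \<alpha> where "\<alpha> = sin ((1-s)*A) / sin A"
  define \<beta> where "\<beta> = sin (s*A) / sin A"
  have "X = (cos (s*A) - sin (s*A) * cos A / sin A) * cos B + \<beta> * cos C"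
    using sA sB by (simp add: X_def Y_def \<beta>_def field_simps)
  also have "cos (s*A) - sin (s*A) * cos A / sin A = \<alpha>"
    using sA sin_diff[of A "s*A"] by (simp add: \<alpha>_def field_simps)
  finally have Xeq: "X = \<alpha> * cos B + \<beta> * cos C" .
  have sA01: "0 \<le> s*A" "s*A \<le> A" "0 \<le> (1-s)*A" "(1-s)*A \<le> A" using s A
    by (auto simp: mult_left_le_one_le)
  have snn: "0 \<le> sin (s*A)" "0 \<le> sin ((1-s)*A)" using sA01 A R pi by (intro sin_ge_zero; linarith)+
  have "\<bar>Y\<bar> \<le> 1" using Y1 Y2 by simp
  then have "\<bar>sin (s*A) * sin B * Y\<bar> \<le> sin (s*A) * sin B"
    using snn sB by (simp add: abs_mult mult_left_le)
  then have Xb: "X \<le> cos (s*A - B)" "cos (s*A + B) \<le> X" by (auto simp: X_def cos_diff cos_add)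
  then have X1: "-1 \<le> X" "X \<le> 1" using cos_le_one[of "s*A-B"] cos_ge_minus_one[of "s*A+B"] by linarith+
  have "cos (arccos X) \<le> cos D"
    using X D X1 by (intro cos_monotone_0_pi_le) (auto simp: arccos_ubound)
  then have cD: "X \<le> cos D" using X1 by simp
  have A2: "A^2 \<le> R^2" "R^2 \<le> 1" using A R by (auto intro: power_mono simp: power_le_one)
  have sinA: "A * (1 - A^2/6) \<le> sin A" using sin_ge_cubic[of A] A by (simp add: field_simps power2_eq_square power3_eq_cube)
  have coef: "sin (q*A) / sin A \<le> q + R^2" if q: "0 \<le> q" "q \<le> 1" for q
  proof -
    have "sin (q*A) \<le> q * A" using q A by (intro sin_x_le_x) auto
    also have "\<dots> \<le> (q + R^2) * (A * (1 - A^2/6))"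
    proof -
      have "q * (A^2/6) \<le> 1 * (A^2/6)" using q by (intro mult_right_mono) auto
      moreover have "R^2 * (5/6) \<le> R^2 * (1 - A^2/6)" using A2 by (intro mult_left_mono) auto
      ultimately have "q * (A^2/6) \<le> R^2 * (1 - A^2/6)" using A2 zero_le_power2[of R] by linarith
      then have "q \<le> (q + R^2) * (1 - A^2/6)" by (simp add: algebra_simps)
      then show ?thesis using A by (simp add: mult_ac)
    qed
    also have "\<dots> \<le> (q + R^2) * sin A" using sinA q by (intro mult_left_mono) auto
    finally show ?thesis using sA by (simp add: pos_divide_le_eq)
  qed
  have \<alpha>: "0 \<le> \<alpha>" "\<alpha> \<le> (1-s) + R^2" using coef[of "1-s"] s snn sA by (auto simp: \<alpha>_def)
  have \<beta>: "0 \<le> \<beta>" "\<beta> \<le> s + R^2" using coef[of s] s snn sA by (auto simp: \<beta>_def)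
  define p where "p = (1-s)*A/2"
  define q where "q = s*A/2"
  have pq: "0 \<le> p" "p \<le> R" "0 \<le> q" "q \<le> R" unfolding p_def q_def using sA01 A by linarith+
  have Apq: "A = 2*(p+q)" "(1-s)*A = 2*p" "s*A = 2*q" by (auto simp: p_def q_def field_simps)
  have cpq: "0 < cos (p+q)" using A R pi by (intro cos_gt_zero) (auto simp: Apq)
  have spq: "sin (p+q) > 0" using A R pi by (intro sin_gt_zero) (auto simp: Apq)
  \<comment> \<open>The sum-to-product formula turns the sum into
    \<open>cos (p-q) / cos (p+q)\<close>, which is about \<open>1 + 2*p*q\<close>, and
    \<open>2*p*q = s*(1-s)*A^2/2\<close>.\<close>
  have "\<alpha> + \<beta> = (sin (2*p) + sin (2*q)) / sin (2*(p+q))"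
    unfolding \<alpha>_def \<beta>_def Apq(2,3) by (simp only: Apq(1) add_divide_distrib)
  also have "sin (2*p) + sin (2*q) = 2 * sin (p+q) * cos (p-q)"
    using sin_add[of "p+q" "p-q"] sin_diff[of "p+q" "p-q"] by simp
  also have "sin (2*(p+q)) = 2 * sin (p+q) * cos (p+q)" by (rule sin_double)
  finally have ab: "\<alpha> + \<beta> = cos (p-q) / cos (p+q)" using spq by simp
  have "sin p \<ge> 0" "sin q \<ge> 0" using pq R pi by (auto intro!: sin_ge_zero)
  have "1 + 2 * (sin p * sin q) \<le> cos (p-q) / cos (p+q)"
  proof -
    have "cos (p-q) = cos (p+q) + 2 * (sin p * sin q)" by (simp add: cos_add cos_diff)
    moreover have "2 * (sin p * sin q) * cos (p+q) \<le> 2 * (sin p * sin q) * 1"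
      using \<open>sin p \<ge> 0\<close> \<open>sin q \<ge> 0\<close> by (intro mult_left_mono) auto
    ultimately show ?thesis using cpq by (simp add: pos_le_divide_eq algebra_simps)
  qed
  moreover have "p*q - R^4 \<le> sin p * sin q"
  proof -
    have p': "p * (1 - p^2/6) \<le> sin p" "q * (1 - q^2/6) \<le> sin q" using sin_ge_cubic[of p] sin_ge_cubic[of q] pq
      by (simp_all add: field_simps power2_eq_square power3_eq_cube)
    have p2: "p^2 \<le> R^2" "q^2 \<le> R^2" using pq by (auto intro: power_mono)
    have "(p * (1 - p^2/6)) * (q * (1 - q^2/6)) \<le> sin p * sin q"
      using p' pq A2 order_trans[OF p2(1) A2(2)] order_trans[OF p2(2) A2(2)] \<open>sin p \<ge> 0\<close> by (intro mult_mono mult_nonneg_nonneg) auto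
    moreover have "(p * (1 - p^2/6)) * (q * (1 - q^2/6)) = p*q - p*q*(p^2+q^2)/6 + p*q*(p^2*q^2)/36"
      by (simp add: field_simps)
    moreover have "p*q*(p^2*q^2)/36 \<ge> 0" using pq by simp
    moreover have "p*q*(p^2+q^2)/6 \<le> (R*R)*(R^2+R^2)/6" using pq p2 by (intro divide_right_mono mult_mono add_mono) auto
    moreover have "(R*R)*(R^2+R^2)/6 = R^4/3" by (simp add: power2_eq_square power4_eq_xxxx)
    moreover have "0 \<le> R^4" by simp
    ultimately show ?thesis by linarith
  qed
  ultimately have ab2: "1 + s*(1-s)*A^2/2 - 2*R^4 \<le> \<alpha> + \<beta>"
    unfolding ab by (simp add: p_def q_def power2_eq_square field_simps)
  have B2: "B^2 \<le> R^2" "C^2 \<le> R^2" using B C by (auto intro: power_mono)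
  have RR: "R^2*R^2 = R^4" by (simp add: power2_eq_square power4_eq_xxxx)
  have "\<alpha> * B^2 \<le> ((1-s) + R^2) * B^2" using \<alpha> by (intro mult_right_mono) auto
  also have "\<dots> \<le> (1-s)*B^2 + R^4" using mult_left_mono[OF B2(1), of "R^2"] RR by (simp add: algebra_simps)
  finally have tB: "\<alpha> * B^2 \<le> (1-s)*B^2 + R^4" .
  have "\<beta> * C^2 \<le> (s + R^2) * C^2" using \<beta> by (intro mult_right_mono) auto
  also have "\<dots> \<le> s*C^2 + R^4" using mult_left_mono[OF B2(2), of "R^2"] RR by (simp add: algebra_simps)
  finally have tC: "\<beta> * C^2 \<le> s*C^2 + R^4" .
  have "1 - B^2/2 - R^4 \<le> cos B" "1 - C^2/2 - R^4 \<le> cos C"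
  proof -
    have "B^4 \<le> R^4" "C^4 \<le> R^4" using B C by (auto intro: power_mono)
    then show "1 - B^2/2 - R^4 \<le> cos B" "1 - C^2/2 - R^4 \<le> cos C"
      using abs_cos_quadratic_le[of B] abs_cos_quadratic_le[of C] zero_le_power[OF order_trans[OF C], of 4] by argo+
  qed
  then have "\<alpha> * (1 - B^2/2 - R^4) + \<beta> * (1 - C^2/2 - R^4) \<le> X"
    unfolding Xeq using \<alpha> \<beta> by (intro add_mono mult_left_mono) auto
  moreover have "\<alpha> * R^4 \<le> 2 * R^4" "\<beta> * R^4 \<le> 2 * R^4" using \<alpha> \<beta> A2 s by (intro mult_right_mono; auto)+
  moreover have "cos D \<le> 1 - D^2/2 + R^4 * (16/24)"
  proof -
    have "D^4 \<le> (2*R)^4" using D by (intro power_mono) auto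
    then have "D^4 \<le> 16 * R^4" by (simp add: power_mult_distrib)
    then show ?thesis using abs_cos_quadratic_le[of D] by argo
  qed
  moreover have "0 \<le> R^4" by simp
  moreover have "\<alpha> * (1 - B^2/2 - R^4) + \<beta> * (1 - C^2/2 - R^4)
      = \<alpha> + \<beta> - (\<alpha> * B^2)/2 - (\<beta> * C^2)/2 - \<alpha> * R^4 - \<beta> * R^4"
    by (simp add: algebra_simps)
  ultimately show ?thesis using cD tB tC ab2 by linarith
qed

text \<open>The same elimination with the inequalities reversed: \<open>cosh D\<close> is bounded
  above by \<open>\<alpha> * cosh B + \<beta> * cosh C\<close>, and
  \<open>\<alpha> + \<beta>\<close> falls short of 1 by about \<open>s*(1-s)*A^2/2\<close>. The
  distance \<open>D\<close> is recovered from \<open>1 + D^2/2 \<le> cosh D\<close>, which costs no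
  remainder.\<close>

lemma hyperbolic_comparison:
  fixes A B C D R s :: real
  assumes A: "0 < A" "A \<le> R" and B: "0 < B" "B \<le> R" and C: "0 \<le> C" "C \<le> R" and R: "R \<le> 1"
    and tri: "\<bar>A - B\<bar> \<le> C" "C \<le> A + B" and s: "0 \<le> s" "s \<le> 1" and D: "0 \<le> D"
    and le: "D \<le> arcosh (cosh (s*A) * cosh B - sinh (s*A) * sinh B * cos (arccos ((cosh A * cosh B - cosh C) / (sinh A * sinh B))))"
  shows "D^2 \<le> (1-s)*B^2 + s*C^2 - s*(1-s)*A^2 + 24*R^4"
proof -
  have sA: "0 < sinh A" and sB: "0 < sinh B" using A B by auto
  define Y where "Y = (cosh A * cosh B - cosh C) / (sinh A * sinh B)"
  have "cosh \<bar>A-B\<bar> \<le> cosh C" using tri C by (subst cosh_real_nonneg_le_iff) auto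
  then have Y1: "Y \<le> 1" using sA sB by (simp add: Y_def cosh_diff)
  have "cosh C \<le> cosh (A+B)" using tri A B C by (subst cosh_real_nonneg_le_iff) auto
  then have Y2: "-1 \<le> Y" using sA sB by (simp add: Y_def cosh_add pos_le_divide_eq)
  define X where "X = cosh (s*A) * cosh B - sinh (s*A) * sinh B * Y"
  have X: "D \<le> arcosh X" using le Y1 Y2 by (simp add: X_def Y_def)
  define \<alpha> where "\<alpha> = sinh ((1-s)*A) / sinh A"
  define \<beta> where "\<beta> = sinh (s*A) / sinh A"
  have "X = (cosh (s*A) - sinh (s*A) * cosh A / sinh A) * cosh B + \<beta> * cosh C"
    using sA sB by (simp add: X_def Y_def \<beta>_def field_simps)
  also have "cosh (s*A) - sinh (s*A) * cosh A / sinh A = \<alpha>"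
    using sA sinh_diff[of A "s*A"] by (simp add: \<alpha>_def field_simps)
  finally have Xeq: "X = \<alpha> * cosh B + \<beta> * cosh C" .
  have sA01: "0 \<le> s*A" "s*A \<le> A" "0 \<le> (1-s)*A" "(1-s)*A \<le> A" using s A
    by (auto simp: mult_left_le_one_le)
  have snn: "0 \<le> sinh (s*A)" "0 \<le> sinh ((1-s)*A)" using sA01 by auto
  have "sinh (s*A) * sinh B * Y \<le> sinh (s*A) * sinh B"
    using snn sB Y1 by (simp add: mult_left_le)
  then have "cosh (s*A - B) \<le> X" by (auto simp: X_def cosh_diff)
  then have X1: "1 \<le> X" using cosh_real_ge_1[of "s*A-B"] by linarith
  have "cosh D \<le> cosh (arcosh X)"
    using X D X1 by (subst cosh_real_nonneg_le_iff) auto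
  then have cD: "cosh D \<le> X" using X1 by simp
  have A2: "A^2 \<le> R^2" "R^2 \<le> 1" using A R by (auto intro: power_mono simp: power_le_one)
  have coef: "sinh (q*A) / sinh A \<le> q + 2*R^2" if q: "0 \<le> q" "q \<le> 1" for q
  proof -
    have q1: "q*A \<le> A" "0 \<le> q*A" using q A by (auto simp: mult_left_le_one_le)
    have "sinh (q*A) \<le> q * A * (1 + 2*(q*A)^2)" using A R q1 by (intro sinh_le_cubic) linarith+
    also have "\<dots> = A * (q + q * (2*(q*A)^2))" by (simp add: algebra_simps)
    also have "\<dots> \<le> A * (q + 1 * (2*R^2))" using q1 q A order_trans[OF q1(1) A(2)] by (intro mult_left_mono add_left_mono mult_mono power_mono) auto
    also have "\<dots> \<le> sinh A * (q + 2*R^2)" using sinh_ge_self[of A] A q by (intro mult_mono) auto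
    finally show ?thesis using sA by (simp add: pos_divide_le_eq mult_ac)
  qed
  have \<alpha>: "0 \<le> \<alpha>" "\<alpha> \<le> (1-s) + 2*R^2" using coef[of "1-s"] s snn sA by (auto simp: \<alpha>_def)
  have \<beta>: "0 \<le> \<beta>" "\<beta> \<le> s + 2*R^2" using coef[of s] s snn sA by (auto simp: \<beta>_def)
  define p where "p = (1-s)*A/2"
  define q where "q = s*A/2"
  have pq: "0 \<le> p" "p \<le> R" "0 \<le> q" "q \<le> R" unfolding p_def q_def using sA01 A by linarith+
  have Apq: "A = 2*(p+q)" "(1-s)*A = 2*p" "s*A = 2*q" by (auto simp: p_def q_def field_simps)
  have spq: "sinh (p+q) > 0" using A by (auto simp: Apq)
  have "\<alpha> + \<beta> = (sinh (2*p) + sinh (2*q)) / sinh (2*(p+q))"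
    unfolding \<alpha>_def \<beta>_def Apq(2,3) by (simp only: Apq(1) add_divide_distrib)
  also have "sinh (2*p) + sinh (2*q) = 2 * sinh (p+q) * cosh (p-q)"
    using sinh_add[of "p+q" "p-q"] sinh_diff[of "p+q" "p-q"] by simp
  also have "sinh (2*(p+q)) = 2 * sinh (p+q) * cosh (p+q)" by (rule sinh_double)
  finally have ab: "\<alpha> + \<beta> = cosh (p-q) / cosh (p+q)" using spq by simp
  have "cosh (p-q) \<le> (1 - 2*p*q + 8*R^4) * cosh (p+q)"
  proof -
    have c1: "1 \<le> cosh (p+q)" by (rule cosh_real_ge_1)
    have c2: "cosh (p+q) \<le> 1 + 2*(p+q)^2" using pq A R by (intro cosh_le_quadratic) (auto simp: Apq)
    have "(p+q)^2 \<le> R^2" using pq A Apq by (intro power_mono) auto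
    then have c3: "cosh (p+q) \<le> 1 + 2*R^2" using c2 by simp
    have "p * q \<le> sinh p * sinh q" using pq by (intro mult_mono sinh_ge_self) auto
    then have "cosh (p-q) \<le> cosh (p+q) - 2*(p*q)" by (simp add: cosh_add cosh_diff)
    moreover have "2*(p*q)*(cosh (p+q) - 1) \<le> 2*(R*R)*(2*R^2)" using pq c3 c1 by (intro mult_mono) auto
    moreover have "2*(R*R)*(2*R^2) = 4*R^4" by (simp add: power2_eq_square power4_eq_xxxx)
    moreover have "8*R^4*1 \<le> 8*R^4*cosh (p+q)" using c1 by (intro mult_left_mono) auto
    moreover have "0 \<le> R^4" by simp
    ultimately have "cosh (p-q) \<le> cosh (p+q) - 2*(p*q) - 2*(p*q)*(cosh (p+q) - 1) + 8*R^4*cosh (p+q)" by linarith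
    then show ?thesis by (simp add: algebra_simps)
  qed
  then have ab2: "\<alpha> + \<beta> \<le> 1 - s*(1-s)*A^2/2 + 8*R^4"
    unfolding ab by (simp add: p_def q_def power2_eq_square pos_divide_le_eq) (simp add: field_simps)
  have B2: "B^2 \<le> R^2" "C^2 \<le> R^2" using B C by (auto intro: power_mono)
  have RR: "R^2*R^2 = R^4" by (simp add: power2_eq_square power4_eq_xxxx)
  have "\<alpha> * B^2 \<le> ((1-s) + 2*R^2) * B^2" using \<alpha> by (intro mult_right_mono) auto
  also have "\<dots> \<le> (1-s)*B^2 + 2*R^4" using mult_left_mono[OF B2(1), of "R^2"] RR by (simp add: algebra_simps)
  finally have tB: "\<alpha> * B^2 \<le> (1-s)*B^2 + 2*R^4" .
  have "\<beta> * C^2 \<le> (s + 2*R^2) * C^2" using \<beta> by (intro mult_right_mono) auto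
  also have "\<dots> \<le> s*C^2 + 2*R^4" using mult_left_mono[OF B2(2), of "R^2"] RR by (simp add: algebra_simps)
  finally have tC: "\<beta> * C^2 \<le> s*C^2 + 2*R^4" .
  have "cosh B \<le> 1 + B^2/2 + R^4" "cosh C \<le> 1 + C^2/2 + R^4"
  proof -
    have "B^4 \<le> R^4" "C^4 \<le> R^4" using B C by (auto intro: power_mono)
    then show "cosh B \<le> 1 + B^2/2 + R^4" "cosh C \<le> 1 + C^2/2 + R^4"
      using cosh_le_quartic[of B] cosh_le_quartic[of C] B C R by linarith+
  qed
  then have "X \<le> \<alpha> * (1 + B^2/2 + R^4) + \<beta> * (1 + C^2/2 + R^4)"
    unfolding Xeq using \<alpha> \<beta> by (intro add_mono mult_left_mono) auto
  moreover have "(\<alpha> + \<beta>) * R^4 \<le> 1 * R^4"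
  proof -
    have "cosh (p-q) \<le> cosh (p+q)" using pq by (simp add: cosh_add cosh_diff)
    then have "\<alpha> + \<beta> \<le> 1" unfolding ab by simp
    then show ?thesis by (intro mult_right_mono) auto
  qed
  moreover have "1 + D^2/2 \<le> cosh D" by (rule cosh_ge_quadratic)
  ultimately have "1 + D^2/2 \<le> \<alpha> + \<beta> + (\<alpha> * B^2)/2 + (\<beta> * C^2)/2 + R^4" using cD by (simp add: algebra_simps)
  moreover have "0 \<le> R^4" by simp
  ultimately show ?thesis using tB tC ab2 by linarith
qed


section \<open>From thin triangles to a local comparison property\<close>

lemma cs_geodesic_on_dist:
  assumes "cs_geodesic_on T g" "0 < T" "s \<in> {0..T}" "t \<in> {0..T}"
  shows "dist (g s) (g t) = \<bar>s - t\<bar> / T * dist (g 0) (g T)"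
proof -
  obtain L where L: "\<And>s t. s \<in> {0..T} \<Longrightarrow> t \<in> {0..T} \<Longrightarrow> dist (g s) (g t) = L * \<bar>s - t\<bar>"
    using assms(1) unfolding cs_geodesic_on_def by metis
  show ?thesis using L[of s t] L[of 0 T] assms by simp
qed

lemma cs_geodesic_1_dist:
  assumes "cs_geodesic_on 1 g" "s \<in> {0..1}" "t \<in> {0..1}"
  shows "dist (g s) (g t) = \<bar>s - t\<bar> * dist (g 0) (g 1)"
  using cs_geodesic_on_dist[OF assms(1) _ assms(2,3)] by simp

lemma cs_geodesic_on_rev:
  assumes "cs_geodesic_on 1 g" shows "cs_geodesic_on 1 (rev_curve g)"
proof -
  obtain L where "L \<ge> 0" and L: "\<forall>s\<in>{0..1}. \<forall>t\<in>{0..1}. dist (g s) (g t) = L * \<bar>s - t\<bar>"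
    using assms unfolding cs_geodesic_on_def by blast
  then show ?thesis unfolding cs_geodesic_on_def rev_curve_def
    by (intro exI[of _ L]) (auto simp: abs_minus_commute)
qed

text \<open>Lengths are multiplied by \<open>k = sqrt \<bar>\<kappa>\<bar>\<close> to reach
  curvature 1 or -1; dividing the error \<open>24 * (k*R)^4\<close> by \<open>k^2\<close> leaves
  \<open>24 * \<bar>\<kappa>\<bar> * R^4\<close>. In the flat case the law of cosines is
  exact.\<close>

lemma thin_pair_quadratic:
  assumes thin: "thin_pair \<kappa> g h" and g: "cs_geodesic_on 1 g" and h: "h 0 = g 0"
    and s: "s \<in> {0..1}" and R: "dist (h 1) (g 0) \<le> R" "dist (h 1) (g 1) \<le> R" "dist (g 0) (g 1) \<le> R"
    and \<kappa>: "sqrt \<bar>\<kappa>\<bar> * R \<le> 1"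
  shows "(dist (h 1) (g s))^2 \<le> (1-s) * (dist (h 1) (g 0))^2 + s * (dist (h 1) (g 1))^2
           - s*(1-s) * (dist (g 0) (g 1))^2 + 24 * \<bar>\<kappa>\<bar> * R^4"
proof -
  define a b c d where abc: "a = dist (g 0) (g 1)" "b = dist (h 1) (g 0)" "c = dist (h 1) (g 1)" "d = dist (h 1) (g s)"
  have nn: "0 \<le> a" "0 \<le> b" "0 \<le> c" "0 \<le> d" and le: "a \<le> R" "b \<le> R" "c \<le> R" using R by (auto simp: abc)
  have R0: "0 \<le> R" using nn le by linarith
  have sa: "dist (g 0) (g s) = s * a" using cs_geodesic_1_dist[OF g, of 0 s] s by (simp add: abc)
  have tri: "\<bar>a - b\<bar> \<le> c" "c \<le> a + b" "d \<le> s * a + b"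
    using dist_triangle[of "g 0" "g 1" "h 1"] dist_triangle[of "g 0" "h 1" "g 1"] dist_triangle[of "h 1" "g 1" "g 0"]
      dist_triangle[of "h 1" "g s" "g 0"] sa
    by (auto simp: abc dist_commute)
  have main: "d \<le> model_dist \<kappa> (s*a) b (model_angle \<kappa> a b c)"
  proof -
    have "dist (g s) (h 1) \<le> model_dist \<kappa> (s * dist (g 0) (g 1)) (1 * dist (h 0) (h 1))
        (model_angle \<kappa> (dist (g 0) (g 1)) (dist (h 0) (h 1)) (dist (g 1) (h 1)))"
      using thin s unfolding thin_pair_def Let_def by (metis atLeastAtMost_iff order_refl zero_le_one)
    then show ?thesis using h by (simp add: abc dist_commute)
  qed
  have err: "0 \<le> 24 * \<bar>\<kappa>\<bar> * R^4" by simp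
  have "d^2 \<le> (1-s) * b^2 + s * c^2 - s*(1-s) * a^2 + 24 * \<bar>\<kappa>\<bar> * R^4"
  proof (cases "a = 0 \<or> b = 0")
    \<comment> \<open>The formula for the comparison angle divides by quantities vanishing with
      \<open>a\<close> or \<open>b\<close>, so degenerate triangles are treated by hand.\<close>
    case True
    then show ?thesis
    proof
      assume "a = 0"
      then have "g s = g 0" "g 1 = g 0" using sa by (auto simp: abc)
      then show ?thesis using err \<open>a = 0\<close> by (simp add: abc algebra_simps)
    next
      assume "b = 0"
      then have "h 1 = g 0" by (simp add: abc)
      then have "d = s * a" "c = a" using sa by (auto simp: abc dist_commute)
      then show ?thesis using err \<open>b = 0\<close> by (simp add: power2_eq_square algebra_simps)
    qed
  next
    case False
    then have ab: "0 < a" "0 < b" using nn by auto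
    consider "\<kappa> = 0" | "\<kappa> > 0" | "\<kappa> < 0" by linarith
    then show ?thesis
    proof cases
      case 1
      define Y where "Y = (a^2 + b^2 - c^2) / (2 * a * b)"
      have "(a - b)^2 \<le> c^2" using tri(1) nn by (subst abs_le_square_iff[symmetric]) auto
      then have Y1: "Y \<le> 1" using ab by (simp add: Y_def power2_eq_square algebra_simps)
      have "c^2 \<le> (a + b)^2" using tri(2) nn by (intro power_mono) auto
      then have Y2: "-1 \<le> Y" using ab by (simp add: Y_def pos_le_divide_eq power2_eq_square algebra_simps)
      define Z where "Z = (s*a)^2 + b^2 - 2 * (s*a) * b * Y"
      have "d \<le> sqrt Z" using main 1 Y1 Y2 by (simp add: model_dist_def model_angle_def Y_def Z_def)
      moreover have "Z \<ge> 0"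
      proof -
        have "0 \<le> (s*a - b)^2 + 2*(s*a)*b*(1 - Y)" using Y1 ab s by simp
        then show ?thesis by (simp add: Z_def power2_eq_square algebra_simps)
      qed
      ultimately have "d^2 \<le> Z" using nn power_mono[of d "sqrt Z" 2] by simp
      also have "Z = (1-s) * b^2 + s * c^2 - s*(1-s) * a^2"
        using ab by (simp add: Z_def Y_def power2_eq_square field_simps)
      finally show ?thesis using 1 by simp
    next
      case 2
      define k where "k = sqrt \<kappa>"
      have k: "0 < k" "k^2 = \<kappa>" using 2 by (auto simp: k_def)
      have "d \<le> arccos (cos (s*(k*a)) * cos (k*b) + sin (s*(k*a)) * sin (k*b) *
          cos (arccos ((cos (k*c) - cos (k*a) * cos (k*b)) / (sin (k*a) * sin (k*b))))) / k"
        using main 2 by (simp add: model_dist_def model_angle_def Let_def k_def mult_ac)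
      then have kd: "k*d \<le> arccos (cos (s*(k*a)) * cos (k*b) + sin (s*(k*a)) * sin (k*b) *
          cos (arccos ((cos (k*c) - cos (k*a) * cos (k*b)) / (sin (k*a) * sin (k*b)))))"
        using k by (simp add: field_simps)
      have sa': "s * a \<le> a" using s nn by (simp add: mult_left_le_one_le)
      have "(k*d)^2 \<le> (1-s) * (k*b)^2 + s * (k*c)^2 - s*(1-s) * (k*a)^2 + 24 * (k*R)^4"
      proof (rule spherical_comparison[OF _ _ _ _ _ _ _ _ _ _ _ _ _ kd])
        show "\<bar>k * a - k * b\<bar> \<le> k * c" using tri(1) k by (simp add: abs_mult flip: right_diff_distrib)
        show "k * c \<le> k * a + k * b" using tri(2) k by (simp flip: distrib_left)
        have "k*d \<le> k*(2*R)" using tri(3) sa' le k by (intro mult_left_mono) auto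
        then show "k*d \<le> 2*(k*R)" by simp
        show "k * R \<le> 1" using \<kappa> 2 by (simp add: k_def)
      qed (use k ab nn le s in auto)
      then have "k^2 * d^2 \<le> k^2 * ((1-s) * b^2 + s * c^2 - s*(1-s) * a^2 + 24 * k^2 * R^4)"
        by (simp add: power2_eq_square power4_eq_xxxx algebra_simps)
      then show ?thesis using k 2 by simp
    next
      case 3
      define k where "k = sqrt (-\<kappa>)"
      have k: "0 < k" "k^2 = -\<kappa>" using 3 by (auto simp: k_def)
      have "d \<le> arcosh (cosh (s*(k*a)) * cosh (k*b) - sinh (s*(k*a)) * sinh (k*b) *
          cos (arccos ((cosh (k*a) * cosh (k*b) - cosh (k*c)) / (sinh (k*a) * sinh (k*b))))) / k"
        using main 3 by (simp add: model_dist_def model_angle_def Let_def k_def mult_ac)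
      then have kd: "k*d \<le> arcosh (cosh (s*(k*a)) * cosh (k*b) - sinh (s*(k*a)) * sinh (k*b) *
          cos (arccos ((cosh (k*a) * cosh (k*b) - cosh (k*c)) / (sinh (k*a) * sinh (k*b)))))"
        using k by (simp add: field_simps)
      have "(k*d)^2 \<le> (1-s) * (k*b)^2 + s * (k*c)^2 - s*(1-s) * (k*a)^2 + 24 * (k*R)^4"
      proof (rule hyperbolic_comparison[OF _ _ _ _ _ _ _ _ _ _ _ _ kd])
        show "\<bar>k * a - k * b\<bar> \<le> k * c" using tri(1) k by (simp add: abs_mult flip: right_diff_distrib)
        show "k * c \<le> k * a + k * b" using tri(2) k by (simp flip: distrib_left)
        show "k * R \<le> 1" using \<kappa> 3 by (simp add: k_def)
      qed (use k ab nn le s in auto)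
      then have "k^2 * d^2 \<le> k^2 * ((1-s) * b^2 + s * c^2 - s*(1-s) * a^2 + 24 * k^2 * R^4)"
        by (simp add: power2_eq_square power4_eq_xxxx algebra_simps)
      then show ?thesis using k 3 by simp
    qed
  qed
  then show ?thesis by (simp add: abc)
qed

text \<open>The comparison triangle has opposite side 0, hence angle 0, and equal parameters on its
  two sides give the same point. For positive curvature the length bound keeps
  \<open>sin (k*a)\<close> away from zero.\<close>

lemma thin_pair_same_endpoint:
  assumes "thin_pair \<kappa> g h" and "h 0 = g 0" "h 1 = g 1" and s: "s \<in> {0..1}"
    and small: "sqrt \<bar>\<kappa>\<bar> * dist (g 0) (g 1) < pi" and g: "cs_geodesic_on 1 g" "cs_geodesic_on 1 h"
  shows "g s = h s"
proof (cases "g 0 = g 1")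
  case True
  then show ?thesis using cs_geodesic_1_dist[OF g(1) s, of 0] cs_geodesic_1_dist[OF g(2) s, of 0] assms(2,3) by simp
next
  case False
  define a where "a = dist (g 0) (g 1)"
  have a: "0 < a" using False by (simp add: a_def)
  have "dist (g s) (h s) \<le> model_dist \<kappa> (s*a) (s*a) (model_angle \<kappa> a a 0)"
    using assms(1-3) s unfolding thin_pair_def Let_def a_def by (auto dest!: bspec[of _ _ s])
  also have "\<dots> = 0"
  proof -
    consider "\<kappa> = 0" | "\<kappa> > 0" | "\<kappa> < 0" by linarith
    then show ?thesis
    proof cases
      case 1
      have "(a^2 + a^2 - 0^2) / (2 * a * a) = 1" using a by (simp add: power2_eq_square)
      then show ?thesis using 1 by (simp add: model_dist_def model_angle_def power2_eq_square)
    next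
      case 2
      define k where "k = sqrt \<kappa>"
      have k: "0 < k" using 2 by (simp add: k_def)
      have sp: "0 < sin (k*a)" using k a small 2 by (intro sin_gt_zero) (auto simp: k_def a_def)
      have e: "(cos (k*0) - cos (k*a) * cos (k*a)) / (sin (k*a) * sin (k*a)) = 1"
      proof -
        have "1 - cos (k*a) * cos (k*a) = sin (k*a) * sin (k*a)"
          using sin_cos_squared_add[of "k*a"] by (simp add: power2_eq_square)
        then show ?thesis using sp by simp
      qed
      have "model_angle \<kappa> a a 0 = arccos ((cos (k*0) - cos (k*a) * cos (k*a)) / (sin (k*a) * sin (k*a)))"
        using 2 by (simp add: model_angle_def Let_def k_def)
      also have "\<dots> = 0" unfolding e by simp
      finally have "model_angle \<kappa> a a 0 = 0" .
      then show ?thesis using 2 sin_cos_squared_add[of "k*(s*a)"] by (simp add: model_dist_def Let_def k_def power2_eq_square add.commute)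
    next
      case 3
      define k where "k = sqrt (-\<kappa>)"
      have k: "0 < k" using 3 by (simp add: k_def)
      have e: "(cosh (k*a) * cosh (k*a) - cosh (k*0)) / (sinh (k*a) * sinh (k*a)) = 1"
      proof -
        have "cosh (k*a) * cosh (k*a) - 1 = sinh (k*a) * sinh (k*a)"
          using cosh_square_eq[of "k*a"] by (simp add: power2_eq_square)
        then show ?thesis using k a by simp
      qed
      have "model_angle \<kappa> a a 0 = arccos ((cosh (k*a) * cosh (k*a) - cosh (k*0)) / (sinh (k*a) * sinh (k*a)))"
        using 3 by (simp add: model_angle_def Let_def k_def)
      also have "\<dots> = 0" unfolding e by simp
      finally have "model_angle \<kappa> a a 0 = 0" .
      then show ?thesis using 3 cosh_square_eq[of "k*(s*a)"] by (simp add: model_dist_def Let_def k_def power2_eq_square)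
    qed
  qed
  finally show ?thesis by simp
qed

text \<open>All that is retained of the curvature bound. \<open>R\<close> is a free parameter, not
  tied to \<open>r\<close>, because the error has to shrink with the triangle in the blow-up. Only
  endpoints are required to lie in the ball, and uniqueness is asked only for geodesics issuing from
  the centre.\<close>

definition near_cat0 :: "'a::metric_space \<Rightarrow> real \<Rightarrow> real \<Rightarrow> bool" where
  "near_cat0 x r K \<longleftrightarrow> 0 < r \<and> 0 \<le> K \<and>
     (\<forall>p g s R. p \<in> ball x r \<and> cs_geodesic_on 1 g \<and> g 0 \<in> ball x r \<and> g 1 \<in> ball x r \<and> s \<in> {0..1} \<and>
        dist p (g 0) \<le> R \<and> dist p (g 1) \<le> R \<and> dist (g 0) (g 1) \<le> R \<longrightarrow>
        (dist p (g s))^2 \<le> (1-s) * (dist p (g 0))^2 + s * (dist p (g 1))^2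
           - s*(1-s) * (dist (g 0) (g 1))^2 + K * R^4) \<and>
     (\<forall>g h z. z \<in> ball x r \<and> geodesic_from_to g x z \<and> geodesic_from_to h x z \<longrightarrow> (\<forall>s\<in>{0..1}. g s = h s))"

text \<open>A geodesic between points of a ball may leave it, but its length is below
  \<open>2*r\<close>. This is the reason for the factor 3 in the choice of the radius below.\<close>

lemma geodesic_in_ball:
  assumes g: "cs_geodesic_on 1 g" "g 0 \<in> ball x r" "g 1 \<in> ball x r"
  shows "g ` {0..1} \<subseteq> ball x (3*r)"
proof safe
  fix s :: real assume s: "s \<in> {0..1}"
  have "dist (g 0) (g s) = s * dist (g 0) (g 1)" using cs_geodesic_1_dist[OF g(1), of 0 s] s by simp
  also have "\<dots> \<le> dist (g 0) (g 1)" using s by (simp add: mult_left_le_one_le)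
  also have "\<dots> \<le> dist x (g 0) + dist x (g 1)" by (rule dist_triangle3)
  finally show "g s \<in> ball x (3*r)" using g(2,3) dist_triangle[of x "g s" "g 0"] by simp
qed

lemma locally_CAT_near_cat0:
  fixes x :: "'a::complete_space"
  assumes "locally_CAT \<kappa> TYPE('a)"
  obtains r K where "near_cat0 x r K"
proof -
  have geo: "\<exists>g. geodesic_from_to g x z" for x z :: 'a
    using assms by (auto simp: locally_CAT_def geodesic_space_def)
  obtain U where U: "x \<in> interior U" "cat_space \<kappa> U" using assms by (auto simp: locally_CAT_def)
  obtain e where e: "0 < e" "ball x e \<subseteq> U" using U(1) by (auto simp: mem_interior)
  \<comment> \<open>The first entry keeps all geodesics with ends in \<open>ball x r\<close> inside
    \<open>U\<close>. The second gives \<open>sqrt \<bar>\<kappa>\<bar> * (2*r) < 1\<close>, hence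
    both the perimeter condition and the smallness required by the model estimates.\<close>
  define r where "r = min (e/3) (1 / (2 * (sqrt \<bar>\<kappa>\<bar> + 1)))"
  have k0: "0 \<le> sqrt \<bar>\<kappa>\<bar>" by simp
  have r: "0 < r" "3*r \<le> e" using e k0 by (auto simp: r_def add_nonneg_pos)
  have "sqrt \<bar>\<kappa>\<bar> * (2*r) \<le> sqrt \<bar>\<kappa>\<bar> * (2*(1 / (2 * (sqrt \<bar>\<kappa>\<bar> + 1))))" by (intro mult_left_mono) (auto simp: r_def)
  also have "\<dots> = sqrt \<bar>\<kappa>\<bar> / (sqrt \<bar>\<kappa>\<bar> + 1)"
  proof -
    have "2 * (1 / (2 * q)) = 1 / q" for q :: real by simp
    then show ?thesis by (simp only:) simp
  qed
  also have "\<dots> < 1" using k0 by (simp add: divide_less_eq del: real_sqrt_ge_0_iff)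
  finally have kr: "sqrt \<bar>\<kappa>\<bar> * (2*r) < 1" .
  have inU: "g ` {0..1} \<subseteq> U" if "cs_geodesic_on 1 g" "g 0 \<in> ball x r" "g 1 \<in> ball x r" for g
  proof -
    have "ball x (3*r) \<subseteq> ball x e" using r by auto
    then show ?thesis using geodesic_in_ball[OF that] e by blast
  qed
  have d2: "dist p q < 2*r" if "p \<in> ball x r" "q \<in> ball x r" for p q
    using that dist_triangle3[of p q x] by simp
  have thin: "thin_pair \<kappa> g (rev_curve h)"
    if "cs_geodesic_on 1 g" "cs_geodesic_on 1 f" "cs_geodesic_on 1 h" "g 1 = f 0" "f 1 = h 0" "h 1 = g 0"
      "g 0 \<in> ball x r" "f 0 \<in> ball x r" "h 0 \<in> ball x r" for g f h
  proof -
    have "below_D \<kappa> ((dist (g 0) (g 1) + dist (f 0) (f 1) + dist (h 0) (h 1)) / 2)"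
    proof (cases "\<kappa> \<le> 0")
      case False
      have "(dist (g 0) (g 1) + dist (f 0) (f 1) + dist (h 0) (h 1)) / 2 < 3 * r"
        using d2[of "g 0" "g 1"] d2[of "f 0" "f 1"] d2[of "h 0" "h 1"] that by simp
      also have "\<dots> \<le> pi / sqrt \<kappa>"
      proof -
        have "sqrt \<kappa> * (3*r) \<le> pi" using kr False pi_gt3 by simp
        then show ?thesis using False by (simp add: pos_le_divide_eq mult.commute)
      qed
      finally show ?thesis by (simp add: below_D_def)
    qed (simp add: below_D_def)
    moreover have "g ` {0..1} \<subseteq> U" "f ` {0..1} \<subseteq> U" "h ` {0..1} \<subseteq> U" using that by (intro inU; simp)+
    ultimately show ?thesis using U(2) that unfolding cat_space_def by blast
  qed
  have "near_cat0 x r (24 * \<bar>\<kappa>\<bar>)"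
    unfolding near_cat0_def
  proof (intro conjI allI impI, goal_cases)
    case (3 p g s R)
    obtain f where f: "cs_geodesic_on 1 f" "f 0 = g 1" "f 1 = p" using geo[of "g 1" p] by (auto simp: geodesic_from_to_def)
    obtain h where h: "cs_geodesic_on 1 h" "h 0 = p" "h 1 = g 0" using geo[of p "g 0"] by (auto simp: geodesic_from_to_def)
    have t: "thin_pair \<kappa> g (rev_curve h)" using 3 f h by (intro thin[of g f h]) auto
    \<comment> \<open>The given \<open>R\<close> may be too large for the model estimate; sides
      within the ball are below \<open>2*r\<close>, and lowering \<open>R\<close> only improves the
      error.\<close>
    define R' where "R' = min R (2*r)"
    have R': "dist p (g 0) \<le> R'" "dist p (g 1) \<le> R'" "dist (g 0) (g 1) \<le> R'"
      using 3 d2[of p "g 0"] d2[of p "g 1"] d2[of "g 0" "g 1"] by (auto simp: R'_def)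
    have "0 \<le> R'" using R'(1) zero_le_dist[of p "g 0"] by linarith
    have "sqrt \<bar>\<kappa>\<bar> * R' \<le> sqrt \<bar>\<kappa>\<bar> * (2*r)" by (intro mult_left_mono) (auto simp: R'_def)
    then have "sqrt \<bar>\<kappa>\<bar> * R' \<le> 1" using kr by linarith
    from thin_pair_quadratic[OF t _ _ _ _ _ _ this, of s] 3 h R'
    have "(dist p (g s))^2 \<le> (1-s) * (dist p (g 0))^2 + s * (dist p (g 1))^2
           - s*(1-s) * (dist (g 0) (g 1))^2 + 24 * \<bar>\<kappa>\<bar> * R'^4" by (simp add: rev_curve_def)
    also have "24 * \<bar>\<kappa>\<bar> * R'^4 \<le> 24 * \<bar>\<kappa>\<bar> * R^4"
      using \<open>0 \<le> R'\<close> by (intro mult_left_mono power_mono) (auto simp: R'_def)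
    finally show ?case by simp
  next
    case (4 g h z)
    then have gh: "cs_geodesic_on 1 g" "cs_geodesic_on 1 h" "g 0 = x" "h 0 = x" "g 1 = z" "h 1 = z" "z \<in> ball x r"
      by (auto simp: geodesic_from_to_def)
    \<comment> \<open>Two geodesics with the same ends form a triangle whose third side is constant
      at \<open>z\<close>.\<close>
    have c: "cs_geodesic_on 1 (\<lambda>_. z)" by (auto simp: cs_geodesic_on_def intro!: exI[of _ 0])
    have "thin_pair \<kappa> g (rev_curve (rev_curve h))"
      using gh c r by (intro thin[of g "\<lambda>_. z" "rev_curve h"] cs_geodesic_on_rev) (auto simp: rev_curve_def)
    then have t: "thin_pair \<kappa> g h" by (simp add: rev_curve_def)
    have "sqrt \<bar>\<kappa>\<bar> * dist x z \<le> sqrt \<bar>\<kappa>\<bar> * (2*r)" using d2[of x z] gh r by (intro mult_left_mono) auto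
    then have "sqrt \<bar>\<kappa>\<bar> * dist x z < pi" using kr pi_gt3 by linarith
    then show ?case using thin_pair_same_endpoint[OF t] gh by auto
  qed (use r in auto)
  then show thesis by (rule that)
qed

section \<open>Tangent cone\<close>

text \<open>Membership in \<open>geods_from\<close> hides the speed and the time of existence behind
  quantifiers. The speed \<open>L\<close> is the norm of the tangent vector, and \<open>T\<close>
  can be shrunk at will.\<close>

definition geo_germ :: "'a::metric_space \<Rightarrow> (real \<Rightarrow> 'a) \<Rightarrow> real \<Rightarrow> real \<Rightarrow> bool" where
  "geo_germ x g L T \<longleftrightarrow> 0 < T \<and> 0 \<le> L \<and> g 0 = x \<and>
     (\<forall>s\<in>{0..T}. \<forall>t\<in>{0..T}. dist (g s) (g t) = L * \<bar>s - t\<bar>)"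

lemma geods_fromE:
  assumes "g \<in> geods_from x" obtains L T where "geo_germ x g L T"
proof -
  obtain T where "g 0 = x" "T > 0" "cs_geodesic_on T g" using assms by (auto simp: geods_from_def)
  then show ?thesis using that unfolding cs_geodesic_on_def geo_germ_def by blast
qed

lemma geo_germ_geods_from: "geo_germ x g L T \<Longrightarrow> g \<in> geods_from x"
  unfolding geo_germ_def geods_from_def cs_geodesic_on_def by blast

lemma geo_germ_mono: "geo_germ x g L T \<Longrightarrow> 0 < T' \<Longrightarrow> T' \<le> T \<Longrightarrow> geo_germ x g L T'"
  unfolding geo_germ_def by auto

lemma geo_germ_dist: "geo_germ x g L T \<Longrightarrow> s \<in> {0..T} \<Longrightarrow> t \<in> {0..T} \<Longrightarrow> dist (g s) (g t) = L * \<bar>s - t\<bar>"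
  unfolding geo_germ_def by blast

lemma geo_germ_dist0: "geo_germ x g L T \<Longrightarrow> t \<in> {0..T} \<Longrightarrow> dist x (g t) = L * t"
  using geo_germ_dist[of x g L T 0 t] unfolding geo_germ_def by auto

lemma geo_germ_scale:
  assumes g: "geo_germ x g L T" and \<alpha>: "0 < \<alpha>"
  shows "geo_germ x (\<lambda>t. g (\<alpha> * t)) (\<alpha> * L) (T / \<alpha>)"
proof -
  have "dist (g (\<alpha> * s)) (g (\<alpha> * t)) = \<alpha> * L * \<bar>s - t\<bar>" if "s \<in> {0..T/\<alpha>}" "t \<in> {0..T/\<alpha>}" for s t
  proof -
    have "\<alpha> * s \<in> {0..T}" "\<alpha> * t \<in> {0..T}" using that \<alpha> by (auto simp: field_simps)
    then have "dist (g (\<alpha> * s)) (g (\<alpha> * t)) = L * \<bar>\<alpha> * s - \<alpha> * t\<bar>" by (rule geo_germ_dist[OF g])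
    also have "\<bar>\<alpha> * s - \<alpha> * t\<bar> = \<alpha> * \<bar>s - t\<bar>" using \<alpha> by (simp add: abs_mult flip: right_diff_distrib)
    finally show ?thesis by simp
  qed
  then show ?thesis using g \<alpha> by (auto simp: geo_germ_def)
qed

lemma geo_germ_const: "geo_germ x (\<lambda>_. x) 0 1"
  by (auto simp: geo_germ_def)

lemma geo_germ_geodesic_from_to:
  assumes "geodesic_from_to g x z" shows "geo_germ x g (dist x z) 1"
  using assms cs_geodesic_1_dist[of g] by (auto simp: geodesic_from_to_def geo_germ_def mult.commute)

lemma geo_germ_cs_geodesic:
  assumes g: "geo_germ x g L T" and t: "t \<in> {0..T}"
  shows "cs_geodesic_on 1 (\<lambda>s. g (s * t))"
  unfolding cs_geodesic_on_def
proof (intro exI[of _ "L * t"] conjI ballI)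
  show "0 \<le> L * t" using g t by (auto simp: geo_germ_def)
  fix s u :: real assume su: "s \<in> {0..1}" "u \<in> {0..1}"
  then have "s * t \<in> {0..T}" "u * t \<in> {0..T}" using t mult_left_le_one_le[of t s] mult_left_le_one_le[of t u] by auto
  then have "dist (g (s * t)) (g (u * t)) = L * \<bar>s * t - u * t\<bar>" by (rule geo_germ_dist[OF g])
  then show "dist (g (s * t)) (g (u * t)) = L * t * \<bar>s - u\<bar>" using t by (simp add: abs_mult flip: left_diff_distrib)
qed

lemma tendsto_of_almost_decreasing:
  fixes F :: "real \<Rightarrow> real"
  assumes T: "0 < T" and C: "0 \<le> C" and bound: "\<And>t. 0 < t \<Longrightarrow> t \<le> T \<Longrightarrow> F t \<le> B"
    and mono: "\<And>t th. 0 < t \<Longrightarrow> t \<le> T \<Longrightarrow> 1/2 \<le> th \<Longrightarrow> th \<le> 1 \<Longrightarrow> F t - C * t^2 \<le> F (th * t)"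
  shows "\<exists>L. (F \<longlongrightarrow> L) (at_right 0)"
proof -
  have half: "F t - C * t^2 \<le> F s" if "0 < t" "t \<le> T" "t/2 \<le> s" "s \<le> t" for s t
  proof -
    have "F t - C * t^2 \<le> F (s/t * t)" using that by (intro mono) (auto simp: field_simps)
    then show ?thesis using that by simp
  qed
  \<comment> \<open>The errors of successive halvings, \<open>C*t^2*(1 + 1/4 + 1/16 + ...)\<close>,
    stay below \<open>2*C*t^2\<close>.\<close>
  have ind: "F t - 2 * C * t^2 \<le> F s" if "0 < t" "t \<le> T" "t / 2^n \<le> s" "s \<le> t" for s t n
    using that
  proof (induction n arbitrary: t)
    case 0
    then show ?case using C by simp
  next
    case (Suc n)
    show ?case
    proof (cases "t/2 \<le> s")
      case True
      have "0 \<le> C * t^2" using C by simp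
      then show ?thesis using half[OF Suc.prems(1,2) True Suc.prems(4)] by linarith
    next
      case False
      have "F (t/2) - 2 * C * (t/2)^2 \<le> F s" using Suc.prems False by (intro Suc.IH) (auto simp: field_simps)
      moreover have "F t - C * t^2 \<le> F (t/2)" using Suc.prems by (intro half) auto
      moreover have "2 * C * (t/2)^2 = C * t^2 / 2" by (simp add: power2_eq_square)
      moreover have "0 \<le> C * t^2" using C by simp
      ultimately show ?thesis by linarith
    qed
  qed
  have all: "F t - 2 * C * t^2 \<le> F s" if st: "0 < s" "s \<le> t" "t \<le> T" for s t
  proof -
    obtain n where "t / s < 2^n" using real_arch_pow[of 2 "t/s"] by auto
    then have "t / 2^n \<le> s" using st by (simp add: field_simps)
    then show ?thesis using st by (intro ind) auto
  qed
  define S where "S = (\<lambda>t. F t - 2 * C * t^2) ` {0<..T}"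
  have bdd: "bdd_above S"
  proof (rule bdd_aboveI)
    fix y assume "y \<in> S"
    then obtain t where "0 < t" "t \<le> T" "y = F t - 2 * C * t^2" by (auto simp: S_def)
    moreover have "0 \<le> 2 * C * t^2" using C by simp
    ultimately show "y \<le> B" using bound[of t] by linarith
  qed
  have "(F \<longlongrightarrow> Sup S) (at_right 0)"
  proof (rule tendstoI)
    fix e :: real assume e: "0 < e"
    have "T \<in> {0<..T}" using T by simp
    then have "S \<noteq> {}" unfolding S_def by blast
    moreover have "Sup S - e < Sup S" using e by simp
    ultimately obtain t0 where t0: "0 < t0" "t0 \<le> T" "Sup S - e < F t0 - 2 * C * t0^2"
      unfolding less_cSup_iff[OF \<open>S \<noteq> {}\<close> bdd] by (auto simp: S_def)
    have "((\<lambda>t. 2 * C * t^2) \<longlongrightarrow> 2 * C * 0^2) (at_right (0::real))" by (intro tendsto_intros)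
    then have "\<forall>\<^sub>F t in at_right 0. 2 * C * t^2 < e" using e by (auto dest: order_tendstoD)
    moreover have "\<forall>\<^sub>F t in at_right 0. t \<in> {0<..<t0}" using t0 by (intro eventually_at_right_real) auto
    ultimately show "\<forall>\<^sub>F t in at_right 0. dist (F t) (Sup S) < e"
    proof eventually_elim
      case (elim t)
      have "F t - 2 * C * t^2 \<le> Sup S" using elim t0 by (intro cSup_upper bdd) (auto simp: S_def)
      moreover have "F t0 - 2 * C * t0^2 \<le> F t" using elim t0 by (intro all) auto
      ultimately show ?case using elim t0 by (auto simp: dist_real_def abs_less_iff)
    qed
  qed
  then show ?thesis ..
qed

locale near_cat0_at =
  fixes x :: "'a::metric_space" and r K :: real
  assumes near: "near_cat0 x r K"
begin

lemma r_pos: "0 < r" and K_nonneg: "0 \<le> K"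
  using near by (auto simp: near_cat0_def)

lemma comparison:
  assumes "p \<in> ball x r" "cs_geodesic_on 1 g" "g 0 \<in> ball x r" "g 1 \<in> ball x r" "s \<in> {0..1}"
    "dist p (g 0) \<le> R" "dist p (g 1) \<le> R" "dist (g 0) (g 1) \<le> R"
  shows "(dist p (g s))^2 \<le> (1-s) * (dist p (g 0))^2 + s * (dist p (g 1))^2
           - s * (1-s) * (dist (g 0) (g 1))^2 + K * R^4"
  using near assms unfolding near_cat0_def by blast

lemma geodesic_unique:
  assumes "z \<in> ball x r" "geodesic_from_to g x z" "geodesic_from_to h x z" "s \<in> {0..1}"
  shows "g s = h s"
  using near assms unfolding near_cat0_def by blast

text \<open>The bracket is twice the Euclidean inner product that the three side lengths would have.
  Comparison with vertex \<open>g s\<close> against the geodesic \<open>h\<close> shows that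
  shrinking one argument by \<open>th\<close> multiplies it by at least \<open>th\<close>, up to the
  error. The factor 16 is \<open>2^4\<close>, all sides being at most \<open>2*M\<close>.\<close>

lemma cross_comparison:
  assumes g: "geo_germ x g a T" and h: "geo_germ x h b T" and s: "s \<in> {0..T}" and u: "u \<in> {0..T}"
    and th: "th \<in> {0..1}" and M: "a * s \<le> M" "b * u \<le> M" "M < r"
  shows "th * ((a * s)^2 + (b * u)^2 - (dist (g s) (h u))^2) - 16 * K * M^4
      \<le> (a * s)^2 + (b * (th * u))^2 - (dist (g s) (h (th * u)))^2"
proof -
  have d: "dist x (g s) = a * s" "dist x (h u) = b * u" using geo_germ_dist0 g h s u by blast+
  have h0: "h 0 = x" using h by (simp add: geo_germ_def)
  have d3: "dist (g s) (h u) \<le> a * s + b * u" using dist_triangle3[of "g s" "h u" x] d by simp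
  have nn: "0 \<le> a * s" "0 \<le> b * u" using d zero_le_dist[of x] by metis+
  have "(dist (g s) (h (th * u)))^2 \<le> (1-th) * (dist (g s) (h (0 * u)))^2 + th * (dist (g s) (h (1 * u)))^2
           - th * (1-th) * (dist (h (0 * u)) (h (1 * u)))^2 + K * (2 * M)^4"
    using d d3 nn h0 M r_pos th by (intro comparison geo_germ_cs_geodesic[OF h u]) (auto simp: dist_commute)
  then have "(dist (g s) (h (th * u)))^2 \<le> (1-th) * (a * s)^2 + th * (dist (g s) (h u))^2
           - th * (1-th) * (b * u)^2 + 16 * K * M^4"
    using d h0 by (simp add: dist_commute power_mult_distrib mult_ac)
  then show ?thesis by (simp add: power2_eq_square algebra_simps)
qed

lemma germ_pair:
  assumes "g \<in> geods_from x" "h \<in> geods_from x"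
  obtains a b m T where "geo_germ x g a T" "geo_germ x h b T" "0 \<le> m" "a \<le> m" "b \<le> m" "m * T < r" "0 < T"
proof -
  obtain a T1 where g: "geo_germ x g a T1" using assms(1) by (rule geods_fromE)
  obtain b T2 where h: "geo_germ x h b T2" using assms(2) by (rule geods_fromE)
  define m where "m = max a b"
  have T12: "0 < T1" "0 < T2" "0 \<le> a" "0 \<le> b" using g h by (auto simp: geo_germ_def)
  define T where "T = min (min T1 T2) (r / (2 * (m + 1)))"
  have m: "0 \<le> m" using T12 by (auto simp: m_def)
  have T: "0 < T" using T12 m r_pos by (auto simp: T_def)
  have "m * T \<le> m * (r / (2 * (m + 1)))" using m by (intro mult_left_mono) (auto simp: T_def)
  also have "\<dots> < r" using m r_pos by (simp add: field_simps add_strict_increasing)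
  finally have "m * T < r" .
  moreover have "geo_germ x g a T" "geo_germ x h b T" using T geo_germ_mono[OF g] geo_germ_mono[OF h] by (auto simp: T_def)
  ultimately show ?thesis using that[of a T b m] m T by (auto simp: m_def)
qed

lemma germ_scale_less:
  fixes m :: real
  assumes m: "0 \<le> m" "a \<le> m" "b \<le> m" "m * T < r" and t: "0 \<le> t" "t \<le> T"
  shows "m * t < r" "a * t \<le> m * t" "b * t \<le> m * t"
proof -
  have "m * t \<le> m * T" using t m by (intro mult_left_mono) auto
  then show "m * t < r" using m by simp
qed (use t m in \<open>auto intro: mult_right_mono\<close>)

text \<open>Since \<open>geod_dist\<close> is defined through \<open>Lim\<close>, it has a meaning
  only once this is known. Shrinking the two arguments of \<open>q\<close> one after the other shows
  that \<open>q t t / t^2\<close> is almost monotone, and the triangle inequality bounds it by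
  \<open>2*a*b\<close>.\<close>

lemma geod_dist_tendsto:
  assumes "g \<in> geods_from x" "h \<in> geods_from x"
  shows "((\<lambda>t. dist (g t) (h t) / t) \<longlongrightarrow> geod_dist g h) (at_right 0)"
proof -
  obtain a b m T where g: "geo_germ x g a T" and h: "geo_germ x h b T" and m: "0 \<le> m" "a \<le> m" "b \<le> m" "m * T < r" and T: "0 < T"
    using germ_pair[OF assms] by metis
  have ab: "0 \<le> a" "0 \<le> b" using g h by (auto simp: geo_germ_def)
  define q where "q s u = (a * s)^2 + (b * u)^2 - (dist (g s) (h u))^2" for s u
  define F where "F t = q t t / t^2" for t
  note mt = germ_scale_less[OF m]
  have step: "F t - (128 * K * m^4) * t^2 \<le> F (th * t)" if t: "0 < t" "t \<le> T" and th: "1/2 \<le> th" "th \<le> 1" for t th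
  proof -
    have tht: "0 \<le> th * t" "th * t \<le> t" using t th by auto
    have 1: "th * q t t - 16 * K * (m * t)^4 \<le> q t (th * t)"
      unfolding q_def using t th mt[of t] by (intro cross_comparison[OF g h]) auto
    have "th * ((b * (th * t))^2 + (a * t)^2 - (dist (h (th * t)) (g t))^2) - 16 * K * (m * t)^4
      \<le> (b * (th * t))^2 + (a * (th * t))^2 - (dist (h (th * t)) (g (th * t)))^2"
    proof (rule cross_comparison[OF h g])
      show "b * (th * t) \<le> m * t" using mult_left_mono[OF tht(2) ab(2)] mt(3)[of t] t by linarith
      show "th * t \<in> {0..T}" using tht t unfolding atLeastAtMost_iff by linarith
    qed (use t th tht mt(1,2)[of t] in simp_all)
    then have 2: "th * q t (th * t) - 16 * K * (m * t)^4 \<le> q (th * t) (th * t)"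
      by (simp add: q_def dist_commute add.commute)
    have "th * (th * q t t - 16 * K * (m * t)^4) \<le> th * q t (th * t)" using 1 th by (intro mult_left_mono) auto
    moreover have "th * (16 * K * (m * t)^4) \<le> 16 * K * (m * t)^4"
      using th K_nonneg by (intro mult_left_le_one_le) auto
    ultimately have 3: "th^2 * q t t - 32 * K * (m * t)^4 \<le> q (th * t) (th * t)"
      using 2 by (simp add: power2_eq_square algebra_simps)
    have "F t - 32 * K * (m * t)^4 / (th * t)^2 = (th^2 * q t t - 32 * K * (m * t)^4) / (th * t)^2"
      using t th by (simp add: F_def power2_eq_square field_simps)
    also have "\<dots> \<le> F (th * t)" unfolding F_def using 3 by (intro divide_right_mono) auto
    finally have 4: "F t - 32 * K * (m * t)^4 / (th * t)^2 \<le> F (th * t)" .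
    have "32 * K * (m * t)^4 / (th * t)^2 = (32 * K * m^4 * t^2) / th^2"
      using t th by (simp add: power2_eq_square power4_eq_xxxx field_simps)
    \<comment> \<open>Here \<open>th \<ge> 1/2\<close> turns the error into a fixed multiple of
      \<open>t^2\<close>.\<close>
    also have "\<dots> \<le> (32 * K * m^4 * t^2) / (1/2)^2"
      using th K_nonneg by (intro divide_left_mono power_mono) auto
    finally show ?thesis using 4 by (simp add: power2_eq_square)
  qed
  have bound: "F t \<le> 2 * a * b" if t: "0 < t" "t \<le> T" for t
  proof -
    have "\<bar>a * t - b * t\<bar> \<le> dist (g t) (h t)"
      using geo_germ_dist0[OF g, of t] geo_germ_dist0[OF h, of t] t
        dist_triangle[of x "g t" "h t"] dist_triangle[of x "h t" "g t"] by (auto simp: dist_commute)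
    then have "(a * t - b * t)^2 \<le> (dist (g t) (h t))^2" by (subst abs_le_square_iff[symmetric]) auto
    then have "q t t \<le> 2 * a * b * t^2" by (simp add: q_def power2_eq_square algebra_simps)
    then show ?thesis using t by (simp add: F_def pos_divide_le_eq)
  qed
  obtain L where L: "(F \<longlongrightarrow> L) (at_right 0)"
    using tendsto_of_almost_decreasing[OF T _ bound step] K_nonneg by auto
  have "((\<lambda>t. sqrt (a^2 + b^2 - F t)) \<longlongrightarrow> sqrt (a^2 + b^2 - L)) (at_right 0)"
    by (intro tendsto_intros L)
  moreover have "\<forall>\<^sub>F t in at_right 0. sqrt (a^2 + b^2 - F t) = dist (g t) (h t) / t"
    unfolding eventually_at_filter
  proof (rule always_eventually, safe)
    fix t :: real assume t: "0 < t"
    have "a^2 + b^2 - F t = (dist (g t) (h t) / t)^2" using t by (simp add: F_def q_def power2_eq_square field_simps)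
    then show "sqrt (a^2 + b^2 - F t) = dist (g t) (h t) / t" using t by simp
  qed
  ultimately have lim: "((\<lambda>t. dist (g t) (h t) / t) \<longlongrightarrow> sqrt (a^2 + b^2 - L)) (at_right 0)"
    by (rule Lim_transform_eventually)
  then show ?thesis using tendsto_Lim[OF trivial_limit_at_right_real lim] by (simp add: geod_dist_def)
qed

lemma at_right_scale: "0 < \<alpha> \<Longrightarrow> filterlim (\<lambda>t. \<alpha> * t) (at_right 0) (at_right (0::real))"
  unfolding filterlim_at
  by (auto intro!: tendsto_eq_intros simp: eventually_at_filter)

lemma geod_dist_eqI:
  assumes "((\<lambda>t. dist (g t) (h t) / t) \<longlongrightarrow> l) (at_right 0)"
  shows "geod_dist g h = l"
  using tendsto_Lim[OF trivial_limit_at_right_real assms] by (simp add: geod_dist_def)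

lemma geod_dist_cong:
  assumes "0 < T" "\<And>t. t \<in> {0..T} \<Longrightarrow> g t = g' t"
  shows "geod_dist g h = geod_dist g' h" "geod_dist h g = geod_dist h g'"
proof -
  have ev: "\<forall>\<^sub>F t in at_right 0. t \<in> {0<..<T}" using assms by (intro eventually_at_right_real) auto
  show "geod_dist g h = geod_dist g' h" "geod_dist h g = geod_dist h g'"
    unfolding geod_dist_def Topological_Spaces.Lim_def
    by (intro arg_cong[where f=The] ext tendsto_cong eventually_mono[OF ev]; use assms in auto)+
qed

lemma geod_dist_nonneg: "g \<in> geods_from x \<Longrightarrow> h \<in> geods_from x \<Longrightarrow> 0 \<le> geod_dist g h"
  by (rule tendsto_lowerbound[OF geod_dist_tendsto]) (auto simp: eventually_at_filter)

lemma geod_dist_sym: "geod_dist g h = geod_dist h g"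
  by (simp add: geod_dist_def dist_commute)

lemma geod_dist_triangle:
  assumes "f \<in> geods_from x" "g \<in> geods_from x" "h \<in> geods_from x"
  shows "geod_dist f h \<le> geod_dist f g + geod_dist g h"
proof (rule tendsto_le[OF trivial_limit_at_right_real tendsto_add geod_dist_tendsto])
  show "\<forall>\<^sub>F t in at_right 0. dist (f t) (h t) / t \<le> dist (f t) (g t) / t + dist (g t) (h t) / t"
    by (auto simp: eventually_at_filter dist_triangle divide_right_mono simp flip: add_divide_distrib)
qed (use assms in \<open>auto intro: geod_dist_tendsto\<close>)

lemma geod_dist_const:
  assumes "geo_germ x g L T" shows "geod_dist g (\<lambda>_. x) = L"
proof (rule geod_dist_eqI, rule tendsto_eventually)
  have "0 < T" using assms by (simp add: geo_germ_def)
  then have "\<forall>\<^sub>F t in at_right 0. t \<in> {0<..<T}" by (rule eventually_at_right_real)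
  then show "\<forall>\<^sub>F t in at_right 0. dist (g t) x / t = L"
    by eventually_elim (use geo_germ_dist0[OF assms] in \<open>auto simp: dist_commute\<close>)
qed

lemma const_geods_from: "(\<lambda>_. x) \<in> geods_from x"
  using geo_germ_const by (rule geo_germ_geods_from)

lemma geods_from_scale: "g \<in> geods_from x \<Longrightarrow> 0 < \<alpha> \<Longrightarrow> (\<lambda>t. g (\<alpha> * t)) \<in> geods_from x"
  by (metis geods_fromE geo_germ_scale geo_germ_geods_from)

definition gip :: "(real \<Rightarrow> 'a) \<Rightarrow> (real \<Rightarrow> 'a) \<Rightarrow> real" where
  "gip g h = ((geod_dist g (\<lambda>_. x))^2 + (geod_dist h (\<lambda>_. x))^2 - (geod_dist g h)^2) / 2"

text \<open>One-sided comparison is enough for an equality: shrinking only \<open>h\<close> gives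
  \<open>\<alpha> * I \<le> J\<close>, and shrinking then \<open>g\<close> as well arrives at the
  pairing of \<open>g\<close> and \<open>h\<close> at time \<open>\<alpha>*t\<close>, so
  \<open>\<alpha> * J \<le> \<alpha>^2 * I\<close>.\<close>

lemma gip_scale_le_1:
  assumes "g \<in> geods_from x" "h \<in> geods_from x" and \<alpha>: "0 < \<alpha>" "\<alpha> \<le> 1"
  shows "gip g (\<lambda>t. h (\<alpha> * t)) = \<alpha> * gip g h"
proof -
  obtain a b m T where g: "geo_germ x g a T" and h: "geo_germ x h b T" and m: "0 \<le> m" "a \<le> m" "b \<le> m" "m * T < r" and T: "0 < T"
    using germ_pair[OF assms(1,2)] by metis
  have ab: "0 \<le> a" "0 \<le> b" using g h by (auto simp: geo_germ_def)
  note mt = germ_scale_less[OF m]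
  define q where "q s u = (a * s)^2 + (b * u)^2 - (dist (g s) (h u))^2" for s u
  define I where "I = gip g h"
  define J where "J = gip g (\<lambda>t. h (\<alpha> * t))"
  have h\<alpha>: "(\<lambda>t. h (\<alpha> * t)) \<in> geods_from x" using assms by (intro geods_from_scale) auto
  have "((\<lambda>t. a^2 + b^2 - (dist (g t) (h t) / t)^2) \<longlongrightarrow> a^2 + b^2 - (geod_dist g h)^2) (at_right 0)"
    by (intro tendsto_intros geod_dist_tendsto assms)
  moreover have "\<forall>\<^sub>F t in at_right 0. a^2 + b^2 - (dist (g t) (h t) / t)^2 = q t t / t^2"
    by (auto simp: eventually_at_filter q_def power2_eq_square field_simps)
  ultimately have "((\<lambda>t. q t t / t^2) \<longlongrightarrow> a^2 + b^2 - (geod_dist g h)^2) (at_right 0)"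
    by (rule Lim_transform_eventually)
  moreover have "a^2 + b^2 - (geod_dist g h)^2 = 2 * I"
    unfolding I_def gip_def geod_dist_const[OF g] geod_dist_const[OF h] by simp
  ultimately have I: "((\<lambda>t. q t t / t^2) \<longlongrightarrow> 2 * I) (at_right 0)" by simp
  have "((\<lambda>t. a^2 + (\<alpha> * b)^2 - (dist (g t) (h (\<alpha> * t)) / t)^2) \<longlongrightarrow> a^2 + (\<alpha> * b)^2 - (geod_dist g (\<lambda>t. h (\<alpha> * t)))^2) (at_right 0)"
    by (intro tendsto_intros geod_dist_tendsto assms h\<alpha>)
  moreover have "\<forall>\<^sub>F t in at_right 0. a^2 + (\<alpha> * b)^2 - (dist (g t) (h (\<alpha> * t)) / t)^2 = q t (\<alpha> * t) / t^2"
    by (auto simp: eventually_at_filter q_def power2_eq_square field_simps)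
  ultimately have "((\<lambda>t. q t (\<alpha> * t) / t^2) \<longlongrightarrow> a^2 + (\<alpha> * b)^2 - (geod_dist g (\<lambda>t. h (\<alpha> * t)))^2) (at_right 0)"
    by (rule Lim_transform_eventually)
  moreover have "a^2 + (\<alpha> * b)^2 - (geod_dist g (\<lambda>t. h (\<alpha> * t)))^2 = 2 * J"
    unfolding J_def gip_def geod_dist_const[OF g] geod_dist_const[OF geo_germ_scale[OF h \<alpha>(1)]] by simp
  ultimately have J: "((\<lambda>t. q t (\<alpha> * t) / t^2) \<longlongrightarrow> 2 * J) (at_right 0)" by simp
  have "((\<lambda>t. q (\<alpha> * t) (\<alpha> * t) / (\<alpha> * t)^2) \<longlongrightarrow> 2 * I) (at_right 0)"
    using filterlim_compose[OF I at_right_scale[OF \<alpha>(1)]] .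
  then have "((\<lambda>t. \<alpha>^2 * (q (\<alpha> * t) (\<alpha> * t) / (\<alpha> * t)^2)) \<longlongrightarrow> \<alpha>^2 * (2 * I)) (at_right 0)"
    by (intro tendsto_intros)
  then have I2: "((\<lambda>t. q (\<alpha> * t) (\<alpha> * t) / t^2) \<longlongrightarrow> \<alpha>^2 * (2 * I)) (at_right 0)"
    using \<alpha> by (simp add: power_mult_distrib)
  have err: "((\<lambda>t. 16 * K * m^4 * t^2) \<longlongrightarrow> 0) (at_right (0::real))" by (auto intro!: tendsto_eq_intros)
  have ev: "\<forall>\<^sub>F t in at_right 0. t \<in> {0<..<T}" using T by (rule eventually_at_right_real)
  have "\<alpha> * (2 * I) - 0 \<le> 2 * J"
  proof (rule tendsto_le[OF trivial_limit_at_right_real J tendsto_diff[OF tendsto_mult[OF tendsto_const I] err]])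
    show "\<forall>\<^sub>F t in at_right 0. \<alpha> * (q t t / t^2) - 16 * K * m^4 * t^2 \<le> q t (\<alpha> * t) / t^2"
      using ev
    proof eventually_elim
      case (elim t)
      have "\<alpha> * q t t - 16 * K * (m * t)^4 \<le> q t (\<alpha> * t)"
        unfolding q_def using elim \<alpha> mt[of t] by (intro cross_comparison[OF g h]) auto
      then have "(\<alpha> * q t t - 16 * K * (m * t)^4) / t^2 \<le> q t (\<alpha> * t) / t^2" by (intro divide_right_mono) auto
      also have "(\<alpha> * q t t - 16 * K * (m * t)^4) / t^2 = \<alpha> * (q t t / t^2) - 16 * K * m^4 * t^2"
        using elim by (simp add: power2_eq_square power4_eq_xxxx field_simps)
      finally show ?case .
    qed
  qed
  moreover have "\<alpha> * (2 * J) - 0 \<le> \<alpha>^2 * (2 * I)"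
  proof (rule tendsto_le[OF trivial_limit_at_right_real I2 tendsto_diff[OF tendsto_mult[OF tendsto_const J] err]])
    show "\<forall>\<^sub>F t in at_right 0. \<alpha> * (q t (\<alpha> * t) / t^2) - 16 * K * m^4 * t^2 \<le> q (\<alpha> * t) (\<alpha> * t) / t^2"
      using ev
    proof eventually_elim
      case (elim t)
      have \<alpha>t: "0 \<le> \<alpha> * t" "\<alpha> * t \<le> t" using elim \<alpha> by auto
      have "\<alpha> * ((b * (\<alpha> * t))^2 + (a * t)^2 - (dist (h (\<alpha> * t)) (g t))^2) - 16 * K * (m * t)^4
        \<le> (b * (\<alpha> * t))^2 + (a * (\<alpha> * t))^2 - (dist (h (\<alpha> * t)) (g (\<alpha> * t)))^2"
      proof (rule cross_comparison[OF h g])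
        have "b * t \<le> m * t" using elim by (intro mt) auto
        then show "b * (\<alpha> * t) \<le> m * t" using mult_left_mono[OF \<alpha>t(2) ab(2)] by linarith
        have "t \<le> T" using elim by simp
        then show "\<alpha> * t \<in> {0..T}" using \<alpha>t unfolding atLeastAtMost_iff by linarith
      qed (use elim \<alpha> mt(1,2)[of t] in simp_all)
      then have "\<alpha> * q t (\<alpha> * t) - 16 * K * (m * t)^4 \<le> q (\<alpha> * t) (\<alpha> * t)"
        by (simp add: q_def dist_commute add.commute)
      then have "(\<alpha> * q t (\<alpha> * t) - 16 * K * (m * t)^4) / t^2 \<le> q (\<alpha> * t) (\<alpha> * t) / t^2" by (intro divide_right_mono) auto
      also have "(\<alpha> * q t (\<alpha> * t) - 16 * K * (m * t)^4) / t^2 = \<alpha> * (q t (\<alpha> * t) / t^2) - 16 * K * m^4 * t^2"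
        using elim by (simp add: power2_eq_square power4_eq_xxxx field_simps)
      finally show ?case .
    qed
  qed
  ultimately show ?thesis using \<alpha> by (simp add: I_def J_def power2_eq_square)
qed

lemma gip_scale:
  assumes g: "g \<in> geods_from x" and h: "h \<in> geods_from x" and \<alpha>: "0 < \<alpha>"
  shows "gip g (\<lambda>t. h (\<alpha> * t)) = \<alpha> * gip g h"
proof (cases "\<alpha> \<le> 1")
  case True
  then show ?thesis using gip_scale_le_1[OF g h \<alpha>] by simp
next
  case False
  have "gip g (\<lambda>t. h (\<alpha> * (1/\<alpha> * t))) = 1/\<alpha> * gip g (\<lambda>t. h (\<alpha> * t))"
    using False \<alpha> geods_from_scale[OF h \<alpha>] by (intro gip_scale_le_1[OF g]) auto
  then show ?thesis using \<alpha> by (simp add: field_simps)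
qed

section \<open>The completed cone: distance, norm and scalar product\<close>

lemma tcone_range: "v \<in> tcone x \<Longrightarrow> v n \<in> geods_from x"
  by (auto simp: tcone_def)

lemma tdist_tendsto:
  assumes v: "v \<in> tcone x" and w: "w \<in> tcone x"
  shows "(\<lambda>n. geod_dist (v n) (w n)) \<longlonglongrightarrow> tdist v w"
proof -
  have "Cauchy (\<lambda>n. geod_dist (v n) (w n))"
  proof (rule CauchyI)
    fix e :: real assume "0 < e"
    then have e: "0 < e/2" by simp
    obtain M where M: "\<And>m n. m \<ge> M \<Longrightarrow> n \<ge> M \<Longrightarrow> geod_dist (v m) (v n) < e/2" using v e unfolding tcone_def by blast
    obtain N where N: "\<And>m n. m \<ge> N \<Longrightarrow> n \<ge> N \<Longrightarrow> geod_dist (w m) (w n) < e/2" using w e unfolding tcone_def by blast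
    show "\<exists>M. \<forall>m\<ge>M. \<forall>n\<ge>M. norm (geod_dist (v m) (w m) - geod_dist (v n) (w n)) < e"
    proof (intro exI[of _ "max M N"] allI impI)
      fix m n assume mn: "max M N \<le> m" "max M N \<le> n"
      note [simp] = tcone_range[OF v] tcone_range[OF w]
      have "geod_dist (v m) (w m) \<le> geod_dist (v m) (v n) + (geod_dist (v n) (w n) + geod_dist (w n) (w m))"
        using geod_dist_triangle[of "v m" "v n" "w m"] geod_dist_triangle[of "v n" "w n" "w m"] by simp
      moreover have "geod_dist (v n) (w n) \<le> geod_dist (v n) (v m) + (geod_dist (v m) (w m) + geod_dist (w m) (w n))"
        using geod_dist_triangle[of "v n" "v m" "w n"] geod_dist_triangle[of "v m" "w m" "w n"] by simp
      ultimately show "norm (geod_dist (v m) (w m) - geod_dist (v n) (w n)) < e"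
        using mn M[of m n] N[of n m] M[of n m] N[of m n] by (simp add: abs_less_iff)
    qed
  qed
  then show ?thesis unfolding tdist_def using Cauchy_convergent convergent_LIMSEQ_iff by blast
qed

lemma tvec_tcone: "g \<in> geods_from x \<Longrightarrow> tvec g \<in> tcone x"
proof -
  assume g: "g \<in> geods_from x"
  have "geod_dist g g = 0" by (rule geod_dist_eqI) simp
  then show ?thesis using g by (auto simp: tcone_def tvec_def)
qed

lemma tzero_eq: "tzero x = tvec (\<lambda>_. x)"
  by (simp add: tzero_def tvec_def)

lemma tzero_tcone: "tzero x \<in> tcone x"
  unfolding tzero_eq by (rule tvec_tcone[OF const_geods_from])

lemma tnorm_tendsto:
  assumes "v \<in> tcone x" shows "(\<lambda>n. geod_dist (v n) (\<lambda>_. x)) \<longlonglongrightarrow> tnorm x v"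
  using tdist_tendsto[OF assms tzero_tcone] by (simp add: tzero_def tnorm_def)

lemma tnorm_tvec: "geo_germ x g L T \<Longrightarrow> tnorm x (tvec g) = L"
  using LIMSEQ_unique[OF tnorm_tendsto[OF tvec_tcone[OF geo_germ_geods_from]]] geod_dist_const
  by (force simp: tvec_def)

lemma tdist_nonneg: "v \<in> tcone x \<Longrightarrow> w \<in> tcone x \<Longrightarrow> 0 \<le> tdist v w"
  by (rule LIMSEQ_le_const[OF tdist_tendsto]) (auto intro!: exI geod_dist_nonneg tcone_range)

lemma tnorm_nonneg: "v \<in> tcone x \<Longrightarrow> 0 \<le> tnorm x v"
  unfolding tnorm_def by (intro tdist_nonneg tzero_tcone)

lemma abs_tnorm_diff_le:
  assumes v: "v \<in> tcone x" and w: "w \<in> tcone x"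
  shows "\<bar>tnorm x v - tnorm x w\<bar> \<le> tdist v w"
proof (rule LIMSEQ_le[OF tendsto_rabs[OF tendsto_diff[OF tnorm_tendsto[OF v] tnorm_tendsto[OF w]]] tdist_tendsto[OF v w]])
  have "\<bar>geod_dist (v n) (\<lambda>_. x) - geod_dist (w n) (\<lambda>_. x)\<bar> \<le> geod_dist (v n) (w n)" for n
    using geod_dist_triangle[OF tcone_range[OF v, of n] tcone_range[OF w, of n] const_geods_from]
      geod_dist_triangle[OF tcone_range[OF w, of n] tcone_range[OF v, of n] const_geods_from]
    by (auto simp: geod_dist_sym[of "w n" "v n"])
  then show "\<exists>N. \<forall>n\<ge>N. \<bar>geod_dist (v n) (\<lambda>_. x) - geod_dist (w n) (\<lambda>_. x)\<bar> \<le> geod_dist (v n) (w n)" by blast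
qed

text \<open>Squaring the reverse triangle inequality through the vertex; no angles are
  involved.\<close>

lemma tinner_le:
  assumes v: "v \<in> tcone x" and w: "w \<in> tcone x"
  shows "tinner x v w \<le> tnorm x v * tnorm x w"
proof -
  have "(tnorm x v - tnorm x w)^2 \<le> (tdist v w)^2"
    using abs_tnorm_diff_le[OF assms] by (subst abs_le_square_iff[symmetric]) auto
  then show ?thesis by (simp add: tinner_def power2_eq_square algebra_simps)
qed

lemma tinner_tendsto:
  assumes v: "v \<in> tcone x" and w: "w \<in> tcone x"
  shows "(\<lambda>n. gip (v n) (w n)) \<longlonglongrightarrow> tinner x v w"
  unfolding gip_def tinner_def by (intro tendsto_intros tnorm_tendsto tdist_tendsto assms) simp

lemma tscale_tvec: "tscale \<alpha> (tvec g) = tvec (\<lambda>t. g (\<alpha> * t))"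
  by (simp add: tscale_def tvec_def)

lemma tinner_tscale:
  assumes v: "v \<in> tcone x" and g: "g \<in> geods_from x" and \<alpha>: "0 < \<alpha>"
  shows "tinner x v (tscale \<alpha> (tvec g)) = \<alpha> * tinner x v (tvec g)"
proof (rule LIMSEQ_unique)
  show "(\<lambda>n. gip (v n) (tvec (\<lambda>t. g (\<alpha> * t)) n)) \<longlonglongrightarrow> tinner x v (tscale \<alpha> (tvec g))"
    unfolding tscale_tvec by (intro tinner_tendsto v tvec_tcone geods_from_scale g \<alpha>)
  have "(\<lambda>n. \<alpha> * gip (v n) (tvec g n)) \<longlonglongrightarrow> \<alpha> * tinner x v (tvec g)"
    by (intro tendsto_intros tinner_tendsto v tvec_tcone g)
  then show "(\<lambda>n. gip (v n) (tvec (\<lambda>t. g (\<alpha> * t)) n)) \<longlonglongrightarrow> \<alpha> * tinner x v (tvec g)"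
    using gip_scale[OF tcone_range[OF v] g \<alpha>] by (simp add: tvec_def)
qed

lemma tinner_cong:
  assumes "0 < T" "\<And>t. t \<in> {0..T} \<Longrightarrow> g t = g' t"
  shows "tinner x v (tvec g) = tinner x v (tvec g')"
  unfolding tinner_def tnorm_def tdist_def tvec_def using geod_dist_cong[of T g g', OF assms] by simp

end

section \<open>Slope and minus-subdifferential\<close>

locale lambda_convex_function =
  fixes lam :: real and E :: "'a::metric_space \<Rightarrow> ereal"
  assumes geodesic: "geodesic_space TYPE('a)"
    and not_MInf: "E z \<noteq> -\<infinity>"
    and convex: "lambda_convex lam E"
begin

lemma finiteE: assumes "E z < \<infinity>" obtains b where "E z = ereal b"
  using assms not_MInf[of z] by (cases "E z") auto

lemma ex_geodesic: fixes p q :: 'a obtains g where "geodesic_from_to g p q"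
  using geodesic unfolding geodesic_space_def by blast

lemma convex_le:
  assumes g: "cs_geodesic_on 1 g" and "E (g 0) \<le> ereal b0" "E (g 1) \<le> ereal b1" and t: "t \<in> {0..1}"
  shows "E (g t) \<le> ereal ((1-t) * b0 + t * b1 - lam/2 * t * (1-t) * (dist (g 0) (g 1))^2)"
proof -
  have "E (g 0) < \<infinity>" "E (g 1) < \<infinity>" using assms by auto
  then obtain c0 c1 where c: "E (g 0) = ereal c0" "E (g 1) = ereal c1" by (metis finiteE)
  have "E (g t) \<le> ereal (1 - t) * E (g 0) + ereal t * E (g 1) - ereal (lam / 2 * t * (1 - t) * (dist (g 0) (g 1))^2)"
    using convex g t unfolding lambda_convex_def by blast
  also have "\<dots> = ereal ((1-t) * c0 + t * c1 - lam/2 * t * (1-t) * (dist (g 0) (g 1))^2)" by (simp add: c)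
  also have "\<dots> \<le> ereal ((1-t) * b0 + t * b1 - lam/2 * t * (1-t) * (dist (g 0) (g 1))^2)"
    using assms c t by (auto intro!: add_mono mult_left_mono)
  finally show ?thesis .
qed

lemma slope_nonneg: "0 \<le> slope E x"
  by (simp add: slope_def)

text \<open>Replaces the extended-real quotient by an inequality without division or positive part.
  Positivity of \<open>c\<close> matters: where \<open>E z \<ge> E x\<close>, in particular where
  \<open>E z\<close> is infinite, the quotient is 0.\<close>

lemma slope_quotient_less:
  assumes x: "E x = ereal ex" and xz: "z \<noteq> x" and c: "0 < c"
  shows "max 0 (E x - E z) / ereal (dist x z) < ereal c \<longleftrightarrow> ereal (ex - c * dist x z) < E z"
proof (cases "E z")
  case (real b)
  have "max 0 (E x - E z) = ereal (max 0 (ex - b))" unfolding x real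
    by (simp only: zero_ereal_def ereal_max ereal_minus)
  then have "max 0 (E x - E z) / ereal (dist x z) = ereal (max 0 (ex - b) / dist x z)" using xz by (simp only:) (simp del: ereal_max)
  then have "max 0 (E x - E z) / ereal (dist x z) < ereal c \<longleftrightarrow> max 0 (ex - b) < c * dist x z"
    using xz by (simp add: pos_divide_less_eq)
  also have "\<dots> \<longleftrightarrow> ex - b < c * dist x z"
  proof -
    have "0 < c * dist x z" using xz c by (metis dist_pos_lt mult_pos_pos)
    then show ?thesis by auto
  qed
  finally show ?thesis by (auto simp: real algebra_simps)
next
  case PInf
  then show ?thesis using x c by (simp add: max_def)
next
  case MInf
  then show ?thesis using not_MInf by simp
qed

lemma slope_less_imp_eventually:
  assumes x: "E x = ereal ex" and c: "slope E x < ereal c"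
  shows "\<forall>\<^sub>F z in at x. ereal (ex - c * dist x z) < E z"
proof -
  have c0: "0 < c" using c slope_nonneg[of x] by (metis ereal_less(2) order_le_less_trans)
  have "Limsup (at x) (\<lambda>z. max 0 (E x - E z) / ereal (dist x z)) < ereal c" using c by (simp add: slope_def)
  then have "\<forall>\<^sub>F z in at x. max 0 (E x - E z) / ereal (dist x z) < ereal c" by (rule Limsup_lessD)
  moreover have "\<forall>\<^sub>F z in at x. z \<noteq> x" by (simp add: eventually_at_filter)
  ultimately show ?thesis by eventually_elim (use slope_quotient_less[OF x _ c0] in auto)
qed

lemma slope_leI:
  assumes x: "E x = ereal ex" and c: "0 < c" and ev: "\<forall>\<^sub>F z in at x. ereal (ex - c * dist x z) < E z"
  shows "slope E x \<le> ereal c"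
proof -
  have "\<forall>\<^sub>F z in at x. z \<noteq> x" by (simp add: eventually_at_filter)
  with ev have "\<forall>\<^sub>F z in at x. max 0 (E x - E z) / ereal (dist x z) \<le> ereal c"
    by eventually_elim (use slope_quotient_less[OF x _ c] in \<open>auto intro: less_imp_le\<close>)
  then have "Limsup (at x) (\<lambda>z. max 0 (E x - E z) / ereal (dist x z)) \<le> ereal c" by (rule Limsup_bounded)
  then show ?thesis using c by (simp add: slope_def)
qed

lemma slope_le_of_quadratic_bound:
  assumes x: "E x = ereal ex" and c: "0 \<le> c" and C: "0 \<le> C"
    and bound: "\<And>z. ereal (ex - c * dist x z - C * (dist x z)^2) \<le> E z"
  shows "slope E x \<le> ereal c"
proof (rule ereal_le_epsilon2)
  fix e :: real assume e: "0 < e"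
  have "((\<lambda>z. C * dist x z) \<longlongrightarrow> C * dist x x) (at x)" by (intro tendsto_intros)
  then have "\<forall>\<^sub>F z in at x. C * dist x z < e" using e by (auto dest: order_tendstoD)
  moreover have "\<forall>\<^sub>F z in at x. z \<noteq> x" by (simp add: eventually_at_filter)
  ultimately have "\<forall>\<^sub>F z in at x. ereal (ex - (c + e) * dist x z) < E z"
  proof eventually_elim
    case (elim z)
    have "C * dist x z * dist x z < e * dist x z" using elim by (intro mult_strict_right_mono) auto
    then have "ex - (c + e) * dist x z < ex - c * dist x z - C * (dist x z)^2"
      by (simp add: power2_eq_square algebra_simps)
    then show ?case using bound[of z] by (metis ereal_less(1) less_ereal.simps(1) order_less_le_trans)
  qed
  then have "slope E x \<le> ereal (c + e)" using c e by (intro slope_leI[OF x]) auto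
  then show "slope E x \<le> ereal c + ereal e" by simp
qed

text \<open>The slope is a local notion, but convexity propagates it: apply the local bound at
  \<open>g t\<close> on a geodesic to \<open>z\<close>, bound \<open>E (g t)\<close> above by
  convexity, divide by \<open>t\<close> and let \<open>t\<close> tend to 0.\<close>

lemma slope_global_bound:
  assumes x: "E x = ereal ex" and S: "slope E x = ereal S"
  shows "ereal (ex - S * dist x z + lam/2 * (dist x z)^2) \<le> E z"
proof (cases "E z = \<infinity> \<or> z = x")
  case True
  then show ?thesis using x by auto
next
  case False
  then obtain b where b: "E z = ereal b" using finiteE[of z] by auto
  define d where "d = dist x z"
  have d: "0 < d" using False by (auto simp: d_def)
  obtain g where "geodesic_from_to g x z" by (rule ex_geodesic)
  then have g: "cs_geodesic_on 1 g" "g 0 = x" "g 1 = z" by (auto simp: geodesic_from_to_def)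
  have gd: "dist x (g t) = t * d" if "t \<in> {0..1}" for t
    using cs_geodesic_1_dist[OF g(1), of 0 t] that g by (simp add: d_def)
  have ev01: "\<forall>\<^sub>F t in at_right (0::real). t \<in> {0<..<1}" by (rule eventually_at_right_real) simp
  have "((\<lambda>t. dist (g t) x) \<longlongrightarrow> 0) (at_right 0)"
  proof (rule Lim_transform_eventually)
    show "((\<lambda>t. t * d) \<longlongrightarrow> 0) (at_right 0)" by (auto intro!: tendsto_eq_intros)
    show "\<forall>\<^sub>F t in at_right 0. t * d = dist (g t) x" using ev01
      by eventually_elim (use gd in \<open>auto simp: dist_commute\<close>)
  qed
  then have "(g \<longlongrightarrow> x) (at_right 0)" using tendsto_dist_iff by blast
  moreover have "\<forall>\<^sub>F t in at_right 0. g t \<noteq> x" using ev01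
  proof eventually_elim
    case (elim t)
    then have "dist x (g t) > 0" using gd[of t] d by auto
    then show ?case by auto
  qed
  ultimately have lim: "filterlim g (at x) (at_right 0)" by (simp add: filterlim_at)
  have "- (S * d) \<le> b - ex - lam/2 * d^2"
  proof (rule field_le_epsilon)
    fix e :: real assume e: "0 < e"
    define eps where "eps = e / d"
    have "slope E x < ereal (S + eps)" using S e d by (simp add: eps_def)
    from slope_less_imp_eventually[OF x this]
    have "\<forall>\<^sub>F t in at_right 0. ereal (ex - (S + eps) * dist x (g t)) < E (g t)"
      using lim by (rule eventually_compose_filterlim)
    then have "\<forall>\<^sub>F t in at_right 0. - ((S + eps) * d) \<le> b - ex - lam/2 * (1-t) * d^2" using ev01
    proof eventually_elim
      case (elim t)
      have "ereal (ex - (S + eps) * (t * d)) < E (g t)" using elim gd[of t] by simp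
      also have "\<dots> \<le> ereal ((1-t) * ex + t * b - lam/2 * t * (1-t) * (dist (g 0) (g 1))^2)"
        using elim g x b by (intro convex_le) auto
      finally have "ex - (S + eps) * (t * d) < (1-t) * ex + t * b - lam/2 * t * (1-t) * d^2"
        using g by (simp add: d_def)
      then have "t * (- ((S + eps) * d)) < t * (b - ex - lam/2 * (1-t) * d^2)" by (simp add: algebra_simps)
      then have "- ((S + eps) * d) < b - ex - lam/2 * (1-t) * d^2"
        using elim by (simp only: mult_less_cancel_left_pos greaterThanLessThan_iff)
      then show ?case by simp
    qed
    moreover have "((\<lambda>t. b - ex - lam/2 * (1-t) * d^2) \<longlongrightarrow> b - ex - lam/2 * (1-0) * d^2) (at_right 0)"
      by (intro tendsto_intros)
    ultimately have "- ((S + eps) * d) \<le> b - ex - lam/2 * (1-0) * d^2"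
      by (intro tendsto_lowerbound[OF _ _ trivial_limit_at_right_real])
    then show "- (S * d) \<le> b - ex - lam/2 * d^2 + e" using d by (simp add: eps_def algebra_simps)
  qed
  then show ?thesis using b by (simp add: d_def)
qed

lemma slope_attained:
  assumes x: "E x = ereal ex" and S: "slope E x = ereal S" "0 < S" and e: "0 < e" and \<delta>: "0 < \<delta>"
  obtains z b where "z \<noteq> x" "dist x z < \<delta>" "E z = ereal b" "b \<le> ex - (S - e) * dist x z"
proof -
  \<comment> \<open>The second entry keeps \<open>c\<close> positive when \<open>e\<close> exceeds
    \<open>S\<close>.\<close>
  define c where "c = max (S - e) (S/2)"
  have c: "0 < c" "c < S" "S - e \<le> c" using S e by (auto simp: c_def max_def)
  have "\<not> (\<forall>\<^sub>F z in at x. ereal (ex - c * dist x z) < E z)"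
    using slope_leI[OF x c(1)] S c by auto
  then have "\<exists>\<^sub>F z in at x. E z \<le> ereal (ex - c * dist x z)" by (simp add: frequently_def not_le)
  moreover have "\<forall>\<^sub>F z in at x. z \<in> ball x \<delta> - {x}" using \<delta>
    by (auto simp: eventually_at dist_commute intro!: exI[of _ \<delta>])
  ultimately have "\<exists>\<^sub>F z in at x. E z \<le> ereal (ex - c * dist x z) \<and> z \<in> ball x \<delta> - {x}"
    by (rule frequently_eventually_frequently)
  then obtain z where z: "E z \<le> ereal (ex - c * dist x z)" "z \<in> ball x \<delta> - {x}"
    by (auto dest: frequently_ex)
  then have "E z < \<infinity>" by auto
  then obtain b where b: "E z = ereal b" by (rule finiteE)
  have "(S - e) * dist x z \<le> c * dist x z" using c by (intro mult_right_mono) auto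
  then have "b \<le> ex - (S - e) * dist x z" using z b by simp
  then show ?thesis using that z b by auto
qed

end

locale lambda_convex_at = near_cat0_at x r K + lambda_convex_function lam E
  for x :: "'a::metric_space" and r K lam and E :: "'a \<Rightarrow> ereal" +
  fixes ex :: real
  assumes Ex: "E x = ereal ex"
begin

text \<open>At the point with parameter \<open>th\<close> on a geodesic from \<open>g s\<close> to
  \<open>h s\<close>, convexity says that the energy has dropped at least at the interpolated rate,
  the slope limits the drop by \<open>S\<close> times the distance to \<open>x\<close>, and
  comparison limits that distance. Divide by \<open>s^2\<close> and let \<open>s\<close> tend to 0.
  With two nearly steepest geodesics this bounds the distance of their directions; with one of them
  and an arbitrary geodesic it yields the subdifferential inequality.\<close>

lemma steep_pair_bound:
  assumes S: "slope E x = ereal S"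
    and g: "g \<in> geods_from x" and h: "h \<in> geods_from x"
    and Eg: "\<forall>\<^sub>F s in at_right 0. E (g s) \<le> ereal (ex - s * A)"
    and Eh: "\<forall>\<^sub>F s in at_right 0. E (h s) \<le> ereal (ex - s * B)"
    and th: "th \<in> {0..1}"
  shows "(1-th) * A + th * B \<le> (S^2 + (1-th) * (geod_dist g (\<lambda>_. x))^2 + th * (geod_dist h (\<lambda>_. x))^2 - th * (1-th) * (geod_dist g h)^2) / 2"
proof -
  obtain a b m T where gg: "geo_germ x g a T" and hh: "geo_germ x h b T" and m: "0 \<le> m" "a \<le> m" "b \<le> m" "m * T < r" and T: "0 < T"
    using germ_pair[OF g h] by metis
  have ab: "0 \<le> a" "0 \<le> b" using gg hh by (auto simp: geo_germ_def)
  define P where "P s = (1-th) * a^2 + th * b^2 - th * (1-th) * (dist (g s) (h s) / s)^2 + 16 * K * m^4 * s^2" for s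
  have ev: "\<forall>\<^sub>F t in at_right 0. t \<in> {0<..<T}" using T by (rule eventually_at_right_real)
  have "\<forall>\<^sub>F s in at_right 0. (1-th) * A + th * B \<le> S^2 / 2 + P s / 2 + abs lam/2 * s * ((dist (g s) (h s) / s)^2 + P s)"
    using Eg Eh ev
  proof eventually_elim
    case (elim s)
    then have s: "0 < s" "s \<le> T" by auto
    define ds where "ds = dist (g s) (h s)"
    have dg: "dist x (g s) = a * s" "dist x (h s) = b * s" using geo_germ_dist0[OF gg, of s] geo_germ_dist0[OF hh, of s] s by auto
    have ms: "a * s \<le> m * s" "b * s \<le> m * s" "m * s < r" using germ_scale_less[OF m] s by auto
    have nn: "0 \<le> a * s" "0 \<le> b * s" "0 \<le> m * s" using ab m s by auto
    have ds: "ds \<le> 2 * (m * s)" unfolding ds_def using dist_triangle3[of "g s" "h s" x] dg ms by linarith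
    obtain k where "geodesic_from_to k (g s) (h s)" by (rule ex_geodesic)
    then have k: "cs_geodesic_on 1 k" "k 0 = g s" "k 1 = h s" by (auto simp: geodesic_from_to_def)
    define dm where "dm = dist x (k th)"
    have in_ball: "x \<in> ball x r" "k 0 \<in> ball x r" "k 1 \<in> ball x r"
      using r_pos ms unfolding k mem_ball dg dist_self by linarith+
    have le: "dist x (k 0) \<le> 2 * (m * s)" "dist x (k 1) \<le> 2 * (m * s)" "dist (k 0) (k 1) \<le> 2 * (m * s)"
      using ms nn ds unfolding ds_def k dg by linarith+
    have "dm^2 \<le> (1-th) * (a * s)^2 + th * (b * s)^2 - th * (1-th) * ds^2 + K * (2 * (m * s))^4"
      using comparison[OF in_ball(1) k(1) in_ball(2,3) th le] by (simp add: dm_def ds_def k dg)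
    also have "\<dots> = s^2 * P s" using s
      by (simp add: P_def ds_def power2_eq_square power4_eq_xxxx field_simps)
    finally have dm: "dm^2 \<le> s^2 * P s" .
    have up: "E (k th) \<le> ereal ((1-th) * (ex - s * A) + th * (ex - s * B) - lam/2 * th * (1-th) * ds^2)"
      using convex_le[OF k(1) _ _ th, of "ex - s * A" "ex - s * B"] elim k by (simp add: ds_def)
    have "ereal (ex - S * dm + lam/2 * dm^2) \<le> E (k th)"
      using slope_global_bound[OF Ex S] by (simp add: dm_def)
    with up have "ereal (ex - S * dm + lam/2 * dm^2) \<le> ereal ((1-th) * (ex - s * A) + th * (ex - s * B) - lam/2 * th * (1-th) * ds^2)"
      by (rule order_trans[rotated])
    then have "s * ((1-th) * A + th * B) \<le> S * dm - lam/2 * dm^2 - lam/2 * (th * (1-th)) * ds^2"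
      by (simp add: algebra_simps)
    moreover have "- lam/2 * dm^2 \<le> abs lam/2 * dm^2" by (intro mult_right_mono) auto
    moreover have "- lam/2 * (th * (1-th)) * ds^2 \<le> abs lam/2 * 1 * ds^2"
    proof -
      have "th * (1-th) \<le> 1" using th mult_le_one[of th "1-th"] by auto
      moreover have "0 \<le> th * (1-th)" using th by auto
      ultimately have "\<bar>- lam/2 * (th * (1-th))\<bar> \<le> abs lam/2 * 1" by (simp add: abs_mult mult_left_le)
      then show ?thesis by (intro mult_right_mono) auto
    qed
    ultimately have "s * ((1-th) * A + th * B) \<le> S * dm + abs lam/2 * ds^2 + abs lam/2 * dm^2" by linarith
    then have 1: "s * ((1-th) * A + th * B) \<le> S * dm + abs lam/2 * (ds^2 + dm^2)" by (simp add: distrib_left)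
    \<comment> \<open>Young's inequality replaces \<open>S * dm\<close> by squares, for which
      comparison gives a bound. It loses nothing in the limit when \<open>dm\<close> is about
      \<open>S * s\<close>, the case of steepest descent.\<close>
    have "0 \<le> (S * s - dm)^2" by simp
    then have 2: "2 * s * (S * dm) \<le> s^2 * S^2 + dm^2" by (simp add: power2_eq_square algebra_simps)
    have 3: "abs lam/2 * (ds^2 + dm^2) \<le> abs lam/2 * (ds^2 + s^2 * P s)" using dm by (intro mult_left_mono) auto
    have "2 * s * (s * ((1-th) * A + th * B)) \<le> 2 * s * (S * dm + abs lam/2 * (ds^2 + s^2 * P s))"
      using 1 3 s by (intro mult_left_mono) auto
    also have "\<dots> \<le> s^2 * S^2 + s^2 * P s + 2 * s * (abs lam/2 * (ds^2 + s^2 * P s))"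
      using 2 dm by (simp add: algebra_simps)
    also have "\<dots> = 2 * s * (s * (S^2 / 2 + P s / 2 + abs lam/2 * s * ((ds / s)^2 + P s)))"
      using s by (simp add: power2_eq_square field_simps)
    finally show ?case using s by (simp add: ds_def)
  qed
  moreover have "((\<lambda>s. S^2 / 2 + P s / 2 + abs lam/2 * s * ((dist (g s) (h s) / s)^2 + P s))
    \<longlongrightarrow> S^2 / 2 + ((1-th) * a^2 + th * b^2 - th * (1-th) * (geod_dist g h)^2 + 16 * K * m^4 * 0^2) / 2
       + abs lam/2 * 0 * ((geod_dist g h)^2 + ((1-th) * a^2 + th * b^2 - th * (1-th) * (geod_dist g h)^2 + 16 * K * m^4 * 0^2))) (at_right 0)"
    unfolding P_def by (intro tendsto_intros geod_dist_tendsto g h) auto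
  ultimately have "(1-th) * A + th * B \<le> S^2 / 2 + ((1-th) * a^2 + th * b^2 - th * (1-th) * (geod_dist g h)^2 + 16 * K * m^4 * 0^2) / 2
       + abs lam/2 * 0 * ((geod_dist g h)^2 + ((1-th) * a^2 + th * b^2 - th * (1-th) * (geod_dist g h)^2 + 16 * K * m^4 * 0^2))"
    by (intro tendsto_lowerbound[OF _ _ trivial_limit_at_right_real])
  then show ?thesis unfolding geod_dist_const[OF gg] geod_dist_const[OF hh] by (simp add: field_simps)
qed

text \<open>Parametrised with speed \<open>S\<close>, a nearly steepest geodesic loses energy at a
  rate close to \<open>S^2\<close>; this is the length of the minimal element to be
  constructed.\<close>

lemma ex_steep_geodesic:
  assumes S: "slope E x = ereal S" and e: "0 < e"
  shows "\<exists>g T. geo_germ x g S T \<and> (\<forall>s\<in>{0..T}. E (g s) \<le> ereal (ex - s * (S * (S - e))))"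
proof (cases "S = 0")
  case True
  then show ?thesis using geo_germ_const[of x] Ex by (intro exI[of _ "\<lambda>_. x"] exI[of _ 1]) auto
next
  case False
  then have S0: "0 < S" using slope_nonneg[of x] S by simp
  \<comment> \<open>Half of \<open>e\<close> pays for the slope being only almost attained at
    \<open>z\<close>, the other half for the \<open>lam\<close> term of convexity, which is small
    because \<open>z\<close> is within \<open>\<delta>\<close> of \<open>x\<close>.\<close>
  define \<delta> where "\<delta> = e / (abs lam + 1)"
  have \<delta>: "0 < \<delta>" using e by (simp add: \<delta>_def)
  have "0 < e/2" using e by simp
  then obtain z b where z: "z \<noteq> x" "dist x z < \<delta>" "E z = ereal b" "b \<le> ex - (S - e/2) * dist x z"
    using slope_attained[OF Ex S S0 _ \<delta>] by metis
  define d where "d = dist x z"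
  have d: "0 < d" "abs lam * d \<le> e"
  proof -
    show "0 < d" using z by (simp add: d_def)
    have "abs lam * d \<le> abs lam * \<delta>" using z by (intro mult_left_mono) (auto simp: d_def)
    also have "\<dots> \<le> e" using e by (simp add: \<delta>_def field_simps)
    finally show "abs lam * d \<le> e" .
  qed
  obtain g where g: "geodesic_from_to g x z" by (rule ex_geodesic)
  then have g': "cs_geodesic_on 1 g" "g 0 = x" "g 1 = z" by (auto simp: geodesic_from_to_def)
  have germ: "geo_germ x (\<lambda>t. g (S/d * t)) (S/d * d) (1 / (S/d))"
    using geo_germ_geodesic_from_to[OF g] d S0 by (intro geo_germ_scale) (auto simp: d_def)
  moreover have "E (g (S/d * s)) \<le> ereal (ex - s * (S * (S - e)))" if s: "s \<in> {0..1/(S/d)}" for s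
  proof -
    define t where "t = S/d * s"
    have t: "t \<in> {0..1}" using s d S0 by (auto simp: t_def field_simps)
    have "E (g t) \<le> ereal ((1-t) * ex + t * b - lam/2 * t * (1-t) * (dist (g 0) (g 1))^2)"
      using g' Ex z t by (intro convex_le) auto
    also have "\<dots> \<le> ereal (ex - s * (S * (S - e)))"
    proof -
      have "t * b \<le> t * (ex - (S - e/2) * d)" using z t by (intro mult_left_mono) (auto simp: d_def)
      moreover have "- (lam/2 * t * (1-t) * d^2) \<le> t * d * (e/2)"
      proof -
        have "- (lam/2 * t * (1-t) * d^2) = (t * d) * ((- lam/2) * ((1-t) * d))" by (simp add: power2_eq_square)
        also have "\<dots> \<le> (t * d) * (abs lam/2 * (1 * d))" using t d by (intro mult_left_mono mult_mono) auto
        also have "\<dots> \<le> (t * d) * (e/2)" using t d by (intro mult_left_mono) auto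
        finally show ?thesis .
      qed
      moreover have td: "t * d = S * s" using d by (simp add: t_def)
      moreover have "t * (ex - (S - e/2) * d) = t * ex - (S - e/2) * (S * s)" by (simp add: algebra_simps flip: td)
      moreover have "t * d * (e/2) = S * s * (e/2)" by (simp only: td)
      moreover have "(S - e/2) * (S * s) - S * s * (e/2) = s * (S * (S - e))" by (simp add: algebra_simps)
      ultimately have "(1-t) * ex + t * b - lam/2 * t * (1-t) * d^2 \<le> ex - s * (S * (S - e))"
        unfolding left_diff_distrib[of 1] by linarith
      then show ?thesis using g' by (simp add: d_def)
    qed
    finally show ?thesis by (simp add: t_def)
  qed
  ultimately show ?thesis using d by (intro exI[of _ "\<lambda>t. g (S/d * t)"] exI[of _ "1/(S/d)"]) auto
qed

text \<open>Cauchy-Schwarz turns the defining inequality into a lower bound for \<open>E\<close>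
  that is linear in the distance up to a quadratic term, and such a bound controls the
  slope.\<close>

lemma msubdiff_slope_le:
  assumes v: "v \<in> msubdiff lam E x"
  shows "slope E x \<le> ereal (tnorm x v)"
proof (rule slope_le_of_quadratic_bound[OF Ex, of _ "abs lam/2"])
  have vT: "v \<in> tcone x" using v by (simp add: msubdiff_def)
  show "0 \<le> tnorm x v" by (rule tnorm_nonneg[OF vT])
  fix z
  obtain g where g: "geodesic_from_to g x z" "E x - ereal (tinner x v (tvec g)) + ereal (lam / 2 * (dist x z)^2) \<le> E z"
    using v unfolding msubdiff_def by blast
  note gg = geo_germ_geodesic_from_to[OF g(1)]
  have "tinner x v (tvec g) \<le> tnorm x v * dist x z"
    using tinner_le[OF vT tvec_tcone[OF geo_germ_geods_from[OF gg]]] tnorm_tvec[OF gg] by simp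
  moreover have "- (abs lam/2 * (dist x z)^2) \<le> lam / 2 * (dist x z)^2"
    using mult_right_mono[of "-abs lam/2" "lam/2" "(dist x z)^2"] by auto
  ultimately have "ereal (ex - tnorm x v * dist x z - abs lam/2 * (dist x z)^2) \<le> E x - ereal (tinner x v (tvec g)) + ereal (lam / 2 * (dist x z)^2)"
    unfolding Ex by simp
  then show "ereal (ex - tnorm x v * dist x z - abs lam/2 * (dist x z)^2) \<le> E z" using g(2) by (rule order_trans)
qed auto

text \<open>The element is the sequence of nearly steepest geodesics itself: being Cauchy, it
  already belongs to \<open>tcone x\<close>.\<close>

lemma ex_msubdiff_slope:
  assumes S: "slope E x = ereal S"
  obtains v where "v \<in> msubdiff lam E x" "tnorm x v = S"
proof -
  have S0: "0 \<le> S" using slope_nonneg[of x] S by simp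
  define eps where "eps n = inverse (real (Suc n))" for n
  have eps: "0 < eps n" for n by (simp add: eps_def)
  have eps0: "eps \<longlonglongrightarrow> 0" unfolding eps_def by (rule LIMSEQ_inverse_real_of_nat)
  have "\<exists>g T. geo_germ x g S T \<and> (\<forall>s\<in>{0..T}. E (g s) \<le> ereal (ex - s * (S * (S - eps n))))" for n
    by (rule ex_steep_geodesic[OF S eps])
  then obtain \<sigma> T where \<sigma>: "\<And>n. geo_germ x (\<sigma> n) S (T n)"
    and E\<sigma>: "\<And>n s. s \<in> {0..T n} \<Longrightarrow> E (\<sigma> n s) \<le> ereal (ex - s * (S * (S - eps n)))" by metis
  have ev\<sigma>: "\<forall>\<^sub>F s in at_right 0. E (\<sigma> n s) \<le> ereal (ex - s * (S * (S - eps n)))" for n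
  proof -
    have "0 < T n" using \<sigma>[of n] by (simp add: geo_germ_def)
    then have "\<forall>\<^sub>F s in at_right 0. s \<in> {0<..<T n}" by (rule eventually_at_right_real)
    then show ?thesis by eventually_elim (use E\<sigma> in auto)
  qed
  have gf: "\<sigma> n \<in> geods_from x" for n using \<sigma> by (rule geo_germ_geods_from)
  have sp: "geod_dist (\<sigma> n) (\<lambda>_. x) = S" for n using \<sigma> by (rule geod_dist_const)
  \<comment> \<open>Interpolation at the midpoint: both rates are close to \<open>S^2\<close> and
    both norms equal \<open>S\<close>, so only the distance term can absorb the difference.\<close>
  have D: "(geod_dist (\<sigma> m) (\<sigma> n))^2 \<le> 4 * S * (eps m + eps n)" for m n
    using steep_pair_bound[OF S gf gf ev\<sigma>[of m] ev\<sigma>[of n], of "1/2"] by (simp add: sp power2_eq_square field_simps)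
  have cone: "\<sigma> \<in> tcone x"
    unfolding tcone_def
  proof (intro CollectI conjI allI impI gf)
    fix e :: real assume e: "0 < e"
    define \<eta> where "\<eta> = e^2 / (8 * (S + 1))"
    have "0 < \<eta>" using e S0 by (simp add: \<eta>_def)
    then have "\<forall>\<^sub>F n in sequentially. eps n < \<eta>" using eps0 by (auto dest: order_tendstoD)
    then obtain N where N: "\<And>n. n \<ge> N \<Longrightarrow> eps n < \<eta>" by (auto simp: eventually_sequentially)
    show "\<exists>N. \<forall>m\<ge>N. \<forall>n\<ge>N. geod_dist (\<sigma> m) (\<sigma> n) < e"
    proof (intro exI[of _ N] allI impI)
      fix m n assume mn: "N \<le> m" "N \<le> n"
      have "4 * S * (eps m + eps n) \<le> 4 * S * (2 * \<eta>)" using N[OF mn(1)] N[OF mn(2)] S0 by (intro mult_left_mono) auto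
      also have "\<dots> < e^2" using e S0 by (simp add: \<eta>_def field_simps)
      finally have "(geod_dist (\<sigma> m) (\<sigma> n))^2 < e^2" using D[of m n] by linarith
      then show "geod_dist (\<sigma> m) (\<sigma> n) < e" using e by (simp add: power2_less_imp_less)
    qed
  qed
  have norm: "tnorm x \<sigma> = S" using LIMSEQ_unique[OF tnorm_tendsto[OF cone]] sp by simp
  have "\<exists>g. geodesic_from_to g x z \<and> E x - ereal (tinner x \<sigma> (tvec g)) + ereal (lam / 2 * (dist x z)^2) \<le> E z" for z
  proof -
    obtain g where g: "geodesic_from_to g x z" by (rule ex_geodesic)
    then have g': "cs_geodesic_on 1 g" "g 0 = x" "g 1 = z" by (auto simp: geodesic_from_to_def)
    note gg = geo_germ_geodesic_from_to[OF g]
    note ggf = geo_germ_geods_from[OF gg]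
    define d where "d = dist x z"
    show ?thesis
    proof (cases "E z = \<infinity>")
      case True
      then show ?thesis using g by auto
    next
      case False
      then have "E z < \<infinity>" by auto
      then obtain b where b: "E z = ereal b" by (rule finiteE)
      define D where "D = tdist \<sigma> (tvec g)"
      have Dlim: "(\<lambda>n. geod_dist (\<sigma> n) g) \<longlonglongrightarrow> D"
        using tdist_tendsto[OF cone tvec_tcone[OF ggf]] by (simp add: D_def tvec_def)
      define B where "B = ex - b + lam/2 * d^2"
      \<comment> \<open>A first-order optimality argument. After \<open>n\<close> tends to infinity
        the interpolated inequality holds with equality at \<open>th = 0\<close>; dividing by
        \<open>th\<close> gives the stated bound, whose limit as \<open>th\<close> tends to 0 is the
        scalar product.\<close>
      have 1: "B - e \<le> (S^2 + d^2 - (1-th) * D^2) / 2" if e: "0 < e" and th: "0 < th" "th \<le> 1" for e th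
      proof -
        have "((\<lambda>s. abs lam/2 * s * d^2) \<longlongrightarrow> abs lam/2 * 0 * d^2) (at_right 0)" by (intro tendsto_intros)
        then have "\<forall>\<^sub>F s in at_right 0. abs lam/2 * s * d^2 < e" using e by (auto dest: order_tendstoD)
        moreover have "\<forall>\<^sub>F s in at_right (0::real). s \<in> {0<..<1}" by (rule eventually_at_right_real) simp
        ultimately have Eg: "\<forall>\<^sub>F s in at_right 0. E (g s) \<le> ereal (ex - s * (B - e))"
        proof eventually_elim
          case (elim s)
          have "E (g s) \<le> ereal ((1-s) * ex + s * b - lam/2 * s * (1-s) * (dist (g 0) (g 1))^2)"
            using g' Ex b elim by (intro convex_le) auto
          also have "(1-s) * ex + s * b - lam/2 * s * (1-s) * (dist (g 0) (g 1))^2 = ex - s * (B - lam/2 * s * d^2)"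
            using g' by (simp add: B_def d_def field_simps)
          also have "\<dots> \<le> ex - s * (B - e)"
          proof -
            have "lam/2 * s * d^2 \<le> abs lam/2 * s * d^2" using elim by (intro mult_right_mono) auto
            then have "lam/2 * s * d^2 \<le> e" using elim by linarith
            then show ?thesis using elim by (intro diff_left_mono mult_left_mono) auto
          qed
          finally show ?case by simp
        qed
        have "(1-th) * (S * (S - eps n)) + th * (B - e) \<le> (S^2 + (1-th) * S^2 + th * d^2 - th * (1-th) * (geod_dist (\<sigma> n) g)^2) / 2" for n
          using steep_pair_bound[OF S gf ggf ev\<sigma>[of n] Eg, of th] th geod_dist_const[OF gg] by (simp add: sp d_def)
        moreover have "(\<lambda>n. (1-th) * (S * (S - eps n)) + th * (B - e)) \<longlonglongrightarrow> (1-th) * (S * (S - 0)) + th * (B - e)"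
          by (intro tendsto_intros eps0)
        moreover have "(\<lambda>n. (S^2 + (1-th) * S^2 + th * d^2 - th * (1-th) * (geod_dist (\<sigma> n) g)^2) / 2)
            \<longlonglongrightarrow> (S^2 + (1-th) * S^2 + th * d^2 - th * (1-th) * D^2) / 2"
          by (intro tendsto_intros Dlim) auto
        ultimately have "(1-th) * (S * (S - 0)) + th * (B - e) \<le> (S^2 + (1-th) * S^2 + th * d^2 - th * (1-th) * D^2) / 2"
          by (intro LIMSEQ_le) auto
        then have "th * (B - e) \<le> th * ((S^2 + d^2 - (1-th) * D^2) / 2)" by (simp add: power2_eq_square field_simps)
        then show ?thesis using th by simp
      qed
      have "B \<le> (S^2 + d^2 - D^2) / 2"
      proof (rule field_le_epsilon)
        fix e :: real assume e: "0 < e"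
        have lim: "((\<lambda>th. (S^2 + d^2 - (1-th) * D^2) / 2) \<longlongrightarrow> (S^2 + d^2 - (1-0) * D^2) / 2) (at_right 0)"
          by (intro tendsto_intros) auto
        have "\<forall>\<^sub>F th in at_right (0::real). th \<in> {0<..<1}" by (rule eventually_at_right_real) simp
        then have "\<forall>\<^sub>F th in at_right 0. B - e \<le> (S^2 + d^2 - (1-th) * D^2) / 2"
          by eventually_elim (use 1[OF e] in auto)
        then have "B - e \<le> (S^2 + d^2 - (1-0) * D^2) / 2"
          by (intro tendsto_lowerbound[OF lim _ trivial_limit_at_right_real])
        then show "B \<le> (S^2 + d^2 - D^2) / 2 + e" by (simp add: field_simps)
      qed
      also have "\<dots> = tinner x \<sigma> (tvec g)" using norm tnorm_tvec[OF gg] by (simp add: tinner_def D_def d_def)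
      finally have "E x - ereal (tinner x \<sigma> (tvec g)) + ereal (lam / 2 * (dist x z)^2) \<le> E z"
        unfolding Ex b by (simp add: B_def d_def)
      then show ?thesis using g by blast
    qed
  qed
  then have "\<sigma> \<in> msubdiff lam E x" using cone Ex by (simp add: msubdiff_def)
  then show thesis using norm by (rule that)
qed

lemma geodesic_Geo:
  assumes z: "z \<in> ball x r" shows "geodesic_from_to (Geo x z) x z"
proof -
  obtain g where g: "geodesic_from_to g x z" by (rule ex_geodesic)
  \<comment> \<open>\<open>Geo\<close> is a definite description and prescribes the value
    \<open>y\<close> outside \<open>[0,1]\<close>; without this normalisation no function would be
    unique.\<close>
  define g' where "g' t = (if t \<in> {0..1} then g t else x)" for t
  have g': "geodesic_from_to g' x z"
    using g by (auto simp: geodesic_from_to_def cs_geodesic_on_def g'_def)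
  have "\<exists>!g. geodesic_from_to g x z \<and> (\<forall>t. t \<notin> {0..1} \<longrightarrow> g t = x)"
  proof (rule ex1I[of _ g'])
    show "geodesic_from_to g' x z \<and> (\<forall>t. t \<notin> {0..1} \<longrightarrow> g' t = x)" using g' by (auto simp: g'_def)
    fix h assume h: "geodesic_from_to h x z \<and> (\<forall>t. t \<notin> {0..1} \<longrightarrow> h t = x)"
    show "h = g'"
    proof
      fix t show "h t = g' t"
        using h geodesic_unique[OF z _ g', of h t] by (cases "t \<in> {0..1}") (auto simp: g'_def)
    qed
  qed
  from theI'[OF this] show ?thesis by (simp add: Geo_def)
qed

text \<open>In \<open>|w|^2 + S^2 - 2*<v,w>\<close> the speed bounds \<open>|w|\<close> by about
  \<open>S\<close>. The subdifferential inequality at \<open>u h\<close>, combined with the energy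
  drop, bounds \<open><v,w>\<close> below by about \<open>S^2\<close>. The only fact used about
  \<open>u\<close> is this pair of one-sided estimates.\<close>

lemma difference_quotient_tendsto:
  fixes u :: "real \<Rightarrow> 'a"
  assumes v: "v \<in> msubdiff lam E x" and S: "tnorm x v = S"
    and speed: "\<And>e. 0 < e \<Longrightarrow> \<forall>\<^sub>F h in at_right 0. dist x (u h) \<le> (S + e) * h"
    and energy: "\<And>e. 0 < e \<Longrightarrow> \<forall>\<^sub>F h in at_right 0. E (u h) \<le> ereal (ex - (S^2 - e) * h)"
  shows "((\<lambda>h. tdist (tscale (1 / h) (tvec (Geo x (u h)))) v) \<longlongrightarrow> 0) (at_right 0)"
proof -
  have vT: "v \<in> tcone x" using v by (simp add: msubdiff_def)
  have S0: "0 \<le> S" using tnorm_nonneg[OF vT] S by simp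
  have pos: "\<forall>\<^sub>F h in at_right (0::real). 0 < h" by (simp add: eventually_at_filter)
  have "((\<lambda>h. (S + 1) * h) \<longlongrightarrow> (S + 1) * 0) (at_right 0)" by (intro tendsto_intros)
  then have small: "\<forall>\<^sub>F h in at_right 0. (S + 1) * h < r" using r_pos by (auto dest: order_tendstoD)
  have key: "0 \<le> tdist (tscale (1/h) (tvec (Geo x (u h)))) v \<and>
      (tdist (tscale (1/h) (tvec (Geo x (u h)))) v)^2 \<le> S^2 + (S + e)^2 - 2 * (S^2 - e) + abs lam * (S + e)^2 * h"
    if h: "0 < h" "dist x (u h) \<le> (S + e) * h" "dist x (u h) < r" "E (u h) \<le> ereal (ex - (S^2 - e) * h)" and e: "0 < e" for h e
  proof -
    define G where "G = Geo x (u h)"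
    define \<rho> where "\<rho> = dist x (u h)"
    have uh: "u h \<in> ball x r" using h by simp
    have G: "geodesic_from_to G x (u h)" unfolding G_def by (rule geodesic_Geo[OF uh])
    note germ = geo_germ_geodesic_from_to[OF G]
    note Gf = geo_germ_geods_from[OF germ]
    have h': "0 < 1/h" using h by simp
    define w where "w = tscale (1/h) (tvec G)"
    have w_eq: "w = tvec (\<lambda>t. G (1/h * t))" by (simp add: w_def tscale_tvec)
    have wT: "w \<in> tcone x" unfolding w_eq by (intro tvec_tcone geods_from_scale Gf h')
    have wn: "tnorm x w = \<rho> / h" unfolding w_eq using tnorm_tvec[OF geo_germ_scale[OF germ h']] by (simp add: \<rho>_def)
    obtain g where g: "geodesic_from_to g x (u h)"
      "E x - ereal (tinner x v (tvec g)) + ereal (lam / 2 * (dist x (u h))^2) \<le> E (u h)"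
      using v unfolding msubdiff_def by blast
    \<comment> \<open>The subdifferential inequality holds for some geodesic to \<open>u h\<close>;
      local uniqueness identifies it with \<open>Geo x (u h)\<close> on
      \<open>[0,1]\<close>.\<close>
    have "tinner x v (tvec g) = tinner x v (tvec G)"
      by (rule tinner_cong[of 1]) (use geodesic_unique[OF uh g(1) G] in auto)
    with g(2) have "E x - ereal (tinner x v (tvec G)) + ereal (lam / 2 * \<rho>^2) \<le> E (u h)" by (simp add: \<rho>_def)
    also have "\<dots> \<le> ereal (ex - (S^2 - e) * h)" by (rule h(4))
    finally have in1: "(S^2 - e) * h + lam / 2 * \<rho>^2 \<le> tinner x v (tvec G)" unfolding Ex by simp
    have "h * tinner x v w = tinner x v (tvec G)"
      using tinner_tscale[OF vT Gf h'] h by (simp add: w_def)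
    moreover have "tinner x v w = (S^2 + (\<rho> / h)^2 - (tdist v w)^2) / 2" by (simp add: tinner_def S wn)
    ultimately have "(S^2 - e) * h + lam / 2 * \<rho>^2 \<le> h * ((S^2 + (\<rho> / h)^2 - (tdist v w)^2) / 2)" using in1 by simp
    moreover have \<rho>: "\<rho> \<le> (S + e) * h" "0 \<le> \<rho>" using h by (auto simp: \<rho>_def)
    then have \<rho>2: "\<rho>^2 \<le> ((S + e) * h)^2" by (intro power_mono) auto
    moreover have "- (abs lam / 2 * ((S + e) * h)^2) \<le> lam / 2 * \<rho>^2"
    proof -
      have "- (lam / 2 * \<rho>^2) \<le> abs lam / 2 * \<rho>^2" using mult_right_mono[of "-lam/2" "abs lam/2" "\<rho>^2"] by auto
      also have "\<dots> \<le> abs lam / 2 * ((S + e) * h)^2" using \<rho>2 by (intro mult_left_mono) auto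
      finally show ?thesis by simp
    qed
    moreover have "h * ((abs lam * (S + e)^2 * h) / 2) = abs lam / 2 * ((S + e) * h)^2" by (simp add: power2_eq_square)
    ultimately have "h * (S^2 - e) - h * ((abs lam * (S + e)^2 * h) / 2) \<le> h * ((S^2 + (\<rho> / h)^2 - (tdist v w)^2) / 2)"
      unfolding mult.commute[of h "S^2 - e"] by linarith
    then have "h * ((S^2 - e) - (abs lam * (S + e)^2 * h) / 2) \<le> h * ((S^2 + (\<rho> / h)^2 - (tdist v w)^2) / 2)"
      by (simp only: right_diff_distrib)
    then have "(S^2 - e) - (abs lam * (S + e)^2 * h) / 2 \<le> (S^2 + (\<rho> / h)^2 - (tdist v w)^2) / 2" using h by simp
    moreover have "(\<rho> / h)^2 \<le> (S + e)^2" using \<rho> h by (intro power_mono) (auto simp: pos_divide_le_eq)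
    moreover have sym: "tdist v w = tdist w v" by (simp add: tdist_def geod_dist_sym)
    moreover have arith: "T \<le> A + B - 2 * (A - e) + C" if "A - e - C/2 \<le> (A + R - T) / 2" "R \<le> B" for A B C R T :: real
      using that by argo
    ultimately have "(tdist w v)^2 \<le> S^2 + (S + e)^2 - 2 * (S^2 - e) + abs lam * (S + e)^2 * h"
      unfolding sym by (intro arith)
    then show ?thesis using tdist_nonneg[OF wT vT] by (simp add: w_def G_def)
  qed
  show ?thesis
  proof (rule tendstoI)
    fix \<eta> :: real assume \<eta>: "0 < \<eta>"
    \<comment> \<open>Since \<open>e \<le> 1\<close>, the part of the bound without \<open>h\<close>
      is at most \<open>(2*S + 3) * e\<close>, which is made at most half of
      \<open>\<eta>^2\<close>.\<close>
    define e where "e = min 1 (\<eta>^2 / (2 * (2 * S + 3)))"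
    have e: "0 < e" "e \<le> 1" using \<eta> S0 by (auto simp: e_def)
    have "(2 * S + 3) * e \<le> (2 * S + 3) * (\<eta>^2 / (2 * (2 * S + 3)))" using S0 by (intro mult_left_mono) (auto simp: e_def)
    also have "\<dots> = \<eta>^2 / 2" using S0 by (simp add: field_simps)
    finally have e1: "(2 * S + 3) * e \<le> \<eta>^2 / 2" .
    have ee: "e^2 \<le> e" using e by (simp add: power2_eq_square mult_left_le)
    have "S^2 + (S + e)^2 - 2 * (S^2 - e) = 2 * S * e + e^2 + 2 * e" by (simp add: power2_eq_square algebra_simps)
    also have "\<dots> \<le> (2 * S + 3) * e" using ee by (simp add: algebra_simps)
    finally have e2: "S^2 + (S + e)^2 - 2 * (S^2 - e) \<le> \<eta>^2 / 2" using e1 by linarith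
    have "((\<lambda>h. abs lam * (S + e)^2 * h) \<longlongrightarrow> abs lam * (S + e)^2 * 0) (at_right 0)" by (intro tendsto_intros)
    moreover have "abs lam * (S + e)^2 * 0 < \<eta>^2 / 2" using \<eta> by simp
    ultimately have "\<forall>\<^sub>F h in at_right 0. abs lam * (S + e)^2 * h < \<eta>^2 / 2" by (rule order_tendstoD)
    with speed[OF e(1)] energy[OF e(1)] pos small
    show "\<forall>\<^sub>F h in at_right 0. dist (tdist (tscale (1 / h) (tvec (Geo x (u h)))) v) 0 < \<eta>"
    proof eventually_elim
      case (elim h)
      have "(S + e) * h \<le> (S + 1) * h" using e elim by (intro mult_right_mono) auto
      then have "dist x (u h) < r" using elim by linarith
      from key[OF elim(3,1) this elim(2) e(1)] e2 elim(5)
      have t: "0 \<le> tdist (tscale (1/h) (tvec (Geo x (u h)))) v" "(tdist (tscale (1/h) (tvec (Geo x (u h)))) v)^2 < \<eta>^2"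
        by auto
      then have "tdist (tscale (1/h) (tvec (Geo x (u h)))) v < \<eta>" using \<eta> by (simp add: power2_less_imp_less)
      then show ?case using t by simp
    qed
  qed
qed

end

section \<open>Ekeland's variational principle and density\<close>

text \<open>\<open>E\<close> need not be bounded below on the whole space, so the principle is run
  in a closed ball on which lower semicontinuity gives \<open>E > ez - 1\<close>.\<close>

lemma ex_finite_slope_near:
  fixes E :: "'a::complete_space \<Rightarrow> ereal"
  assumes conv: "lambda_convex_function lam E" and lsc: "lsc E" and z: "E z < \<infinity>" and \<delta>: "0 < \<delta>"
  shows "\<exists>w. dist z w < \<delta> \<and> E w < \<infinity> \<and> slope E w < \<infinity>"
proof -
  interpret lambda_convex_function lam E by (rule conv)
  obtain ez where ez: "E z = ereal ez" using z by (rule finiteE)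
  have "open (- {x. E x \<le> ereal (ez - 1)})" using lsc unfolding lsc_def by (simp add: open_Compl)
  moreover have "z \<in> - {x. E x \<le> ereal (ez - 1)}" using ez by simp
  ultimately obtain \<rho>' where \<rho>': "0 < \<rho>'" "ball z \<rho>' \<subseteq> - {x. E x \<le> ereal (ez - 1)}" by (meson openE)
  define \<rho> where "\<rho> = min (\<rho>'/2) \<delta>"
  have \<rho>: "0 < \<rho>" "\<rho> \<le> \<delta>" "\<rho> < \<rho>'" using \<rho>' \<delta> by (auto simp: \<rho>_def)
  \<comment> \<open>An energy loss of at most 1 then allows a displacement of at most
    \<open>\<rho>/2\<close>, so the Ekeland point has a whole ball around it inside the closed ball
    and its minimality controls the slope.\<close>
  define eps where "eps = 2 / \<rho>"
  have eps: "0 < eps" using \<rho> by (simp add: eps_def)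
  define e where "e w = real_of_ereal (E w)" for w
  define D where "D = {w \<in> cball z \<rho>. E w < \<infinity>}"
  have eE: "E w = ereal (e w)" if "w \<in> D" for w
  proof -
    have "E w < \<infinity>" using that by (simp add: D_def)
    then obtain b where "E w = ereal b" by (rule finiteE)
    then show ?thesis by (simp add: e_def)
  qed
  have low: "ez - 1 \<le> e w" if w: "w \<in> D" for w
  proof -
    have "w \<in> ball z \<rho>'" using w \<rho> by (auto simp: D_def)
    then have "\<not> E w \<le> ereal (ez - 1)" using \<rho>' by blast
    then show ?thesis using eE[OF w] by simp
  qed
  \<comment> \<open>The set of points below \<open>u\<close> in Ekeland's order; a point that is
    alone in its own set is what is sought.\<close>
  define A where "A u = {w \<in> D. e w + eps * dist u w \<le> e u}" for u
  have A_refl: "u \<in> A u" if "u \<in> D" for u using that by (simp add: A_def)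
  have A_trans: "w' \<in> A u" if "w \<in> A u" "w' \<in> A w" for u w w'
  proof -
    have "eps * dist u w' \<le> eps * (dist u w + dist w w')" using eps by (intro mult_left_mono dist_triangle) auto
    then show ?thesis using that by (auto simp: A_def algebra_simps)
  qed
  have step: "\<exists>w\<in>A u. \<forall>w'\<in>A u. e w \<le> e w' + (1/2)^n" if u: "u \<in> D" for u n
  proof -
    have bdd: "bdd_below (e ` A u)" using low by (intro bdd_belowI[of _ "ez - 1"]) (auto simp: A_def)
    have ne: "e ` A u \<noteq> {}" using A_refl[OF u] by auto
    have "Inf (e ` A u) < Inf (e ` A u) + (1/2)^n" by simp
    then obtain w where w: "w \<in> A u" "e w < Inf (e ` A u) + (1/2)^n"
      unfolding cInf_less_iff[OF ne bdd] by blast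
    have "e w \<le> e w' + (1/2)^n" if "w' \<in> A u" for w'
      using cInf_lower[OF imageI[OF that] bdd] w(2) by linarith
    then show ?thesis using w(1) by blast
  qed
  have zD: "z \<in> D" using z \<rho> by (simp add: D_def)
  have "\<exists>f. \<forall>n. f n \<in> D \<and> (f (Suc n) \<in> A (f n) \<and> (\<forall>w'\<in>A (f n). e (f (Suc n)) \<le> e w' + (1/2)^n)) \<and> f 0 = z"
  proof -
    have "\<exists>f. \<forall>n. (f n \<in> D \<and> (n = 0 \<longrightarrow> f n = z)) \<and> (f (Suc n) \<in> A (f n) \<and> (\<forall>w'\<in>A (f n). e (f (Suc n)) \<le> e w' + (1/2)^n))"
    proof (rule dependent_nat_choice)
      show "\<exists>w. w \<in> D \<and> (0 = (0::nat) \<longrightarrow> w = z)" using zD by blast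
      fix u n assume "u \<in> D \<and> (n = (0::nat) \<longrightarrow> u = z)"
      then show "\<exists>w. (w \<in> D \<and> (Suc n = 0 \<longrightarrow> w = z)) \<and> w \<in> A u \<and> (\<forall>w'\<in>A u. e w \<le> e w' + (1/2)^n)"
        using step[of u n] by (auto simp: A_def)
    qed
    then show ?thesis by metis
  qed
  then obtain f where fD: "\<And>n. f n \<in> D" and fA: "\<And>n. f (Suc n) \<in> A (f n)"
    and fmin: "\<And>n w'. w' \<in> A (f n) \<Longrightarrow> e (f (Suc n)) \<le> e w' + (1/2)^n" and f0: "f 0 = z" by metis
  have fA': "f (n + k) \<in> A (f n)" for n k
    by (induction k) (auto intro: A_refl fD A_trans fA)
  have close: "eps * dist (f (Suc n)) w \<le> (1/2)^n" if w: "w \<in> A (f (Suc n))" for n w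
  proof -
    have "w \<in> A (f n)" using A_trans[OF fA w] .
    then show ?thesis using fmin[of w n] w by (auto simp: A_def)
  qed
  have half0: "(\<lambda>n. (1/2)^n / eps) \<longlonglongrightarrow> 0"
    by (intro tendsto_divide_zero LIMSEQ_realpow_zero) auto
  have "Cauchy f"
  proof (rule metric_CauchyI)
    fix d :: real assume "0 < d"
    then have "0 < d/2" by simp
    then have "\<forall>\<^sub>F n in sequentially. (1/2)^n / eps < d/2" by (rule order_tendstoD(2)[OF half0])
    then obtain n where n: "(1/2)^n / eps < d/2" by (auto simp: eventually_sequentially)
    have c: "dist (f (Suc n)) (f m) < d/2" if "m \<ge> Suc n" for m
    proof -
      have "f m \<in> A (f (Suc n))" using fA'[of "Suc n" "m - Suc n"] that by simp
      then have "dist (f (Suc n)) (f m) \<le> (1/2)^n / eps" using close[of "f m" n] eps by (simp add: pos_le_divide_eq mult.commute)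
      then show ?thesis using n by linarith
    qed
    show "\<exists>M. \<forall>m\<ge>M. \<forall>k\<ge>M. dist (f m) (f k) < d"
      using c by (intro exI[of _ "Suc n"]) (metis dist_triangle_half_r)
  qed
  then obtain w where w: "f \<longlonglongrightarrow> w" using Cauchy_convergent convergent_def by blast
  have wX: "w \<in> cball z \<rho>" by (rule closed_sequentially[OF closed_cball _ w]) (use fD in \<open>auto simp: D_def\<close>)
  have Ew: "E w \<le> ereal (e (f n) - eps * dist (f n) w)" for n
  proof (rule ereal_le_epsilon2)
    fix \<eta> :: real assume \<eta>: "0 < \<eta>"
    define c where "c = e (f n) - eps * dist (f n) w + \<eta>"
    have "(\<lambda>m. e (f n) - eps * dist (f n) (f m)) \<longlonglongrightarrow> e (f n) - eps * dist (f n) w" by (intro tendsto_intros w)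
    then have "\<forall>\<^sub>F m in sequentially. e (f n) - eps * dist (f n) (f m) < c"
      by (rule order_tendstoD) (use \<eta> in \<open>simp add: c_def\<close>)
    moreover have "\<forall>\<^sub>F m in sequentially. n \<le> m" by (rule eventually_ge_at_top)
    ultimately have "\<forall>\<^sub>F m in sequentially. f m \<in> {u. E u \<le> ereal c}"
    proof eventually_elim
      case (elim m)
      have "f m \<in> A (f n)" using fA'[of n "m - n"] elim by simp
      then have "e (f m) \<le> c" using elim by (auto simp: A_def)
      then show ?case using eE[OF fD] by simp
    qed
    then have "w \<in> {u. E u \<le> ereal c}" using lsc w
      unfolding lsc_def by (intro Lim_in_closed_set[of _ f sequentially]) auto
    then show "E w \<le> ereal (e (f n) - eps * dist (f n) w) + ereal \<eta>" by (simp add: c_def)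
  qed
  have wD: "w \<in> D" using wX Ew[of 0] by (auto simp: D_def)
  have wA: "w \<in> A (f n)" for n using Ew[of n] wD eE[OF wD] by (simp add: A_def)
  \<comment> \<open>A competitor below \<open>w\<close> lies below every \<open>f (Suc n)\<close>,
    hence within \<open>(1/2)^n / eps\<close> of it, and is therefore the limit of the same
    sequence.\<close>
  have unique: "u = w" if "u \<in> A w" for u
  proof -
    have "dist (f (Suc n)) u \<le> (1/2)^n / eps" for n
      using close[OF A_trans[OF wA that], of n] eps by (simp add: pos_le_divide_eq mult.commute)
    then have "(\<lambda>n. dist (f (Suc n)) u) \<longlonglongrightarrow> 0"
      using tendsto_sandwich[OF _ _ tendsto_const half0, of "\<lambda>n. dist (f (Suc n)) u"] by (simp add: always_eventually)
    then have "(\<lambda>n. f (Suc n)) \<longlonglongrightarrow> u" by (simp add: tendsto_dist_iff[symmetric])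
    then show ?thesis using LIMSEQ_unique LIMSEQ_Suc[OF w] by blast
  qed
  have "eps * dist z w \<le> 1" using wA[of 0] low[OF wD] ez by (auto simp: A_def f0 e_def)
  then have zw: "dist z w \<le> \<rho>/2" using \<rho> by (simp add: eps_def field_simps)
  have "\<forall>\<^sub>F u in at w. u \<in> ball w (\<rho>/2) - {w}" using \<rho>
    by (auto simp: eventually_at dist_commute intro!: exI[of _ "\<rho>/2"])
  then have "\<forall>\<^sub>F u in at w. ereal (e w - eps * dist w u) < E u"
  proof eventually_elim
    case (elim u)
    have uX: "u \<in> cball z \<rho>" using elim zw dist_triangle[of z u w] by auto
    show ?case
    proof (cases "E u = \<infinity>")
      case False
      then have uD: "u \<in> D" using uX by (auto simp: D_def)
      then have "u \<notin> A w" using unique elim by auto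
      then show ?thesis using uD eE[OF uD] by (auto simp: A_def)
    qed simp
  qed
  then have "slope E w \<le> ereal eps" using eE[OF wD] eps by (intro slope_leI) auto
  then show ?thesis using zw \<rho> wD by (intro exI[of _ w]) (auto simp: D_def)
qed

section \<open>Absolutely continuous functions with nonpositive derivative\<close>

text \<open>A Lebesgue null set is null for the finite Borel measure with density
  \<open>\<bar>m\<bar>\<close>; outer regularity of that measure gives the cover.\<close>

lemma null_set_open_cover_density:
  fixes m :: "real \<Rightarrow> real"
  assumes m: "integrable lborel m" and N: "N \<in> null_sets lborel" and e: "0 < e"
  defines "M \<equiv> density lborel (\<lambda>t. ennreal \<bar>m t\<bar>)"
  obtains U where "open U" "N \<subseteq> U" "measure M U < e"
proof -
  have fin: "emeasure M (space M) \<noteq> \<infinity>"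
  proof -
    have "emeasure M (space M) = (\<integral>\<^sup>+t. ennreal \<bar>m t\<bar> \<partial>lborel)"
      using m unfolding M_def by (subst emeasure_density) (auto intro!: nn_integral_cong)
    also have "\<dots> < \<infinity>" using m by (simp add: integrable_iff_bounded)
    finally show ?thesis by simp
  qed
  have "N \<in> null_sets M"
    using N m unfolding M_def by (subst null_sets_density_iff) (auto intro: AE_mp[OF AE_not_in[OF N]])
  then have N0: "emeasure M N = 0" "N \<in> sets M" by auto
  have sets: "sets M = sets borel" by (simp add: M_def)
  have "emeasure M N = (INF U\<in>{U. N \<subseteq> U \<and> open U}. emeasure M U)"
    using outer_regular[OF sets fin] N0 sets by simp
  then have "(INF U\<in>{U. N \<subseteq> U \<and> open U}. emeasure M U) < ennreal e" using N0 e by simp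
  then obtain U where U: "N \<subseteq> U" "open U" "emeasure M U < ennreal e" by (auto simp: INF_less_iff)
  then have "emeasure M U \<noteq> \<infinity>" by auto
  then have "measure M U < e"
    using U(3) by (simp add: emeasure_eq_ennreal_measure ennreal_less_iff)
  then show ?thesis using that U by blast
qed

text \<open>Outside a null set the derivative prevents growth. Inside it, growth is charged to an
  open cover of small \<open>\<bar>m\<bar>\<close> measure. The sum of an \<open>e\<close>-slope and
  the charge collected so far dominates \<open>F\<close> by a first-violation argument.\<close>

lemma nonincreasing_of_derivative_nonpos_AE:
  fixes F m :: "real \<Rightarrow> real"
  assumes ab: "a \<le> b" and m: "set_integrable lborel {a..b} m"
    and bound: "\<And>s r. a \<le> s \<Longrightarrow> s \<le> r \<Longrightarrow> r \<le> b \<Longrightarrow> F r - F s \<le> (\<integral>\<tau>\<in>{s..r}. m \<tau> \<partial>lborel)"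
    and cont: "continuous_on {a..b} F"
    and deriv: "AE t in lborel. a < t \<and> t < b \<longrightarrow> (\<exists>D\<le>0. (F has_real_derivative D) (at t))"
  shows "F b \<le> F a"
proof -
  define m' where "m' t = indicator {a..b} t * m t" for t
  have m': "integrable lborel m'" using m by (simp add: set_integrable_def m'_def[abs_def])
  define M where "M = density lborel (\<lambda>t. ennreal \<bar>m' t\<bar>)"
  have setsM: "sets M = sets borel" by (simp add: M_def)
  have finM: "finite_measure M"
  proof
    have "emeasure M (space M) = (\<integral>\<^sup>+t. ennreal \<bar>m' t\<bar> \<partial>lborel)"
      using m' unfolding M_def by (subst emeasure_density) (auto intro!: nn_integral_cong)
    also have "\<dots> < \<infinity>" using m' by (simp add: integrable_iff_bounded)
    finally show "emeasure M (space M) \<noteq> \<infinity>" by simp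
  qed
  interpret M: finite_measure M by (rule finM)
  \<comment> \<open>Half-open intervals make the collected charge additive; dropping the endpoint
    \<open>s\<close> changes nothing, as it is a null set.\<close>
  have M_int: "(\<integral>\<tau>\<in>{s..r}. m \<tau> \<partial>lborel) \<le> measure M {s<..r}" if sr: "a \<le> s" "s \<le> r" "r \<le> b" for s r
  proof -
    have int1: "integrable lborel (\<lambda>t. \<bar>m' t\<bar> * indicator {s<..r} t)"
      using integrable_mult_indicator[of "{s<..r}" lborel "\<lambda>t. \<bar>m' t\<bar>"] m' by (simp add: mult.commute)
    have int2: "integrable lborel (\<lambda>t. indicator {s..r} t * m' t)"
      using integrable_mult_indicator[of "{s..r}" lborel m'] m' by simp
    have "(\<integral>\<tau>\<in>{s..r}. m \<tau> \<partial>lborel) = (\<integral>t. indicator {s..r} t * m' t \<partial>lborel)"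
      unfolding set_lebesgue_integral_def m'_def using sr by (intro Bochner_Integration.integral_cong) (auto simp: indicator_def)
    also have "\<dots> \<le> (\<integral>t. \<bar>m' t\<bar> * indicator {s<..r} t \<partial>lborel)"
    proof (rule integral_mono_AE[OF int2 int1])
      show "AE t in lborel. indicator {s..r} t * m' t \<le> \<bar>m' t\<bar> * indicator {s<..r} t"
        using AE_lborel_singleton[of s] by eventually_elim (auto simp: indicator_def)
    qed
    also have "\<dots> = (\<integral>t. indicator {s<..r} t \<partial>M)"
      unfolding M_def using m' by (subst integral_density) auto
    also have "\<dots> = measure M {s<..r}" by (simp add: setsM)
    finally show ?thesis .
  qed
  have main: "F b - F a \<le> e * (b - a) + e" if e: "0 < e" for e
  proof -
    obtain N where N: "{t \<in> space lborel. \<not> (a < t \<and> t < b \<longrightarrow> (\<exists>D\<le>0. (F has_real_derivative D) (at t)))} \<subseteq> N"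
      "N \<in> null_sets lborel"
      using deriv by (rule AE_E) blast
    \<comment> \<open>The derivative hypothesis does not cover the endpoint \<open>a\<close>, so
      \<open>a\<close> is treated as exceptional.\<close>
    define N' where "N' = insert a N"
    have N': "N' \<in> null_sets lborel" using N(2) unfolding N'_def
      by (metis finite.emptyI finite.insertI finite_imp_null_set_lborel insert_is_Un null_sets.Un)
    obtain U where U: "open U" "N' \<subseteq> U" "measure M U < e"
      using null_set_open_cover_density[OF m' N' e] unfolding M_def by metis
    have Us: "U \<inter> {p<..q} \<in> sets M" for p q using U setsM by auto
    define W where "W t = measure M (U \<inter> {a<..t})" for t
    have W_mono: "W s \<le> W t" if "s \<le> t" for s t
      unfolding W_def using that by (intro M.finite_measure_mono Us) auto
    have W_add: "W t = W s + measure M (U \<inter> {s<..t})" if "a \<le> s" "s \<le> t" for s t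
    proof -
      have "U \<inter> {a<..t} = (U \<inter> {a<..s}) \<union> (U \<inter> {s<..t})" using that by auto
      then show ?thesis unfolding W_def by (metis (no_types) Us M.finite_measure_Union disjoint_iff IntD2 greaterThanAtMost_iff not_le)
    qed
    have claim: "F t - F a \<le> e * (t - a) + W t" if t: "t \<in> {a..b}" for t
    proof (rule ccontr)
      assume neg: "\<not> ?thesis"
      \<comment> \<open>The infimum of the violation times is not itself one, by continuity from the
        left; so violations accumulate at it from the right.\<close>
      define B where "B = {t\<in>{a..b}. e * (t - a) + W t < F t - F a}"
      have B: "t \<in> B" "B \<subseteq> {a..b}" using neg t by (auto simp: B_def)
      have bdd: "bdd_below B" using B by (meson bdd_below_Icc bdd_below_mono)
      define \<tau> where "\<tau> = Inf B"
      have \<tau>: "a \<le> \<tau>" "\<tau> \<le> t" using B t unfolding \<tau>_def by (auto intro!: cInf_greatest cInf_lower bdd)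
      have below: "F s - F a \<le> e * (s - a) + W s" if "a \<le> s" "s < \<tau>" for s
        using that cInf_lower[OF _ bdd, of s] \<tau> t unfolding \<tau>_def[symmetric] by (force simp: B_def)
      have at\<tau>: "F \<tau> - F a \<le> e * (\<tau> - a) + W \<tau>"
      proof (cases "\<tau> = a")
        case True
        then show ?thesis by (simp add: W_def)
      next
        case False
        then have "a < \<tau>" using \<tau> by simp
        have "continuous (at \<tau> within {a..b}) F" using cont \<tau> t by (auto simp: continuous_on_eq_continuous_within)
        then have "(F \<longlongrightarrow> F \<tau>) (at \<tau> within {a..b})" by (simp add: continuous_within)
        then have "(F \<longlongrightarrow> F \<tau>) (at \<tau> within {a..\<tau>})" by (rule tendsto_within_subset) (use \<tau> t in auto)
        then have lim: "(F \<longlongrightarrow> F \<tau>) (at_left \<tau>)"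
          using at_within_Icc_at_left[OF \<open>a < \<tau>\<close>] by simp
        have "\<forall>\<^sub>F s in at_left \<tau>. s \<in> {a<..<\<tau>}" using \<open>a < \<tau>\<close> by (rule eventually_at_left_real)
        then have "\<forall>\<^sub>F s in at_left \<tau>. F s \<le> F a + e * (\<tau> - a) + W \<tau>"
        proof eventually_elim
          case (elim s)
          have "e * (s - a) \<le> e * (\<tau> - a)" using elim e by (intro mult_left_mono) auto
          then show ?case using below[of s] W_mono[of s \<tau>] elim by auto
        qed
        then have "F \<tau> \<le> F a + e * (\<tau> - a) + W \<tau>" by (intro tendsto_upperbound[OF lim]) auto
        then show ?thesis by simp
      qed
      then have "\<tau> \<noteq> t" using neg by auto
      then have "\<tau> < b" using \<tau> t by auto
      \<comment> \<open>Just after the infimum, growth is either paid by the cover, if the time is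
        exceptional, or by \<open>e\<close>, since the derivative there is below \<open>e\<close>.
        Either way the bound survives for a while, contrary to the choice of the infimum.\<close>
      have "\<exists>\<delta>>0. \<forall>s. \<tau> < s \<and> s < \<tau> + \<delta> \<and> s \<le> b \<longrightarrow> F s - F \<tau> \<le> e * (s - \<tau>) + measure M (U \<inter> {\<tau><..s})"
      proof (cases "\<tau> \<in> N'")
        case True
        then obtain \<delta> where \<delta>: "0 < \<delta>" "ball \<tau> \<delta> \<subseteq> U" using U by (meson openE subsetD)
        have "F s - F \<tau> \<le> e * (s - \<tau>) + measure M (U \<inter> {\<tau><..s})" if s: "\<tau> < s" "s < \<tau> + \<delta>" "s \<le> b" for s
        proof -
          have "{\<tau><..s} \<subseteq> ball \<tau> \<delta>" using s by (auto simp: dist_real_def)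
          then have "U \<inter> {\<tau><..s} = {\<tau><..s}" using \<delta> by auto
          moreover have "F s - F \<tau> \<le> measure M {\<tau><..s}" using bound[of \<tau> s] M_int[of \<tau> s] s \<tau> by simp
          moreover have "0 \<le> e * (s - \<tau>)" using e s by simp
          ultimately show ?thesis by simp
        qed
        then show ?thesis using \<delta> by blast
      next
        case False
        then have "\<tau> \<noteq> a" "\<tau> \<notin> N" by (auto simp: N'_def)
        then obtain D where D: "D \<le> 0" "(F has_real_derivative D) (at \<tau>)"
          using subsetD[OF N(1), of \<tau>] \<tau> \<open>\<tau> < b\<close> by fastforce
        have "((\<lambda>s. (F s - F \<tau>) / (s - \<tau>)) \<longlongrightarrow> D) (at \<tau>)" using D(2) by (simp add: has_field_derivative_iff)
        then have "\<forall>\<^sub>F s in at \<tau>. (F s - F \<tau>) / (s - \<tau>) < e" by (rule order_tendstoD) (use D(1) e in linarith)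
        then obtain \<delta> where \<delta>: "0 < \<delta>" "\<And>s. s \<noteq> \<tau> \<Longrightarrow> dist s \<tau> < \<delta> \<Longrightarrow> (F s - F \<tau>) / (s - \<tau>) < e"
          unfolding eventually_at by auto
        have "F s - F \<tau> \<le> e * (s - \<tau>) + measure M (U \<inter> {\<tau><..s})" if s: "\<tau> < s" "s < \<tau> + \<delta>" for s
        proof -
          have "(F s - F \<tau>) / (s - \<tau>) < e" using s by (intro \<delta>) (auto simp: dist_real_def)
          then have "F s - F \<tau> < e * (s - \<tau>)" using s by (simp add: pos_divide_less_eq)
          then show ?thesis by (simp add: add_increasing2)
        qed
        then show ?thesis using \<delta> by blast
      qed
      then obtain \<delta> where \<delta>: "0 < \<delta>" "\<And>s. \<tau> < s \<Longrightarrow> s < \<tau> + \<delta> \<Longrightarrow> s \<le> b \<Longrightarrow> F s - F \<tau> \<le> e * (s - \<tau>) + measure M (U \<inter> {\<tau><..s})"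
        by blast
      have "Inf B < \<tau> + \<delta>" using \<delta> by (simp add: \<tau>_def)
      then obtain s where s: "s \<in> B" "s < \<tau> + \<delta>" using cInf_less_iff[OF _ bdd] B by blast
      have "\<tau> \<le> s" using s cInf_lower[OF _ bdd] by (simp add: \<tau>_def)
      moreover have "s \<noteq> \<tau>" using s at\<tau> by (auto simp: B_def)
      ultimately have "\<tau> < s" by simp
      then have "F s - F \<tau> \<le> e * (s - \<tau>) + measure M (U \<inter> {\<tau><..s})" using s B by (intro \<delta>) auto
      moreover have "W s = W \<tau> + measure M (U \<inter> {\<tau><..s})" using \<tau> \<open>\<tau> < s\<close> by (intro W_add) auto
      moreover have "e * (\<tau> - a) + e * (s - \<tau>) = e * (s - a)" by (simp add: algebra_simps)
      ultimately have "F s - F a \<le> e * (s - a) + W s" using at\<tau> by linarith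
      then show False using s by (auto simp: B_def)
    qed
    have "W b \<le> measure M U" unfolding W_def using U setsM by (intro M.finite_measure_mono) auto
    then show ?thesis using claim[of b] ab U by auto
  qed
  show ?thesis
  proof (rule field_le_epsilon)
    fix \<eta> :: real assume \<eta>: "0 < \<eta>"
    define e where "e = \<eta> / (b - a + 1)"
    have e: "0 < e" using \<eta> ab by (simp add: e_def)
    have "e * (b - a) + e = e * (b - a + 1)" by (simp add: algebra_simps)
    also have "\<dots> = \<eta>" using ab by (simp add: e_def)
    finally show "F b \<le> F a + \<eta>" using main[OF e] by linarith
  qed
qed

section \<open>Gradient flow\<close>

locale evi_flow = lambda_convex_function lam E for lam and E :: "'a::metric_space \<Rightarrow> ereal" +
  fixes c :: "real \<Rightarrow> 'a"
  assumes lsc: "lsc E" and lac: "loc_abs_cont c" and right0: "(c \<longlongrightarrow> c 0) (at_right 0)"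
    and evi: "\<And>w. AE t in lborel. t > 0 \<longrightarrow>
        (\<exists>D. ((\<lambda>s. (dist (c s) w)^2 / 2) has_real_derivative D) (at t) \<and>
             ereal D + E (c t) + ereal (lam / 2 * (dist (c t) w)^2) \<le> E w)"
    and dom: "effdom E \<noteq> {}"
begin

lemma isCont_flow:
  assumes t: "0 < t" shows "isCont c t"
proof -
  define a b where "a = t/2" and "b = 2 * t"
  have ab: "0 < a" "a < t" "t < b" using t by (auto simp: a_def b_def)
  obtain m where m: "set_integrable lborel {a..b} m"
    and dist_le: "\<And>s r. a \<le> s \<Longrightarrow> s \<le> r \<Longrightarrow> r \<le> b \<Longrightarrow> dist (c s) (c r) \<le> (\<integral>\<tau>\<in>{s..r}. m \<tau> \<partial>lborel)"
    using lac ab unfolding loc_abs_cont_def by (metis order_less_trans)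
  define I where "I r = integral {a..r} m" for r
  have int: "m integrable_on {a..b}" using set_borel_integral_eq_integral(1)[OF m] .
  have le: "dist (c s) (c r) \<le> I r - I s" if "a \<le> s" "s \<le> r" "r \<le> b" for s r
  proof -
    have "set_integrable lborel {s..r} m" using that by (intro set_integrable_subset[OF m]) auto
    then have "(\<integral>\<tau>\<in>{s..r}. m \<tau> \<partial>lborel) = integral {s..r} m" by (rule set_borel_integral_eq_integral)
    moreover have "m integrable_on {a..r}" using that by (intro integrable_on_subinterval[OF int]) auto
    then have "I s + integral {s..r} m = I r" unfolding I_def using that
      by (intro Henstock_Kurzweil_Integration.integral_combine) auto
    ultimately show ?thesis using dist_le[OF that] by linarith
  qed
  have "continuous_on {a..b} I" unfolding I_def by (rule indefinite_integral_continuous_1[OF int])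
  then have "isCont I t" using ab by (intro continuous_on_interior[of "{a..b}"]) auto
  then have "((\<lambda>s. \<bar>I s - I t\<bar>) \<longlongrightarrow> \<bar>I t - I t\<bar>) (at t)" unfolding isCont_def by (intro tendsto_intros)
  then have lim: "((\<lambda>s. \<bar>I s - I t\<bar>) \<longlongrightarrow> 0) (at t)" by simp
  have "\<forall>\<^sub>F s in at t. s \<in> {a<..<b}" using ab by (intro eventually_at_in_open') auto
  then have "\<forall>\<^sub>F s in at t. dist (c s) (c t) \<le> \<bar>I s - I t\<bar>"
  proof eventually_elim
    case (elim s)
    then show ?case using le[of s t] le[of t s] ab by (cases "s \<le> t") (auto simp: dist_commute)
  qed
  then have "((\<lambda>s. dist (c s) (c t)) \<longlongrightarrow> 0) (at t)"
    by (intro tendsto_sandwich[OF _ _ tendsto_const lim]) auto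
  then show ?thesis unfolding isCont_def using tendsto_dist_iff by blast
qed

lemma continuous_on_flow: "continuous_on {0..} c"
  unfolding continuous_on_def
proof
  fix t :: real assume "t \<in> {0..}"
  then consider "t = 0" | "0 < t" by fastforce
  then show "(c \<longlongrightarrow> c t) (at t within {0..})"
  proof cases
    case 1
    then show ?thesis using right0 by (simp add: at_within_Ici_at_right)
  next
    case 2
    then show ?thesis using isCont_flow[OF 2] by (auto simp: isCont_def intro: tendsto_within_subset)
  qed
qed

lemma flow_dist_bounded:
  assumes "0 \<le> a" obtains R where "0 \<le> R" "\<And>t. t \<in> {a..b} \<Longrightarrow> dist (c t) w \<le> R"
proof -
  have "continuous_on {a..b} (\<lambda>t. dist (c t) w)" using assms
    by (intro continuous_intros continuous_on_subset[OF continuous_on_flow]) auto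
  then have "bounded ((\<lambda>t. dist (c t) w) ` {a..b})" using compact_continuous_image compact_imp_bounded by blast
  then obtain R where "\<And>t. t \<in> {a..b} \<Longrightarrow> \<bar>dist (c t) w\<bar> \<le> R" unfolding bounded_iff by fastforce
  then show ?thesis using that[of "max R 0"] by fastforce
qed

text \<open>The evolution inequality in integrated form: the hypothesis says that
  \<open>E w - E (c t) - lam/2 * d^2\<close> is at most an affine function of time, whose integral
  is the right side.\<close>

lemma evi_step_pos:
  assumes a: "0 < a" "a < b" and w: "E w = ereal ew"
    and H: "\<And>t. a < t \<Longrightarrow> t < b \<Longrightarrow> ereal (ew - lam/2 * (dist (c t) w)^2 - (p + q * (t - a))) \<le> E (c t)"
  shows "(dist (c b) w)^2 / 2 - (dist (c a) w)^2 / 2 \<le> p * (b - a) + q * (b - a)^2 / 2"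
proof -
  define F where "F t = (dist (c t) w)^2 / 2 - p * (t - a) - q * (t - a)^2 / 2" for t
  obtain m where m: "set_integrable lborel {a..b} m"
    and dist_le: "\<And>s r. a \<le> s \<Longrightarrow> s \<le> r \<Longrightarrow> r \<le> b \<Longrightarrow> dist (c s) (c r) \<le> (\<integral>\<tau>\<in>{s..r}. m \<tau> \<partial>lborel)"
    using lac a unfolding loc_abs_cont_def by metis
  obtain R where R: "0 \<le> R" "\<And>t. t \<in> {a..b} \<Longrightarrow> dist (c t) w \<le> R"
    using flow_dist_bounded[of a b w] a by auto
  define C where "C = \<bar>p\<bar> + \<bar>q\<bar> * (b - a)"
  have const: "set_integrable lborel {s..r} (\<lambda>_. C)" for s r :: real
    unfolding set_integrable_def by (auto intro!: integrable_real_indicator simp: emeasure_lborel_Icc_eq)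
  have "F b \<le> F a"
  \<comment> \<open>The density \<open>R * m + C\<close> bounds increments of \<open>F\<close>: half
    the squared distance grows by at most \<open>R\<close> times the displacement, and the
    polynomial contributes at most \<open>C\<close> per unit of time.\<close>
  proof (rule nonincreasing_of_derivative_nonpos_AE[where F = F and a = a and b = b and m = "\<lambda>\<tau>. R * m \<tau> + C"])
    show "a \<le> b" using a by simp
    show "set_integrable lborel {a..b} (\<lambda>\<tau>. R * m \<tau> + C)"
      using m const by (intro set_integral_add) auto
    show "continuous_on {a..b} F" unfolding F_def using a
      by (intro continuous_intros continuous_on_subset[OF continuous_on_flow]) auto
    fix s r assume sr: "a \<le> s" "s \<le> r" "r \<le> b"
    have msr: "set_integrable lborel {s..r} m" using sr by (intro set_integrable_subset[OF m]) auto
    define X Y where "X = dist (c r) w" and "Y = dist (c s) w"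
    have XY: "0 \<le> X" "X \<le> R" "0 \<le> Y" "Y \<le> R" using R sr by (auto simp: X_def Y_def)
    have "\<bar>X - Y\<bar> \<le> dist (c s) (c r)" unfolding X_def Y_def
      using dist_triangle[of "c r" w "c s"] dist_triangle[of "c s" w "c r"] by (simp add: dist_commute)
    moreover have "\<bar>(X + Y) / 2\<bar> \<le> R" using XY by simp
    ultimately have "\<bar>X - Y\<bar> * \<bar>(X + Y) / 2\<bar> \<le> dist (c s) (c r) * R" by (intro mult_mono) auto
    moreover have "X^2 / 2 - Y^2 / 2 = (X - Y) * ((X + Y) / 2)" by (simp add: power2_eq_square field_simps)
    ultimately have 1: "X^2 / 2 - Y^2 / 2 \<le> R * dist (c s) (c r)"
      by (metis abs_ge_self abs_mult mult.commute order_trans)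
    have "dist (c s) (c r) \<le> (\<integral>\<tau>\<in>{s..r}. m \<tau> \<partial>lborel)" using sr by (rule dist_le)
    then have 2: "R * dist (c s) (c r) \<le> R * (\<integral>\<tau>\<in>{s..r}. m \<tau> \<partial>lborel)" using R by (intro mult_left_mono) auto
    have 3: "- (p * (r - s)) \<le> \<bar>p\<bar> * (r - s)" using sr by (metis abs_ge_minus_self abs_mult abs_of_nonneg diff_ge_0_iff_ge)
    have 4: "- (q * ((r - s) * (((r - a) + (s - a)) / 2))) \<le> \<bar>q\<bar> * ((r - s) * (b - a))"
    proof -
      have "- (q * ((r - s) * (((r - a) + (s - a)) / 2))) \<le> \<bar>q * ((r - s) * (((r - a) + (s - a)) / 2))\<bar>" by (rule abs_ge_minus_self)
      also have "\<dots> = \<bar>q\<bar> * ((r - s) * (((r - a) + (s - a)) / 2))" using sr by (simp add: abs_mult)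
      also have "\<dots> \<le> \<bar>q\<bar> * ((r - s) * (b - a))" using sr by (intro mult_left_mono) auto
      finally show ?thesis .
    qed
    have "F r - F s = (X^2 / 2 - Y^2 / 2) - p * (r - s) - q * ((r - s) * (((r - a) + (s - a)) / 2))"
      by (simp add: F_def X_def Y_def power2_eq_square field_simps)
    also have "\<dots> \<le> R * (\<integral>\<tau>\<in>{s..r}. m \<tau> \<partial>lborel) + C * (r - s)"
      using 1 2 3 4 by (simp add: C_def algebra_simps)
    also have "C * (r - s) = (\<integral>\<tau>\<in>{s..r}. C \<partial>lborel)"
      using sr by (simp add: set_lebesgue_integral_def)
    also have "R * (\<integral>\<tau>\<in>{s..r}. m \<tau> \<partial>lborel) + (\<integral>\<tau>\<in>{s..r}. C \<partial>lborel) = (\<integral>\<tau>\<in>{s..r}. R * m \<tau> + C \<partial>lborel)"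
      using msr const by (subst set_integral_add) auto
    finally show "F r - F s \<le> (\<integral>\<tau>\<in>{s..r}. R * m \<tau> + C \<partial>lborel)" .
  next
    show "AE t in lborel. a < t \<and> t < b \<longrightarrow> (\<exists>D\<le>0. (F has_real_derivative D) (at t))"
      using evi[of w]
    proof eventually_elim
      case (elim t)
      show ?case
      proof
        assume t: "a < t \<and> t < b"
        then obtain D where D: "((\<lambda>s. (dist (c s) w)^2 / 2) has_real_derivative D) (at t)"
          "ereal D + E (c t) + ereal (lam / 2 * (dist (c t) w)^2) \<le> E w" using elim a by auto
        have "E (c t) < \<infinity>" using D(2) w by (cases "E (c t)") auto
        then obtain f where f: "E (c t) = ereal f" by (rule finiteE)
        have "D + f + lam/2 * (dist (c t) w)^2 \<le> ew" using D(2) by (simp add: f w)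
        moreover have "ew - lam/2 * (dist (c t) w)^2 - (p + q * (t - a)) \<le> f" using H[of t] t by (simp add: f)
        ultimately have le: "D - p - q * (t - a) \<le> 0" by linarith
        have "(F has_real_derivative (D - p - q * (t - a))) (at t)"
          unfolding F_def by (rule derivative_eq_intros D(1) refl | simp)+
        with le show "\<exists>D\<le>0. (F has_real_derivative D) (at t)" by blast
      qed
    qed
  qed
  then show ?thesis by (simp add: F_def)
qed

text \<open>Absolute continuity is assumed only away from time 0. The starting time 0 is reached by
  applying the previous estimate from \<open>s > a\<close>, with \<open>p\<close> replaced by
  \<open>p + q*(s - a)\<close>, and letting \<open>s\<close> decrease to \<open>a\<close>.\<close>

lemma evi_step:
  assumes a: "0 \<le> a" "a \<le> b" and w: "E w = ereal ew" and q: "0 \<le> q"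
    and H: "\<And>t. a < t \<Longrightarrow> t < b \<Longrightarrow> ereal (ew - lam/2 * (dist (c t) w)^2 - (p + q * (t - a))) \<le> E (c t)"
  shows "(dist (c b) w)^2 / 2 - (dist (c a) w)^2 / 2 \<le> p * (b - a) + q * (b - a)^2 / 2"
proof (cases "a = b")
  case False
  then have ab: "a < b" using a by simp
  have ev: "\<forall>\<^sub>F s in at_right a. s \<in> {a<..<b}" using ab by (rule eventually_at_right_real)
  then have "\<forall>\<^sub>F s in at_right a. (dist (c b) w)^2 / 2 - (dist (c s) w)^2 / 2 \<le> (p + q * (s - a)) * (b - s) + q * (b - s)^2 / 2"
  proof eventually_elim
    case (elim s)
    show ?case
    proof (rule evi_step_pos[OF _ _ w])
      fix t assume t: "s < t" "t < b"
      have "(p + q * (s - a)) + q * (t - s) = p + q * (t - a)" by (simp add: algebra_simps)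
      then show "ereal (ew - lam/2 * (dist (c t) w)^2 - ((p + q * (s - a)) + q * (t - s))) \<le> E (c t)"
        using H[of t] t elim by (simp only:) auto
    qed (use elim a in auto)
  qed
  moreover have "(c \<longlongrightarrow> c a) (at_right a)"
    using continuous_on_flow a unfolding continuous_on_def
    by (auto intro: tendsto_within_subset)
  then have "((\<lambda>s. (dist (c b) w)^2 / 2 - (dist (c s) w)^2 / 2) \<longlongrightarrow> (dist (c b) w)^2 / 2 - (dist (c a) w)^2 / 2) (at_right a)"
    by (intro tendsto_intros) auto
  moreover have "((\<lambda>s. (p + q * (s - a)) * (b - s) + q * (b - s)^2 / 2) \<longlongrightarrow> (p + q * (a - a)) * (b - a) + q * (b - a)^2 / 2) (at_right a)"
    by (intro tendsto_intros) auto
  ultimately have "(dist (c b) w)^2 / 2 - (dist (c a) w)^2 / 2 \<le> (p + q * (a - a)) * (b - a) + q * (b - a)^2 / 2"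
    by (intro tendsto_le[OF trivial_limit_at_right_real])
  then show ?thesis by simp
qed simp

lemma abs_lam_bound: "0 \<le> d \<Longrightarrow> d \<le> L \<Longrightarrow> - (lam/2 * d^2) \<le> abs lam/2 * L^2"
proof -
  assume d: "0 \<le> d" "d \<le> L"
  have "- (lam/2 * d^2) \<le> abs lam/2 * d^2" using mult_right_mono[of "-lam/2" "abs lam/2" "d^2"] by auto
  also have "\<dots> \<le> abs lam/2 * L^2" using d by (intro mult_left_mono power_mono) auto
  finally show ?thesis .
qed

lemma attains_max_dist:
  assumes "0 \<le> a" "a \<le> b"
  obtains r where "r \<in> {a..b}" "\<And>t. t \<in> {a..b} \<Longrightarrow> dist (c t) w \<le> dist (c r) w"
proof -
  have "continuous_on {a..b} (\<lambda>t. dist (c t) w)" using assms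
    by (intro continuous_intros continuous_on_subset[OF continuous_on_flow]) auto
  then show ?thesis using continuous_attains_sup[of "{a..b}" "\<lambda>t. dist (c t) w"] assms that by auto
qed

text \<open>Just after the last time \<open>p\<close> at which the energy is at most \<open>\<alpha>\<close>, the evolution
  inequality tested with \<open>c p\<close> forces the flow to stand still.\<close>

lemma energy_nonincreasing:
  assumes st: "0 \<le> s" "s \<le> t"
  shows "E (c t) \<le> E (c s)"
proof (rule ccontr)
  assume "\<not> ?thesis"
  then have "E (c s) < E (c t)" by simp
  from ereal_dense2[OF this] obtain \<alpha> where \<alpha>: "E (c s) < ereal \<alpha>" "ereal \<alpha> < E (c t)" by blast
  define P where "P = {s..t} \<inter> c -` {x. E x \<le> ereal \<alpha>}"
  have "continuous_on {s..t} c" using st by (intro continuous_on_subset[OF continuous_on_flow]) auto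
  then have "closed P" unfolding P_def using lsc unfolding lsc_def
    by (intro continuous_closed_preimage) auto
  have sP: "s \<in> P" using \<alpha> st by (auto simp: P_def)
  have bdd: "bdd_above P" unfolding P_def by (meson bdd_above_Icc bdd_above_mono inf_le1)
  define p where "p = Sup P"
  have pP: "p \<in> P" unfolding p_def using sP bdd \<open>closed P\<close> by (intro closed_contains_Sup) auto
  then have p: "s \<le> p" "p \<le> t" "E (c p) \<le> ereal \<alpha>" by (auto simp: P_def)
  have "p \<noteq> t" using \<alpha> p by auto
  then have pt: "p < t" using p by simp
  have above: "ereal \<alpha> < E (c r)" if "p < r" "r \<le> t" for r
  proof (rule ccontr)
    assume "\<not> ereal \<alpha> < E (c r)"
    then have "r \<in> P" using that p by (auto simp: P_def)
    then have "r \<le> p" unfolding p_def by (rule cSup_upper[OF _ bdd])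
    then show False using that by simp
  qed
  have "E (c p) < \<infinity>" using p by auto
  then obtain ep where ep: "E (c p) = ereal ep" by (rule finiteE)
  \<comment> \<open>So short that the \<open>lam\<close> term is absorbed: the maximal squared
    displacement \<open>D^2\<close> becomes at most a factor below 1 times itself.\<close>
  define q where "q = min t (p + 1 / (2 * (abs lam + 1)))"
  have q: "p < q" "q \<le> t" using pt by (auto simp: q_def)
  have lq: "abs lam * (q - p) < 1"
  proof -
    have "abs lam * (q - p) \<le> abs lam * (1 / (2 * (abs lam + 1)))" by (intro mult_left_mono) (auto simp: q_def)
    also have "\<dots> < 1" by (simp add: field_simps)
    finally show ?thesis .
  qed
  obtain r where r: "r \<in> {p..q}" "\<And>t. t \<in> {p..q} \<Longrightarrow> dist (c t) (c p) \<le> dist (c r) (c p)"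
    using attains_max_dist[of p q "c p"] st p q by auto
  define D where "D = dist (c r) (c p)"
  have "(dist (c r) (c p))^2 / 2 - (dist (c p) (c p))^2 / 2 \<le> (abs lam/2 * D^2) * (r - p) + 0 * (r - p)^2 / 2"
  proof (rule evi_step[OF _ _ ep])
    fix t' assume t': "p < t'" "t' < r"
    have "dist (c t') (c p) \<le> D" using r t' by (auto simp: D_def)
    then have "- (lam/2 * (dist (c t') (c p))^2) \<le> abs lam/2 * D^2" by (intro abs_lam_bound) auto
    then have "ereal (ep - lam/2 * (dist (c t') (c p))^2 - (abs lam/2 * D^2 + 0 * (t' - p))) \<le> ereal ep" by simp
    also have "\<dots> \<le> ereal \<alpha>" using p ep by simp
    also have "\<dots> \<le> E (c t')" using above[of t'] t' r q by auto
    finally show "ereal (ep - lam/2 * (dist (c t') (c p))^2 - (abs lam/2 * D^2 + 0 * (t' - p))) \<le> E (c t')" .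
  qed (use st p r in auto)
  then have "D^2 \<le> D^2 * (abs lam * (r - p))" by (simp add: D_def mult_ac)
  also have "\<dots> \<le> D^2 * (abs lam * (q - p))" using r by (intro mult_left_mono) auto
  finally have "D^2 * (1 - abs lam * (q - p)) \<le> 0" by (simp add: algebra_simps)
  then have "D^2 \<le> 0" using lq by (simp add: mult_le_0_iff)
  then have "D = 0" by simp
  then have "c q = c p" using r(2)[of q] q by (simp add: D_def)
  then show False using above[of q] q p by auto
qed

text \<open>The evolution inequality tested with one point of finite energy gives finiteness at
  almost every time, and monotonicity carries it to all later times.\<close>

lemma energy_finite:
  assumes t: "0 < t" shows "E (c t) < \<infinity>"
proof -
  obtain w where w: "E w < \<infinity>" using dom by (auto simp: effdom_def)
  have "\<exists>s. 0 < s \<and> s < t \<and> E (c s) < \<infinity>"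
  proof (rule ccontr)
    assume neg: "\<not> ?thesis"
    have "AE s in lborel. s \<notin> {0<..<t}"
      using evi[of w]
    proof eventually_elim
      case (elim s)
      show ?case
      proof
        assume s: "s \<in> {0<..<t}"
        then obtain D where "ereal D + E (c s) + ereal (lam / 2 * (dist (c s) w)^2) \<le> E w" using elim by auto
        then have "E (c s) < \<infinity>" using w by (cases "E (c s)") auto
        then show False using neg s by auto
      qed
    qed
    then have "emeasure lborel {0<..<t} = 0" by (subst (asm) AE_iff_measurable[of "{0<..<t}"]) auto
    then show False using t by simp
  qed
  then show ?thesis using energy_nonincreasing[of _ t] by (meson less_imp_le order_le_less_trans)
qed

definition energy :: "real \<Rightarrow> real" where "energy t = real_of_ereal (E (c t))"

lemma E_eq_energy: "E (c t) < \<infinity> \<Longrightarrow> E (c t) = ereal (energy t)"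
  using not_MInf[of "c t"] by (cases "E (c t)") (auto simp: energy_def)

lemma E_eq_energy_pos: "0 < t \<Longrightarrow> E (c t) = ereal (energy t)"
  by (intro E_eq_energy energy_finite)

lemma energy_mono: "0 < s \<Longrightarrow> s \<le> t \<Longrightarrow> energy t \<le> energy s"
  using energy_nonincreasing[of s t] E_eq_energy_pos[of s] E_eq_energy_pos[of t] by simp

text \<open>By monotonicity the energy on the interval is at least its final value, so a constant
  bound suffices.\<close>

lemma discrete_evi:
  assumes s: "0 \<le> s" "s < t" and w: "E w = ereal ew"
    and L: "\<And>r. r \<in> {s..t} \<Longrightarrow> dist (c r) w \<le> L"
  shows "(dist (c t) w)^2 / 2 - (dist (c s) w)^2 / 2 \<le> (t - s) * (ew - energy t + abs lam/2 * L^2)"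
proof -
  have "(dist (c t) w)^2 / 2 - (dist (c s) w)^2 / 2 \<le> (ew - energy t + abs lam/2 * L^2) * (t - s) + 0 * (t - s)^2 / 2"
  proof (rule evi_step[OF _ _ w])
    fix r assume r: "s < r" "r < t"
    have "- (lam/2 * (dist (c r) w)^2) \<le> abs lam/2 * L^2" using L[of r] r by (intro abs_lam_bound) auto
    moreover have "energy t \<le> energy r" using s r by (intro energy_mono) auto
    ultimately show "ereal (ew - lam/2 * (dist (c r) w)^2 - (ew - energy t + abs lam/2 * L^2 + 0 * (r - s))) \<le> E (c r)"
      using s r by (simp add: E_eq_energy_pos)
  qed (use s in auto)
  then show ?thesis by (simp add: mult.commute)
qed


section \<open>Quasi-contraction of time shifts and finite slope at positive times\<close>

text \<open>The two curves are advanced one at a time: first the later one, tested with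
  \<open>c s\<close>, then the earlier one, tested with the new endpoint
  \<open>c (s + h + \<delta>)\<close>. The energy at \<open>s + h + \<delta>\<close> cancels,
  leaving a drop that telescopes over successive steps.\<close>

lemma shift_step:
  assumes s: "0 < s" and \<delta>: "0 < \<delta>" and h: "0 \<le> h"
    and osc1: "\<And>r. r \<in> {s..s + \<delta>} \<Longrightarrow> dist (c r) (c s) \<le> \<eta>"
    and osc2: "\<And>r. r \<in> {s + h..s + h + \<delta>} \<Longrightarrow> dist (c r) (c (s + h)) \<le> \<eta>"
  shows "(dist (c (s + \<delta> + h)) (c (s + \<delta>)))^2 \<le>
    (1 + 4 * abs lam * \<delta>) * (dist (c (s + h)) (c s))^2 + 2 * \<delta> * (energy s - energy (s + \<delta>)) + 16 * abs lam * \<delta> * \<eta>^2"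
proof -
  define \<rho> where "\<rho> = dist (c (s + h)) (c s)"
  define L where "L = \<rho> + 2 * \<eta>"
  define w where "w = c (s + h + \<delta>)"
  have \<eta>: "0 \<le> \<eta>" using osc1[of s] \<delta> by simp
  have "(dist (c (s + h + \<delta>)) (c s))^2 / 2 - (dist (c (s + h)) (c s))^2 / 2 \<le> (s + h + \<delta> - (s + h)) * (energy s - energy (s + h + \<delta>) + abs lam/2 * L^2)"
  proof (rule discrete_evi)
    fix r assume "r \<in> {s + h..s + h + \<delta>}"
    then show "dist (c r) (c s) \<le> L" using osc2[of r] dist_triangle[of "c r" "c s" "c (s + h)"] \<eta> by (simp add: L_def \<rho>_def)
  qed (use s \<delta> h E_eq_energy_pos in auto)
  moreover have "(dist (c (s + \<delta>)) w)^2 / 2 - (dist (c s) w)^2 / 2 \<le> (s + \<delta> - s) * (energy (s + h + \<delta>) - energy (s + \<delta>) + abs lam/2 * L^2)"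
  proof (rule discrete_evi)
    fix r assume r: "r \<in> {s..s + \<delta>}"
    have "dist (c r) w \<le> dist (c r) (c s) + (dist (c s) (c (s + h)) + dist (c (s + h)) w)"
      using dist_triangle[of "c r" w "c s"] dist_triangle[of "c s" w "c (s + h)"] by linarith
    then show "dist (c r) w \<le> L" using osc1[OF r] osc2[of "s + h + \<delta>"] \<delta> by (simp add: L_def \<rho>_def w_def dist_commute)
  qed (use s \<delta> h E_eq_energy_pos in \<open>auto simp: w_def\<close>)
  ultimately have 1: "(dist (c (s + \<delta>)) w)^2 \<le> \<rho>^2 + 2 * \<delta> * (energy s - energy (s + \<delta>)) + 2 * \<delta> * abs lam * L^2"
    by (simp add: \<rho>_def w_def dist_commute algebra_simps)
  have "0 \<le> (\<rho> - 2 * \<eta>)^2" by simp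
  then have "L^2 \<le> 2 * \<rho>^2 + 8 * \<eta>^2" by (simp add: L_def power2_eq_square algebra_simps)
  then have "2 * \<delta> * abs lam * L^2 \<le> 2 * \<delta> * abs lam * (2 * \<rho>^2 + 8 * \<eta>^2)" using \<delta> by (intro mult_left_mono) auto
  moreover have "w = c (s + \<delta> + h)" by (simp add: w_def add_ac)
  ultimately show ?thesis using 1 by (simp add: \<rho>_def dist_commute algebra_simps)
qed

text \<open>A discrete Gronwall argument. Over \<open>n\<close> steps the energy errors telescope to
  \<open>2*\<delta>\<close> times a fixed drop and vanish as the step shrinks; the oscillation
  errors are small by uniform continuity. The crude rate \<open>4 * abs lam\<close> is enough,
  because only a finite factor on bounded time intervals matters.\<close>

lemma shift_distance_growth:
  assumes s: "0 < s" "s \<le> t" and h: "0 \<le> h"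
  shows "(dist (c (t + h)) (c t))^2 \<le> exp (4 * abs lam * (t - s)) * (dist (c (s + h)) (c s))^2"
proof (cases "s = t")
  case False
  then have st: "s < t" using s by simp
  define a where "a r = (dist (c (r + h)) (c r))^2" for r
  have main: "a t \<le> exp (4 * abs lam * (t - s)) * (a s + e)" if e: "0 < e" for e
  proof -
    define \<eta> where "\<eta> = min 1 (e / (2 * (16 * abs lam * (t - s) + 1)))"
    have den: "0 < 16 * abs lam * (t - s) + 1" using st by (simp add: add_nonneg_pos)
    have \<eta>: "0 < \<eta>" "\<eta> \<le> 1" using e den by (auto simp: \<eta>_def)
    have "\<eta>^2 \<le> \<eta>" using \<eta> by (simp add: power2_eq_square mult_left_le)
    then have "16 * abs lam * (t - s) * \<eta>^2 \<le> (16 * abs lam * (t - s) + 1) * \<eta>" using st \<eta> by (intro mult_mono) auto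
    also have "\<dots> \<le> (16 * abs lam * (t - s) + 1) * (e / (2 * (16 * abs lam * (t - s) + 1)))"
      using den by (intro mult_left_mono) (auto simp: \<eta>_def)
    also have "\<dots> = e / 2" using den by (simp add: field_simps)
    finally have err1: "16 * abs lam * (t - s) * \<eta>^2 \<le> e / 2" .
    have "uniformly_continuous_on {s..t + h} c"
      using s h by (intro compact_uniformly_continuous continuous_on_subset[OF continuous_on_flow]) auto
    then obtain d where d: "0 < d" "\<And>x y. x \<in> {s..t + h} \<Longrightarrow> y \<in> {s..t + h} \<Longrightarrow> dist y x < d \<Longrightarrow> dist (c y) (c x) < \<eta>"
      using \<eta> unfolding uniformly_continuous_on_def by metis
    have fst: "0 \<le> energy s - energy t" using energy_mono[of s t] s by simp
    \<comment> \<open>The first summand makes the step shorter than the modulus of continuity, the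
      second makes the telescoped energy error at most \<open>e/2\<close>.\<close>
    obtain n :: nat where n: "(t - s) / d + 4 * (t - s) * (energy s - energy t) / e < real n" using reals_Archimedean2 by blast
    have "0 \<le> 4 * (t - s) * (energy s - energy t) / e" "0 < (t - s) / d" using st fst e d by auto
    then have n1: "(t - s) / d < real n" "4 * (t - s) * (energy s - energy t) / e < real n" "0 < real n" using n by linarith+
    define \<delta> where "\<delta> = (t - s) / real n"
    have \<delta>: "0 < \<delta>" "\<delta> < d" using st n1 d by (auto simp: \<delta>_def field_simps)
    have err2: "2 * \<delta> * (energy s - energy t) \<le> e / 2" using n1 e by (simp add: \<delta>_def field_simps)
    have n\<delta>: "real n * \<delta> = t - s" using n1 by (simp add: \<delta>_def)
    define \<beta> where "\<beta> = 1 + 4 * abs lam * \<delta>"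
    have \<beta>: "1 \<le> \<beta>" using \<delta> by (simp add: \<beta>_def)
    define e0 where "e0 = 16 * abs lam * \<delta> * \<eta>^2"
    have e0: "0 \<le> e0" using \<delta> by (simp add: e0_def)
    have ind: "k \<le> n \<Longrightarrow> a (s + real k * \<delta>) \<le> \<beta>^k * (a s + 2 * \<delta> * (energy s - energy (s + real k * \<delta>)) + real k * e0)" for k
    proof (induction k)
      case (Suc k)
      define s' where "s' = s + real k * \<delta>"
      have "real (Suc k) * \<delta> \<le> real n * \<delta>" using Suc.prems \<delta> by (intro mult_right_mono) auto
      then have s't: "s' + \<delta> \<le> t" using n\<delta> by (simp add: s'_def algebra_simps)
      have s's: "s \<le> s'" using \<delta> by (simp add: s'_def)
      have Seq: "s + real (Suc k) * \<delta> = s' + \<delta>" by (simp add: s'_def algebra_simps)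
      have "a (s' + \<delta>) \<le> \<beta> * a s' + 2 * \<delta> * (energy s' - energy (s' + \<delta>)) + e0"
        unfolding a_def \<beta>_def e0_def
      proof (rule shift_step)
        fix r assume "r \<in> {s'..s' + \<delta>}"
        then show "dist (c r) (c s') \<le> \<eta>" using s's s't h \<delta> by (intro less_imp_le d(2)) (auto simp: dist_real_def)
      next
        fix r assume "r \<in> {s' + h..s' + h + \<delta>}"
        then show "dist (c r) (c (s' + h)) \<le> \<eta>" using s's s't h \<delta> by (intro less_imp_le d(2)) (auto simp: dist_real_def)
      qed (use s s's \<delta> h in auto)
      also have "\<dots> \<le> \<beta> * (\<beta>^k * (a s + 2 * \<delta> * (energy s - energy s') + real k * e0)) + 1 * (2 * \<delta> * (energy s' - energy (s' + \<delta>)) + e0)"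
        using Suc \<beta> by (auto simp: s'_def)
      also have "\<dots> \<le> \<beta> * (\<beta>^k * (a s + 2 * \<delta> * (energy s - energy s') + real k * e0)) + \<beta>^Suc k * (2 * \<delta> * (energy s' - energy (s' + \<delta>)) + e0)"
      proof -
        have "0 \<le> energy s' - energy (s' + \<delta>)" using energy_mono[of s' "s' + \<delta>"] s s's \<delta> by simp
        then have "0 \<le> 2 * \<delta> * (energy s' - energy (s' + \<delta>)) + e0" using \<delta> e0 by simp
        moreover have "1 \<le> \<beta>^Suc k" using \<beta> by (rule one_le_power)
        ultimately show ?thesis by (intro add_left_mono mult_right_mono) auto
      qed
      also have "\<dots> = \<beta>^Suc k * (a s + 2 * \<delta> * (energy s - energy (s' + \<delta>)) + real (Suc k) * e0)"
        by (simp add: algebra_simps)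
      finally show ?case unfolding Seq .
    qed (simp add: a_def)
    have "a t \<le> \<beta>^n * (a s + 2 * \<delta> * (energy s - energy t) + real n * e0)" using ind[of n] n\<delta> by simp
    also have "\<dots> \<le> \<beta>^n * (a s + e)"
    proof -
      have "real n * e0 = 16 * abs lam * (t - s) * \<eta>^2" using n\<delta> by (simp add: e0_def mult_ac flip: n\<delta>)
      then show ?thesis using err1 err2 \<beta> by (intro mult_left_mono) auto
    qed
    also have "\<dots> \<le> exp (4 * abs lam * (t - s)) * (a s + e)"
    proof -
      have "\<beta>^n \<le> exp (4 * abs lam * \<delta>)^n" unfolding \<beta>_def using \<delta>
        by (intro power_mono exp_ge_add_one_self) auto
      also have "\<dots> = exp (real n * (4 * abs lam * \<delta>))" by (simp add: exp_of_nat_mult)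
      also have "real n * (4 * abs lam * \<delta>) = 4 * abs lam * (t - s)" by (simp flip: n\<delta>)
      finally show ?thesis using e by (intro mult_right_mono) (auto simp: a_def)
    qed
    finally show ?thesis .
  qed
  have "((\<lambda>e. exp (4 * abs lam * (t - s)) * (a s + e)) \<longlongrightarrow> exp (4 * abs lam * (t - s)) * (a s + 0)) (at_right 0)"
    by (intro tendsto_intros)
  moreover have "\<forall>\<^sub>F e in at_right 0. a t \<le> exp (4 * abs lam * (t - s)) * (a s + e)"
    using main by (auto simp: eventually_at_filter)
  ultimately have "a t \<le> exp (4 * abs lam * (t - s)) * (a s + 0)"
    by (intro tendsto_lowerbound[OF _ _ trivial_limit_at_right_real])
  then show ?thesis by (simp add: a_def)
qed simp

text \<open>The evolution inequality is tested with the starting point of the interval, up to the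
  time of maximal displacement; for small \<open>h\<close> the \<open>lam\<close> term is
  absorbed.\<close>

lemma dist_sq_le_energy_drop:
  assumes s: "0 < s" and h: "0 < h" "h * abs lam \<le> 1/2"
  shows "(dist (c (s + h)) (c s))^2 \<le> 4 * h * (energy s - energy (s + h))"
proof -
  obtain r where r: "r \<in> {s..s + h}" "\<And>t. t \<in> {s..s + h} \<Longrightarrow> dist (c t) (c s) \<le> dist (c r) (c s)"
    using attains_max_dist[of s "s + h" "c s"] s h by auto
  define M where "M = dist (c r) (c s)"
  have drop: "0 \<le> energy s - energy (s + h)" using energy_mono[of s "s + h"] s h by simp
  have "M^2 \<le> 4 * h * (energy s - energy (s + h))"
  proof (cases "r = s")
    case True
    then show ?thesis using drop h by (simp add: M_def)
  next
    case False
    then have sr: "s < r" using r by simp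
    have "(dist (c r) (c s))^2 / 2 - (dist (c s) (c s))^2 / 2 \<le> (r - s) * (energy s - energy r + abs lam/2 * M^2)"
      using s sr r by (intro discrete_evi E_eq_energy_pos) (auto simp: M_def)
    also have "\<dots> \<le> h * (energy s - energy (s + h) + abs lam/2 * M^2)"
      using r s sr energy_mono[of r "s + h"] drop energy_mono[of s r] by (intro mult_mono add_mono) auto
    finally have "M^2 / 2 \<le> h * (energy s - energy (s + h)) + (h * abs lam) * M^2 / 2" by (simp add: M_def algebra_simps)
    moreover have "(h * abs lam) * M^2 \<le> 1/2 * M^2" using h by (intro mult_right_mono) auto
    ultimately show ?thesis by linarith
  qed
  moreover have "(dist (c (s + h)) (c s))^2 \<le> M^2" using r h unfolding M_def by (intro power_mono) auto
  ultimately show ?thesis by linarith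
qed

text \<open>The increment at \<open>t\<close> is controlled by each of the \<open>n\<close>
  increments of length \<open>h = t/(2*n)\<close> on \<open>[t/2, t]\<close>, and their squares sum
  to a multiple of \<open>h\<close> times the total energy drop. Averaging gains the missing factor
  \<open>1/n\<close>, proportional to \<open>h\<close>. A bound along this sequence of
  \<open>h\<close> is sufficient later.\<close>

lemma flow_difference_bound:
  assumes t: "0 < t"
  obtains L where "0 \<le> L" "\<And>n::nat. t * abs lam + 1 \<le> real n \<Longrightarrow> dist (c (t + t / (2 * real n))) (c t) \<le> L * (t / (2 * real n))"
proof -
  define \<Lambda> where "\<Lambda> = exp (4 * abs lam * t)"
  define \<Delta> where "\<Delta> = energy (t/2) - energy t"
  have \<Delta>: "0 \<le> \<Delta>" using energy_mono[of "t/2" t] t by (simp add: \<Delta>_def)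
  define L where "L = sqrt (8 * \<Lambda> * \<Delta> / t)"
  have \<Lambda>: "0 < \<Lambda>" by (simp add: \<Lambda>_def)
  have L0: "0 \<le> 8 * \<Lambda> * \<Delta> / t" using \<Delta> \<Lambda> t by simp
  have "dist (c (t + t / (2 * real n))) (c t) \<le> L * (t / (2 * real n))" if n: "t * abs lam + 1 \<le> real n" for n :: nat
  proof -
    define h where "h = t / (2 * real n)"
    have n0: "0 < real n" using n t by (smt (verit) mult_nonneg_nonneg abs_ge_zero)
    have h: "0 < h" "h * abs lam \<le> 1/2" using n0 n t by (auto simp: h_def field_simps)
    have nh: "real n * h = t/2" using n0 by (simp add: h_def)
    define D where "D = (dist (c (t + h)) (c t))^2"
    define s where "s k = t/2 + real k * h" for k
    have "D \<le> \<Lambda> * (4 * h * (energy (s k) - energy (s (Suc k))))" if k: "k < n" for k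
    proof -
      have "real k * h \<le> real n * h" using k h by (intro mult_right_mono) auto
      then have sk: "0 < s k" "s k \<le> t" using t nh h by (auto simp: s_def add_pos_nonneg)
      have "D \<le> exp (4 * abs lam * (t - s k)) * (dist (c (s k + h)) (c (s k)))^2"
        unfolding D_def using sk h by (intro shift_distance_growth) auto
      also have "\<dots> \<le> \<Lambda> * (dist (c (s k + h)) (c (s k)))^2"
        unfolding \<Lambda>_def using sk by (intro mult_right_mono) (auto intro: mult_left_mono)
      also have "\<dots> \<le> \<Lambda> * (4 * h * (energy (s k) - energy (s k + h)))"
        using \<Lambda> sk h by (intro mult_left_mono dist_sq_le_energy_drop) auto
      also have "s k + h = s (Suc k)" by (simp add: s_def algebra_simps)
      finally show ?thesis .
    qed
    then have "(\<Sum>k<n. D) \<le> (\<Sum>k<n. \<Lambda> * (4 * h * (energy (s k) - energy (s (Suc k)))))" by (intro sum_mono) auto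
    also have "\<dots> = \<Lambda> * (4 * h * (energy (s 0) - energy (s n)))"
      by (simp only: sum_distrib_left[symmetric] sum_lessThan_telescope'[of "\<lambda>k. energy (s k)" n])
    also have "s 0 = t/2" by (simp add: s_def)
    also have "s n = t" unfolding s_def nh by simp
    also have "energy (t/2) - energy t = \<Delta>" by (simp add: \<Delta>_def)
    finally have "real n * D \<le> \<Lambda> * (4 * h * \<Delta>)" by simp
    then have "D \<le> \<Lambda> * (4 * h * \<Delta>) / real n" using n0 by (simp add: field_simps)
    also have "\<dots> = (8 * \<Lambda> * \<Delta> / t) * h^2" using n0 t by (simp add: h_def power2_eq_square field_simps)
    also have "\<dots> = (L * h)^2" using L0 by (simp add: L_def power_mult_distrib)
    finally have "(dist (c (t + h)) (c t))^2 \<le> (L * h)^2" by (simp add: D_def)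
    then have "dist (c (t + h)) (c t) \<le> L * h" by (rule power2_le_imp_le) (use L0 h in \<open>simp add: L_def\<close>)
    then show ?thesis by (simp add: h_def)
  qed
  moreover have "0 \<le> L" using L0 by (simp add: L_def)
  ultimately show thesis using that by blast
qed

text \<open>Divide the evolution inequality over \<open>[t, t + h n]\<close> by \<open>h n\<close>:
  the increment bound makes the change of squared distance cost at most \<open>L\<close> times the
  distance. In the limit this is a linear lower bound for \<open>E\<close> around
  \<open>c t\<close>, up to a quadratic term.\<close>

lemma slope_finite:
  assumes t: "0 < t" shows "slope E (c t) < \<infinity>"
proof -
  obtain L where L: "0 \<le> L" and diff: "\<And>n::nat. t * abs lam + 1 \<le> real n \<Longrightarrow> dist (c (t + t / (2 * real n))) (c t) \<le> L * (t / (2 * real n))"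
    using flow_difference_bound[OF t] by blast
  have bound: "ereal (energy t - L * dist (c t) w - abs lam/2 * (dist (c t) w)^2) \<le> E w" for w
  proof (cases "E w = \<infinity>")
    case False
    then have "E w < \<infinity>" by auto
    then obtain ew where ew: "E w = ereal ew" by (rule finiteE)
    define A where "A = dist (c t) w"
    have A: "0 \<le> A" by (simp add: A_def)
    have main: "energy t \<le> ew + L * A + abs lam/2 * (A + \<eta>)^2" if \<eta>: "0 < \<eta>" for \<eta>
    proof -
      define h where "h n = t / (2 * real n)" for n :: nat
      have h0: "h \<longlonglongrightarrow> 0" unfolding h_def
      proof -
        have "(\<lambda>n. t / 2 * inverse (real n)) \<longlonglongrightarrow> t / 2 * 0" by (intro tendsto_intros lim_inverse_n)
        then show "(\<lambda>n. t / (2 * real n)) \<longlonglongrightarrow> 0" by (simp add: field_simps)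
      qed
      have "isCont (\<lambda>r. dist (c r) w) t" by (intro continuous_intros isCont_flow t)
      then have "((\<lambda>r. dist (c r) w) \<longlongrightarrow> A) (nhds t)"
        using tendsto_at_iff_tendsto_nhds[of "\<lambda>r. dist (c r) w" t] by (simp add: isCont_def A_def)
      then have "\<forall>\<^sub>F r in nhds t. dist (c r) w < A + \<eta>" by (rule order_tendstoD) (use \<eta> in simp)
      then obtain d where d: "0 < d" "\<And>r. dist r t < d \<Longrightarrow> dist (c r) w < A + \<eta>" unfolding eventually_nhds_metric by blast
      have "\<forall>\<^sub>F n in sequentially. h n < d" by (rule order_tendstoD(2)[OF h0 d(1)])
      moreover have "\<forall>\<^sub>F n in sequentially. t * abs lam + 1 \<le> real n"
        by (rule eventually_compose_filterlim[OF eventually_ge_at_top filterlim_real_sequentially])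
      ultimately have "\<forall>\<^sub>F n in sequentially. c (t + h n) \<in> {x. E x \<le> ereal (ew + L * A + abs lam/2 * (A + \<eta>)^2)}"
      proof eventually_elim
        case (elim n)
        have n0: "0 < real n" using elim(2) t by (smt (verit) mult_nonneg_nonneg abs_ge_zero)
        have hn: "0 < h n" using t n0 by (simp add: h_def)
        define B where "B = dist (c (t + h n)) w"
        have "B^2 / 2 - A^2 / 2 \<le> (t + h n - t) * (ew - energy (t + h n) + abs lam/2 * (A + \<eta>)^2)"
          unfolding A_def B_def
        proof (rule discrete_evi[OF _ _ ew])
          fix r assume "r \<in> {t..t + h n}"
          then have "dist r t < d" using elim(1) by (auto simp: dist_real_def)
          then show "dist (c r) w \<le> dist (c t) w + \<eta>" using d(2)[of r] by (simp add: A_def)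
        qed (use t hn in auto)
        moreover have "A^2 / 2 - B^2 / 2 \<le> h n * (L * A)"
        proof (cases "A \<le> B")
          case True
          then have "A^2 \<le> B^2" using A by (intro power_mono) auto
          moreover have "0 \<le> h n * (L * A)" using hn L A by simp
          ultimately show ?thesis by linarith
        next
          case False
          have "A - B \<le> dist (c (t + h n)) (c t)" unfolding A_def B_def
            using dist_triangle[of "c t" w "c (t + h n)"] by (simp add: dist_commute)
          also have "\<dots> \<le> L * h n" unfolding h_def by (rule diff[OF elim(2)])
          finally have "(A - B) * ((A + B) / 2) \<le> (L * h n) * A"
            using False A by (intro mult_mono) (auto simp: B_def)
          then show ?thesis by (simp add: power2_eq_square field_simps)
        qed
        ultimately have "0 \<le> h n * (L * A) + h n * (ew - energy (t + h n) + abs lam/2 * (A + \<eta>)^2)" by simp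
        then have "0 \<le> h n * (L * A + (ew - energy (t + h n) + abs lam/2 * (A + \<eta>)^2))" by (simp only: distrib_left)
        then have "energy (t + h n) \<le> ew + L * A + abs lam/2 * (A + \<eta>)^2" using hn by (simp add: zero_le_mult_iff)
        then show ?case using t hn by (simp add: E_eq_energy_pos)
      qed
      moreover have "(\<lambda>n. c (t + h n)) \<longlonglongrightarrow> c t"
      proof -
        have "(\<lambda>n. t + h n) \<longlonglongrightarrow> t + 0" by (intro tendsto_intros h0)
        then show ?thesis using isCont_tendsto_compose[OF isCont_flow[OF t]] by simp
      qed
      \<comment> \<open>The estimate holds for the energy at \<open>t + h n\<close>; lower
        semicontinuity transfers it to time \<open>t\<close>.\<close>
      ultimately have "c t \<in> {x. E x \<le> ereal (ew + L * A + abs lam/2 * (A + \<eta>)^2)}"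
        using lsc unfolding lsc_def by (intro Lim_in_closed_set) auto
      then show ?thesis using t by (simp add: E_eq_energy_pos)
    qed
    have "((\<lambda>\<eta>. ew + L * A + abs lam/2 * (A + \<eta>)^2) \<longlongrightarrow> ew + L * A + abs lam/2 * (A + 0)^2) (at_right 0)"
      by (intro tendsto_intros)
    then have "energy t \<le> ew + L * A + abs lam/2 * (A + 0)^2"
      by (rule tendsto_lowerbound) (use main in \<open>auto simp: eventually_at_filter\<close>)
    then show ?thesis by (simp add: ew A_def)
  qed simp
  have "slope E (c t) \<le> ereal L"
    by (rule slope_le_of_quadratic_bound[OF E_eq_energy_pos[OF t] L _ bound]) auto
  then show ?thesis by auto
qed

section \<open>Speed and energy dissipation at a time of finite slope\<close>

text \<open>The flow is tested with \<open>c t\<close> and the slope bounds the energy loss by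
  \<open>S\<close> times the maximal displacement. The factor 4 is not sharp; its purpose is to have
  some linear bound from which to start the bootstrap.\<close>

lemma initial_speed_crude:
  assumes t: "0 \<le> t" and ex: "E (c t) = ereal ex" and S: "slope E (c t) = ereal S"
    and h: "0 \<le> h" "h * abs lam \<le> 1/4"
  shows "dist (c t) (c (t + h)) \<le> 4 * S * h"
proof -
  have S0: "0 \<le> S" using slope_nonneg[of "c t"] S by simp
  obtain r where r: "r \<in> {t..t + h}" "\<And>u. u \<in> {t..t + h} \<Longrightarrow> dist (c u) (c t) \<le> dist (c r) (c t)"
    using attains_max_dist[of t "t + h" "c t"] t h by auto
  define D where "D = dist (c r) (c t)"
  have D0: "0 \<le> D" by (simp add: D_def)
  have "(dist (c r) (c t))^2 / 2 - (dist (c t) (c t))^2 / 2 \<le> (S * D + abs lam * D^2) * (r - t) + 0 * (r - t)^2 / 2"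
  proof (rule evi_step[OF t _ ex])
    fix u assume u: "t < u" "u < r"
    define d where "d = dist (c u) (c t)"
    have d: "0 \<le> d" "d \<le> D" using r u by (auto simp: d_def D_def)
    have "S * d \<le> S * D" using d S0 by (intro mult_left_mono) auto
    moreover have "- (lam/2 * d^2) \<le> abs lam/2 * D^2" by (rule abs_lam_bound[OF d])
    ultimately have "ereal (ex - lam/2 * d^2 - (S * D + abs lam * D^2 + 0 * (u - t))) \<le> ereal (ex - S * d + lam/2 * d^2)"
      by simp
    also have "\<dots> \<le> E (c u)" using slope_global_bound[OF ex S, of "c u"] by (simp add: d_def dist_commute)
    finally show "ereal (ex - lam/2 * (dist (c u) (c t))^2 - (S * D + abs lam * D^2 + 0 * (u - t))) \<le> E (c u)"
      by (simp add: d_def)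
  qed (use r in auto)
  then have "D^2 / 2 \<le> (S * D + abs lam * D^2) * (r - t)" by (simp add: D_def)
  also have "\<dots> \<le> (S * D + abs lam * D^2) * h" using r S0 D0 by (intro mult_left_mono) auto
  also have "\<dots> = S * D * h + (h * abs lam) * D^2" by (simp add: algebra_simps)
  also have "\<dots> \<le> S * D * h + 1/4 * D^2" using h by (intro add_left_mono mult_right_mono) auto
  finally have "D * D \<le> D * (4 * S * h)" by (simp add: power2_eq_square algebra_simps)
  then have "D \<le> 4 * S * h" using D0 S0 h by (cases "D = 0") auto
  then show ?thesis using r(2)[of "t + h"] h by (simp add: D_def dist_commute)
qed

text \<open>One round of the bootstrap: the assumed bound \<open>k*r\<close> is inserted at each
  time \<open>r\<close>, so the linear term of \<open>evi_step\<close> is used and the integral of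
  \<open>r\<close> supplies the decisive factor 1/2.\<close>

lemma initial_speed_improve:
  assumes t: "0 \<le> t" and ex: "E (c t) = ereal ex" and S: "slope E (c t) = ereal S"
    and h: "0 \<le> h" and k: "0 \<le> k" and le: "\<And>r. 0 < r \<Longrightarrow> r \<le> h \<Longrightarrow> dist (c t) (c (t + r)) \<le> k * r"
  shows "(dist (c t) (c (t + h)))^2 \<le> (S * k + abs lam * k^2 * h) * h^2"
proof -
  have S0: "0 \<le> S" using slope_nonneg[of "c t"] S by simp
  define q where "q = S * k + abs lam * k^2 * h"
  have q0: "0 \<le> q" using S0 k h by (simp add: q_def)
  have "(dist (c (t + h)) (c t))^2 / 2 - (dist (c t) (c t))^2 / 2 \<le> 0 * (t + h - t) + q * (t + h - t)^2 / 2"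
  proof (rule evi_step[OF t _ ex q0])
    fix u assume u: "t < u" "u < t + h"
    define r where "r = u - t"
    have r: "0 < r" "r \<le> h" "u = t + r" using u by (auto simp: r_def)
    define d where "d = dist (c u) (c t)"
    have d: "0 \<le> d" "d \<le> k * r" using le[OF r(1,2)] r by (auto simp: d_def dist_commute)
    have "S * d \<le> S * (k * r)" using d S0 by (intro mult_left_mono) auto
    moreover have "- (lam/2 * d^2) \<le> abs lam/2 * (k * r)^2" by (rule abs_lam_bound[OF d])
    moreover have "abs lam * (k * r)^2 \<le> abs lam * k^2 * h * r"
    proof -
      have "abs lam * k^2 * r * r \<le> abs lam * k^2 * r * h" using r by (intro mult_left_mono) auto
      then show ?thesis by (simp add: power2_eq_square mult_ac)
    qed
    moreover have "q * r = S * (k * r) + abs lam * k^2 * h * r" by (simp add: q_def algebra_simps)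
    ultimately have "ex - lam/2 * d^2 - (0 + q * (u - t)) \<le> ex - S * d + lam/2 * d^2" using r by simp
    then have "ereal (ex - lam/2 * d^2 - (0 + q * (u - t))) \<le> ereal (ex - S * d + lam/2 * d^2)" by simp
    also have "\<dots> \<le> E (c u)" using slope_global_bound[OF ex S, of "c u"] by (simp add: d_def dist_commute)
    finally show "ereal (ex - lam/2 * (dist (c u) (c t))^2 - (0 + q * (u - t))) \<le> E (c u)"
      by (simp add: d_def)
  qed (use h in auto)
  then show ?thesis by (simp add: q_def dist_commute)
qed

text \<open>The asymptotic speed \<open>k\<close> is finite and, by the bootstrap \<open>k\<^sup>2 \<le> S k\<close>, at most the slope.\<close>

lemma initial_speed:
  assumes t: "0 \<le> t" and ex: "E (c t) = ereal ex" and S: "slope E (c t) = ereal S" and e: "0 < e"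
  shows "\<forall>\<^sub>F h in at_right 0. dist (c t) (c (t + h)) \<le> (S + e) * h"
proof -
  have S0: "0 \<le> S" using slope_nonneg[of "c t"] S by simp
  define Q where "Q = {k. 0 \<le> k \<and> (\<forall>\<^sub>F h in at_right 0. dist (c t) (c (t + h)) \<le> k * h)}"
  have "4 * S \<in> Q"
  proof -
    have "((\<lambda>h. h * abs lam) \<longlongrightarrow> 0 * abs lam) (at_right 0)" by (intro tendsto_intros)
    then have "\<forall>\<^sub>F h in at_right 0. h * abs lam < 1/4" by (rule order_tendstoD) simp
    moreover have "\<forall>\<^sub>F h in at_right (0::real). 0 < h" by (simp add: eventually_at_filter)
    ultimately have "\<forall>\<^sub>F h in at_right 0. dist (c t) (c (t + h)) \<le> 4 * S * h"
      by eventually_elim (use initial_speed_crude[OF t ex S] in auto)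
    then show ?thesis using S0 by (simp add: Q_def)
  qed
  then have Qne: "Q \<noteq> {}" by auto
  have bdd: "bdd_below Q" by (rule bdd_belowI[of _ 0]) (auto simp: Q_def)
  define k0 where "k0 = Inf Q"
  have k00: "0 \<le> k0" unfolding k0_def using Qne by (intro cInf_greatest) (auto simp: Q_def)
  have "k0 \<le> S"
  proof (rule ccontr)
    assume "\<not> k0 \<le> S"
    then have k0: "S < k0" by simp
    \<comment> \<open>If the infimum \<open>k0\<close> exceeded \<open>S\<close>, one round started
      from \<open>k\<close> close enough to \<open>k0\<close> would yield \<open>k'\<close> with
      \<open>k'^2 = k0^2 - gap/2\<close>: a quarter of \<open>gap\<close> is lost through
      \<open>k - k0\<close> and a quarter through the \<open>lam\<close> term.\<close>
    define gap where "gap = k0^2 - S * k0"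
    have gap: "0 < gap"
    proof -
      have "S * k0 < k0 * k0" using k0 S0 by (intro mult_strict_right_mono) auto
      then show ?thesis by (simp add: gap_def power2_eq_square)
    qed
    have "k0 < k0 + gap / (4 * (S + 1))" using gap S0 by simp
    then obtain k where k: "k \<in> Q" "k < k0 + gap / (4 * (S + 1))"
      unfolding k0_def using cInf_less_iff[OF Qne bdd] by blast
    have Sk: "S * k \<le> S * k0 + gap / 4"
    proof -
      have "S * k \<le> S * (k0 + gap / (4 * (S + 1)))" using k S0 by (intro mult_left_mono) auto
      also have "\<dots> = S * k0 + S / (S + 1) * (gap / 4)" using S0 by (simp add: field_simps)
      also have "\<dots> \<le> S * k0 + 1 * (gap / 4)" using S0 gap by (intro add_left_mono mult_right_mono) auto
      finally show ?thesis by simp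
    qed
    have k_nn: "0 \<le> k" using k by (simp add: Q_def)
    from k(1) have "\<forall>\<^sub>F h in at_right 0. dist (c t) (c (t + h)) \<le> k * h" by (simp add: Q_def)
    then obtain b where b: "0 < b" "\<And>h. 0 < h \<Longrightarrow> h < b \<Longrightarrow> dist (c t) (c (t + h)) \<le> k * h"
      unfolding eventually_at_right_field by auto
    define k' where "k' = sqrt (k0^2 - gap / 2)"
    have nn: "0 \<le> k0^2 - gap / 2"
    proof -
      have "0 \<le> S * k0" using S0 k0 by simp
      then have "gap \<le> k0^2" by (simp add: gap_def)
      then show ?thesis using gap by linarith
    qed
    have "((\<lambda>h. abs lam * k^2 * h) \<longlongrightarrow> abs lam * k^2 * 0) (at_right 0)" by (intro tendsto_intros)
    then have "\<forall>\<^sub>F h in at_right 0. abs lam * k^2 * h < gap / 4" by (rule order_tendstoD) (use gap in simp)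
    moreover have "\<forall>\<^sub>F h in at_right 0. h \<in> {0<..<b}" using b(1) by (rule eventually_at_right_real)
    ultimately have "\<forall>\<^sub>F h in at_right 0. dist (c t) (c (t + h)) \<le> k' * h"
    proof eventually_elim
      case (elim h)
      have "(dist (c t) (c (t + h)))^2 \<le> (S * k + abs lam * k^2 * h) * h^2"
        using elim b k_nn by (intro initial_speed_improve[OF t ex S]) auto
      also have "\<dots> \<le> (k0^2 - gap / 2) * h^2"
      proof (rule mult_right_mono)
        have "S * k0 = k0^2 - gap" by (simp add: gap_def)
        then show "S * k + abs lam * k^2 * h \<le> k0^2 - gap / 2" using Sk elim by linarith
      qed simp
      also have "\<dots> = (k' * h)^2" using nn by (simp add: k'_def power_mult_distrib)
      finally have "(dist (c t) (c (t + h)))^2 \<le> (k' * h)^2" .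
      then show ?case by (rule power2_le_imp_le) (use elim nn in \<open>simp add: k'_def\<close>)
    qed
    then have "k' \<in> Q" using nn by (simp add: Q_def k'_def)
    then have "k0 \<le> k'" unfolding k0_def using bdd by (intro cInf_lower) auto
    then have "k0^2 \<le> k'^2" using k00 by (intro power_mono) auto
    then show False using nn gap by (simp add: k'_def)
  qed
  then have "k0 < S + e" using e by simp
  then obtain k where k: "k \<in> Q" "k < S + e" unfolding k0_def using cInf_less_iff[OF Qne bdd] by blast
  from k(1) have "\<forall>\<^sub>F h in at_right 0. dist (c t) (c (t + h)) \<le> k * h" by (simp add: Q_def)
  moreover have "\<forall>\<^sub>F h in at_right (0::real). 0 < h" by (simp add: eventually_at_filter)
  ultimately show ?thesis
  proof eventually_elim
    case (elim h)
    have "k * h \<le> (S + e) * h" using k elim by (intro mult_right_mono) auto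
    then show ?case using elim by linarith
  qed
qed

text \<open>If the energy dropped by less than \<open>(S\<^sup>2 - \<delta>) h\<close>, then by monotonicity it would also be too large on
  \<open>[(1 - \<eta>) h, h]\<close>, and the evolution inequality tested with a steep point at distance \<open>S h\<close> would make a
  squared distance negative.\<close>

lemma initial_energy_drop:
  assumes t: "0 \<le> t" and ex: "E (c t) = ereal ex" and S: "slope E (c t) = ereal S" and \<delta>: "0 < \<delta>"
    and steep: "\<And>e. 0 < e \<Longrightarrow> \<exists>g T. geo_germ (c t) g S T \<and> (\<forall>s\<in>{0..T}. E (g s) \<le> ereal (ex - s * (S * (S - e))))"
  shows "\<forall>\<^sub>F h in at_right 0. E (c (t + h)) \<le> ereal (ex - (S^2 - \<delta>) * h)"
proof (cases "S = 0")
  case True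
  have "\<forall>\<^sub>F h in at_right (0::real). 0 < h" by (simp add: eventually_at_filter)
  then show ?thesis
  proof eventually_elim
    case (elim h)
    have "E (c (t + h)) \<le> ereal ex" using energy_nonincreasing[of t "t + h"] t elim ex by simp
    also have "\<dots> \<le> ereal (ex - (S^2 - \<delta>) * h)" using True \<delta> elim by simp
    finally show ?case .
  qed
next
  case False
  then have S0: "0 < S" using slope_nonneg[of "c t"] S by simp
  \<comment> \<open>The final balance contains the gain \<open>\<delta> * \<eta>\<close> against
    \<open>S^2 * \<eta>^2 / 2 \<le> \<delta> * \<eta> / 2\<close>,
    \<open>2 * S * eps = \<delta> * \<eta> / 8\<close> and
    \<open>C * h < \<delta> * \<eta> / 8\<close>, so a quarter of the gain remains. The bound 1/2
    keeps the first interval nonempty.\<close>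
  define \<eta> where "\<eta> = min (1/2) (\<delta> / S^2)"
  have \<eta>: "0 < \<eta>" "\<eta> \<le> 1/2" "S^2 * \<eta> \<le> \<delta>"
  proof -
    have "S^2 * \<eta> \<le> S^2 * (\<delta> / S^2)" by (intro mult_left_mono) (auto simp: \<eta>_def)
    then show "S^2 * \<eta> \<le> \<delta>" using S0 by simp
    show "\<eta> \<le> 1/2" unfolding \<eta>_def by (rule min.cobounded1)
  qed (use S0 \<delta> in \<open>auto simp: \<eta>_def\<close>)
  define eps where "eps = \<eta> * \<delta> / (16 * S)"
  have eps: "0 < eps" "S * eps = \<eta> * \<delta> / 16" using \<eta> \<delta> S0 by (auto simp: eps_def)
  define S' where "S' = S + eps"
  obtain g T where g: "geo_germ (c t) g S T" and Eg: "\<And>s. s \<in> {0..T} \<Longrightarrow> E (g s) \<le> ereal (ex - s * (S * (S - eps)))"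
    using steep[OF eps(1)] by blast
  have T: "0 < T" using g by (simp add: geo_germ_def)
  obtain b where b: "0 < b" "\<And>h. 0 < h \<Longrightarrow> h < b \<Longrightarrow> dist (c t) (c (t + h)) \<le> S' * h"
    using initial_speed[OF t ex S eps(1)] unfolding eventually_at_right_field S'_def by auto
  define C where "C = abs lam/2 * (2 * S')^2 + abs lam/2 * S'^2"
  have "((\<lambda>h. C * h) \<longlongrightarrow> C * 0) (at_right 0)" by (intro tendsto_intros)
  then have "\<forall>\<^sub>F h in at_right 0. C * h < \<eta> * \<delta> / 8" by (rule order_tendstoD) (use \<eta> \<delta> in simp)
  moreover have "\<forall>\<^sub>F h in at_right 0. h \<in> {0<..<min b T}" using b(1) T by (intro eventually_at_right_real) auto
  ultimately show ?thesis
  proof eventually_elim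
    case (elim h)
    then have h: "0 < h" "h < b" "h \<le> T" by auto
    show ?case
    proof (rule ccontr)
      assume neg: "\<not> ?case"
      have SS': "S \<le> S'" "0 < S'" using eps S0 by (auto simp: S'_def)
      define w where "w = g h"
      have dw: "dist (c t) w = S * h" using geo_germ_dist0[OF g, of h] h by (simp add: w_def)
      have Ew: "E w \<le> ereal (ex - h * (S * (S - eps)))" unfolding w_def using h by (intro Eg) auto
      then have "E w < \<infinity>" by auto
      then obtain ew where ew: "E w = ereal ew" by (rule finiteE)
      have ew_le: "ew - ex \<le> - (h * (S * (S - eps)))" using Ew ew by simp
      have speed: "dist (c t) (c (t + r)) \<le> S' * r" if "0 < r" "r \<le> h" for r using that h b(2)[of r] by auto
      have dist_w: "dist (c (t + r)) w \<le> 2 * S' * h" if r: "0 < r" "r \<le> h" for r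
      proof -
        have "dist (c (t + r)) w \<le> dist (c t) (c (t + r)) + dist (c t) w" by (rule dist_triangle3)
        also have "\<dots> \<le> S' * h + S' * h"
        proof (rule add_mono)
          have "S' * r \<le> S' * h" using r SS' by (intro mult_left_mono) auto
          then show "dist (c t) (c (t + r)) \<le> S' * h" using speed[OF r] by linarith
          show "dist (c t) w \<le> S' * h" unfolding dw using SS' h by (intro mult_right_mono) auto
        qed
        finally show ?thesis by simp
      qed
      define m1 where "m1 = (1 - \<eta>) * h"
      have m1: "0 < m1" "m1 < h" using \<eta> h by (auto simp: m1_def)
      define P where "P = abs lam/2 * (2 * S' * h)^2"
      define P' where "P' = abs lam/2 * (S' * h)^2"
      have PC: "P + P' = C * h^2" by (simp add: P_def P'_def C_def power2_eq_square algebra_simps)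
      have P0: "0 \<le> P" "0 \<le> P'" by (auto simp: P_def P'_def)
      have lamw: "- (lam/2 * (dist (c (t + r)) w)^2) \<le> P" if "0 < r" "r \<le> h" for r
        unfolding P_def by (rule abs_lam_bound[OF _ dist_w[OF that]]) simp
      \<comment> \<open>On the first interval the energy is bounded below by slope and speed, at
        time \<open>r\<close> by about \<open>ex - S * S' * r\<close>.\<close>
      have step1: "(dist (c (t + m1)) w)^2 / 2 - (dist (c t) w)^2 / 2
          \<le> (ew - ex + P + P') * (t + m1 - t) + (S * S') * (t + m1 - t)^2 / 2"
      proof (rule evi_step[OF t _ ew])
        fix u assume u: "t < u" "u < t + m1"
        define r where "r = u - t"
        have r: "0 < r" "r \<le> h" "u = t + r" using u m1 by (auto simp: r_def)
        define d where "d = dist (c t) (c u)"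
        have d: "0 \<le> d" "d \<le> S' * r" using speed[OF r(1,2)] by (auto simp: d_def r(3))
        have dh: "d \<le> S' * h"
        proof -
          have "S' * r \<le> S' * h" using r SS' by (intro mult_left_mono) auto
          then show ?thesis using d by linarith
        qed
        have "S * d \<le> S * (S' * r)" using d S0 by (intro mult_left_mono) auto
        moreover have "- (lam/2 * d^2) \<le> P'" unfolding P'_def by (rule abs_lam_bound[OF d(1) dh])
        moreover have "- (lam/2 * (dist (c u) w)^2) \<le> P" using lamw[OF r(1,2)] r(3) by simp
        moreover have "S * S' * (u - t) = S * (S' * r)" using r by simp
        ultimately have "ew - lam/2 * (dist (c u) w)^2 - (ew - ex + P + P' + S * S' * (u - t)) \<le> ex - S * d + lam/2 * d^2" by linarith
        then have "ereal (ew - lam/2 * (dist (c u) w)^2 - (ew - ex + P + P' + S * S' * (u - t))) \<le> ereal (ex - S * d + lam/2 * d^2)" by simp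
        also have "\<dots> \<le> E (c u)" using slope_global_bound[OF ex S, of "c u"] by (simp add: d_def)
        finally show "ereal (ew - lam/2 * (dist (c u) w)^2 - (ew - ex + P + P' + S * S' * (u - t))) \<le> E (c u)" .
      qed (use m1 S0 SS' in auto)
      \<comment> \<open>On the last interval, of length \<open>\<eta> * h\<close>, the negated claim
        at time \<open>h\<close> and monotonicity give the better bound
        \<open>ex - (S^2 - \<delta>) * h\<close>.\<close>
      have step2: "(dist (c (t + h)) w)^2 / 2 - (dist (c (t + m1)) w)^2 / 2
          \<le> (ew - ex + (S^2 - \<delta>) * h + P) * (t + h - (t + m1)) + 0 * (t + h - (t + m1))^2 / 2"
      proof (rule evi_step[OF _ _ ew])
        fix u assume u: "t + m1 < u" "u < t + h"
        define r where "r = u - t"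
        have r: "0 < r" "r \<le> h" "u = t + r" using u m1 by (auto simp: r_def)
        have "- (lam/2 * (dist (c u) w)^2) \<le> P" using lamw[OF r(1,2)] r(3) by simp
        then have "ereal (ew - lam/2 * (dist (c u) w)^2 - (ew - ex + (S^2 - \<delta>) * h + P + 0 * (u - (t + m1)))) \<le> ereal (ex - (S^2 - \<delta>) * h)" by simp
        also have "\<dots> \<le> E (c (t + h))" using neg by simp
        also have "\<dots> \<le> E (c u)" using u t m1 by (intro energy_nonincreasing) auto
        finally show "ereal (ew - lam/2 * (dist (c u) w)^2 - (ew - ex + (S^2 - \<delta>) * h + P + 0 * (u - (t + m1)))) \<le> E (c u)" .
      qed (use t m1 in auto)
      have "- ((S * h)^2 / 2) \<le> (dist (c (t + h)) w)^2 / 2 - (dist (c t) w)^2 / 2" by (simp add: dw)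
      also have "\<dots> \<le> (ew - ex + P + P') * m1 + (S * S') * m1^2 / 2 + (ew - ex + (S^2 - \<delta>) * h + P) * (h - m1)"
        using step1 step2 by simp
      also have "\<dots> = (ew - ex + P) * h + P' * m1 + (S * S') * m1^2 / 2 + (S^2 - \<delta>) * h * (h - m1)"
        by (simp add: algebra_simps)
      also have "\<dots> \<le> (- (h * (S * (S - eps))) + P) * h + P' * h + (S * S') * m1^2 / 2 + (S^2 - \<delta>) * h * (h - m1)"
        using ew_le P0 m1 h by (intro add_mono mult_right_mono mult_left_mono order_refl) auto
      also have "\<dots> = h^2 * (- (S * (S - eps)) + (S * S') * (1 - \<eta>)^2 / 2 + (S^2 - \<delta>) * \<eta>) + (P + P') * h"
        by (simp add: m1_def power2_eq_square algebra_simps)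
      also have "(P + P') * h = h^2 * (C * h)" unfolding PC by simp
      finally have "h^2 * (- (S^2 / 2)) \<le> h^2 * (- (S * (S - eps)) + (S * S') * (1 - \<eta>)^2 / 2 + (S^2 - \<delta>) * \<eta> + C * h)"
        by (simp add: power_mult_distrib algebra_simps)
      then have "- (S^2 / 2) \<le> - (S * (S - eps)) + (S * S') * (1 - \<eta>)^2 / 2 + (S^2 - \<delta>) * \<eta> + C * h"
        using h by (simp only: mult_le_cancel_left_pos zero_less_power)
      moreover have "(S * S') * (1 - \<eta>)^2 / 2 \<le> S^2 * (1 - \<eta>)^2 / 2 + S * eps"
      proof -
        have "(1 - \<eta>)^2 \<le> 1" using \<eta> by (intro power_le_one) auto
        then have "S * eps * (1 - \<eta>)^2 \<le> S * eps * 1" using S0 eps by (intro mult_left_mono) auto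
        moreover have "0 \<le> S * eps" using S0 eps by simp
        moreover have "(S * S') * (1 - \<eta>)^2 = S^2 * (1 - \<eta>)^2 + S * eps * (1 - \<eta>)^2"
          by (simp add: S'_def power2_eq_square algebra_simps)
        ultimately show ?thesis by linarith
      qed
      moreover have "S^2 * (1 - \<eta>)^2 / 2 = S^2 / 2 - S^2 * \<eta> + S^2 * \<eta> * \<eta> / 2" by (simp add: power2_eq_square field_simps)
      moreover have "S^2 * \<eta> * \<eta> \<le> \<delta> * \<eta>" using \<eta> by (intro mult_right_mono) auto
      moreover have "- (S * (S - eps)) = - (S^2) + S * eps" by (simp add: power2_eq_square algebra_simps)
      moreover have "(S^2 - \<delta>) * \<eta> = S^2 * \<eta> - \<delta> * \<eta>" by (simp add: algebra_simps)
      moreover have "\<delta> * \<eta> = \<eta> * \<delta>" by simp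
      moreover have "0 < \<eta> * \<delta>" using \<eta> \<delta> by simp
      ultimately show False using eps(2) elim(1) by linarith
    qed
  qed
qed

end

section \<open>Domains, minimal elements and right derivatives put together\<close>

theorem theorem3p10:
  fixes \<kappa> lam :: real and E :: "'a::complete_space \<Rightarrow> ereal"
    and y :: 'a and c :: "real \<Rightarrow> 'a"
  assumes "locally_CAT \<kappa> TYPE('a)"
    and "\<forall>x. E x \<noteq> -\<infinity>"
    and "lambda_convex lam E"
    and "lsc E"
    and "y \<in> closure (effdom E)"
    and "gf_trajectory lam E y c"
    and "c 0 = y"
  shows "(\<forall>t>0. dq_converges_to_min lam E c t)
    \<and> (dq_converges_to_min lam E c 0 \<longleftrightarrow> y \<in> slope_dom E)
    \<and> msubdiff_dom lam E = slope_dom E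
    \<and> (\<forall>z\<in>effdom E.
         (msubdiff lam E z = {} \<and> slope E z = \<infinity>) \<or>
         (\<exists>v. min_norm_elem lam E z v \<and> slope E z = ereal (tnorm z v)))
    \<and> effdom E \<subseteq> closure (msubdiff_dom lam E)"
proof -
  have conv: "lambda_convex_function lam E"
    using assms(1-3) by unfold_locales (auto simp: locally_CAT_def)
  interpret lambda_convex_function lam E by (rule conv)
  have "effdom E \<noteq> {}" using assms(5) by auto
  then interpret evi_flow lam E c
    using assms(4,6,7) by unfold_locales (auto simp: gf_trajectory_def)
  have at_point: "\<exists>r K. lambda_convex_at z r K lam E ez" if "E z = ereal ez" for z ez
  proof -
    obtain r K where "near_cat0 z r K" using locally_CAT_near_cat0[OF assms(1)] .
    then have "lambda_convex_at z r K lam E ez" using that by unfold_locales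
    then show ?thesis by blast
  qed
  have ex_min: "\<exists>v. min_norm_elem lam E z v \<and> slope E z = ereal (tnorm z v)"
    if z: "E z < \<infinity>" "slope E z < \<infinity>" for z
  proof -
    obtain ez where ez: "E z = ereal ez" using z(1) by (rule finiteE)
    then obtain r K where "lambda_convex_at z r K lam E ez" using at_point by blast
    then interpret Z: lambda_convex_at z r K lam E ez .
    obtain S where S: "slope E z = ereal S" using z(2) slope_nonneg[of z] by (cases "slope E z") auto
    obtain v where v: "v \<in> msubdiff lam E z" "tnorm z v = S" using Z.ex_msubdiff_slope[OF S] .
    have "min_norm_elem lam E z v"
      unfolding min_norm_elem_def using v Z.msubdiff_slope_le S by auto
    then show ?thesis using v S by auto
  qed
  have empty: "msubdiff lam E z = {}" if "\<not> (E z < \<infinity> \<and> slope E z < \<infinity>)" for z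
  proof (rule ccontr)
    assume "msubdiff lam E z \<noteq> {}"
    then obtain v where v: "v \<in> msubdiff lam E z" by auto
    then have "E z < \<infinity>" by (simp add: msubdiff_def)
    then obtain ez where ez: "E z = ereal ez" by (rule finiteE)
    then obtain r K where "lambda_convex_at z r K lam E ez" using at_point by blast
    then interpret Z: lambda_convex_at z r K lam E ez .
    have "slope E z < \<infinity>" using Z.msubdiff_slope_le[OF v] by auto
    then show False using that \<open>E z < \<infinity>\<close> by simp
  qed
  have dom_eq: "msubdiff_dom lam E = slope_dom E"
    using ex_min empty by (force simp: msubdiff_dom_def slope_dom_def min_norm_elem_def)
  \<comment> \<open>A single argument serves \<open>t = 0\<close> and \<open>t > 0\<close>; at
    positive times the two finiteness conditions hold automatically.\<close>
  have conv_at: "dq_converges_to_min lam E c t" if t: "0 \<le> t" and fin: "E (c t) < \<infinity>" "slope E (c t) < \<infinity>" for t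
    unfolding dq_converges_to_min_def
  proof (intro conjI allI impI)
    obtain v0 where v0: "min_norm_elem lam E (c t) v0" "slope E (c t) = ereal (tnorm (c t) v0)" using ex_min[OF fin] by blast
    show "\<exists>v. min_norm_elem lam E (c t) v" using v0 by blast
    fix v assume v: "min_norm_elem lam E (c t) v"
    obtain ex where ex: "E (c t) = ereal ex" using fin(1) by (rule finiteE)
    then obtain r K where "lambda_convex_at (c t) r K lam E ex" using at_point by blast
    then interpret Z: lambda_convex_at "c t" r K lam E ex .
    define S where "S = tnorm (c t) v"
    \<comment> \<open>Any two elements of minimal norm have the same norm, and for \<open>v0\<close>
      that norm is the slope; so it is the slope for the given \<open>v\<close> too.\<close>
    have S: "slope E (c t) = ereal S" using v v0 unfolding min_norm_elem_def S_def by (metis antisym)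
    show "((\<lambda>h. tdist (tscale (1 / h) (tvec (Geo (c t) (c (t + h))))) v) \<longlongrightarrow> 0) (at_right 0)"
    proof (rule Z.difference_quotient_tendsto)
      show "v \<in> msubdiff lam E (c t)" using v by (simp add: min_norm_elem_def)
      show "tnorm (c t) v = S" by (simp add: S_def)
      fix e :: real assume e: "0 < e"
      show "\<forall>\<^sub>F h in at_right 0. dist (c t) (c (t + h)) \<le> (S + e) * h" by (rule initial_speed[OF t ex S e])
      show "\<forall>\<^sub>F h in at_right 0. E (c (t + h)) \<le> ereal (ex - (S^2 - e) * h)"
        by (rule initial_energy_drop[OF t ex S e Z.ex_steep_geodesic[OF S]])
    qed
  qed
  show ?thesis
  proof (intro conjI allI impI ballI dom_eq)
    fix t :: real assume "0 < t"
    then show "dq_converges_to_min lam E c t" using conv_at energy_finite slope_finite by simp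
  next
    show "dq_converges_to_min lam E c 0 \<longleftrightarrow> y \<in> slope_dom E"
    proof
      \<comment> \<open>The convergence statement includes existence of a minimal element, so the
        equality of domains already yields finite slope.\<close>
      assume "dq_converges_to_min lam E c 0"
      then have "y \<in> msubdiff_dom lam E"
        using assms(7) by (auto simp: dq_converges_to_min_def msubdiff_dom_def min_norm_elem_def)
      then show "y \<in> slope_dom E" using dom_eq by simp
    next
      assume "y \<in> slope_dom E"
      then show "dq_converges_to_min lam E c 0" using conv_at[of 0] assms(7) by (simp add: slope_dom_def)
    qed
  next
    fix z assume "z \<in> effdom E"
    then show "(msubdiff lam E z = {} \<and> slope E z = \<infinity>) \<or> (\<exists>v. min_norm_elem lam E z v \<and> slope E z = ereal (tnorm z v))"
      using ex_min[of z] empty[of z] by (cases "slope E z < \<infinity>") (auto simp: effdom_def)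
  next
    show "effdom E \<subseteq> closure (msubdiff_dom lam E)"
    proof
      fix z assume "z \<in> effdom E"
      then have z: "E z < \<infinity>" by (simp add: effdom_def)
      show "z \<in> closure (msubdiff_dom lam E)"
        unfolding closure_approachable dom_eq
      proof (intro allI impI)
        fix e :: real assume "0 < e"
        then show "\<exists>w\<in>slope_dom E. dist w z < e"
          using ex_finite_slope_near[OF conv assms(4) z] by (auto simp: slope_dom_def dist_commute)
      qed
    qed
  qed
qed

end
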